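(* Let $\tilde\alpha,\tilde\beta\in\mathbb{C}$ and let $(\tau_n)_{n\in\mathbb{Z}}$ be nonzero complex numbers satisfying $\tau_{n+3}\tau_{n-2}=\tilde\alpha\,\tau_{n+2}\tau_{n-1}+\tilde\beta\,\tau_{n+1}\tau_n$ for all $n$. Put $h_n=\tau_{n+2}\tau_{n-1}/(\tau_{n+1}\tau_n)$ and $\tilde J=h_{-1}+h_0+\tilde\alpha\big(\frac1{h_{-1}}+\frac1{h_0}\big)+\frac{\tilde\beta}{h_{-1}h_0}$. Define $$\tilde\mu=(\tilde\beta+\tilde\alpha\tilde J)^{1/4},\quad \tilde\lambda=\frac{1}{3\tilde\mu^2}\Big(\frac{\tilde J^2}{4}+\tilde\alpha\Big),\quad g_2=12\tilde\lambda^2-2\tilde J,\quad g_3=4\tilde\lambda^3-g_2\tilde\lambda-\tilde\mu^2,\quad x_0=\tilde\lambda+\frac{\tilde\mu^2}{h_{-1}+h_0-\tilde J}$$ (assuming nonzero denominators and a nonsingular curve), and let $\kappa,z_0\in\mathbb{C}$ satisfy $\wp(\kappa)=\tilde\lambda$, $\wp'(\kappa)=\tilde\mu$, $\wp(z_0)=x_0$, $\wp'(\kappa)\wp'(z_0)=(x_0-\tilde\lambda)(h_{-1}-h_0)$, where $\wp=\wp(\cdot;g_2,g_3)$. Set $$g_2^*=\tilde\mu^4g_2,\quad g_3^*=\tilde\mu^6g_3,\quad u_0=z_0/\tilde\mu,\quad v=\kappa/\tilde\mu,$$ and let $\sigma(u)=\sigma(u;g_2^*,g_3^* )$ be the Weierstrass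 sigma function of the curve $E^*:\ y^2=4x^3-g_2^*x-g_3^*$. Define $$A_+=\frac{\tau_0}{\sigma(u_0)},\quad A_-=\frac{\tau_1}{\sigma(u_0+v)},\quad B_+=\frac{\sigma(2v)\sigma(u_0)\tau_2}{\sigma(u_0+2v)\tau_0},\quad B_-=\frac{\sigma(2v)\sigma(u_0+v)\tau_3}{\sigma(u_0+3v)\tau_1}.$$ Then for all $n\in\mathbb{Z}$, $$\tau_{2n}=A_+B_+^n\frac{\sigma(u_0+2nv)}{\sigma(2v)^{n^2}},\qquad \tau_{2n+1}=A_-B_-^n\frac{\sigma(u_0+(2n+1)v)}{\sigma(2v)^{n^2}},$$ and $B_+/B_-=-\sigma(2v)$; in particular the solution is determined by the seven parameters $g_2^*,g_3^*,u_0,v,A_+,A_-,B_+$.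
   Context: $\sigma(z;g_2,g_3)$ and $\wp(z;g_2,g_3)$ denote the Weierstrass sigma and elliptic functions associated with the curve $y^2=4x^3-g_2x-g_3$. *)

theory Defs
  imports "HOL-Complex_Analysis.Complex_Analysis"
begin

text \<open>
  Weierstrass functions with prescribed invariants. The condition \<open>Im (\<omega>\<^sub>2 / \<omega>\<^sub>1) \<noteq> 0\<close>
  says that the generators are linearly independent over the reals; it forces \<open>\<omega>\<^sub>1 \<noteq> 0\<close>
  because \<open>x / 0 = 0\<close>.
\<close>

definition is_lattice :: "complex set \<Rightarrow> bool" where
  "is_lattice L \<longleftrightarrow>
     (\<exists>\<omega>\<^sub>1 \<omega>\<^sub>2. Im (\<omega>\<^sub>2 / \<omega>\<^sub>1) \<noteq> 0 \<and>
        L = {of_int m * \<omega>\<^sub>1 + of_int n * \<omega>\<^sub>2 | m n. True})"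

definition eisenstein_sum :: "nat \<Rightarrow> complex set \<Rightarrow> complex" where
  "eisenstein_sum k L = (\<Sum>\<^sub>\<infinity>\<omega>\<in>L - {0}. 1 / \<omega> ^ k)"

text \<open>
  The period lattice of the curve \<open>y\<^sup>2 = 4x\<^sup>3 - g\<^sub>2x - g\<^sub>3\<close>. It exists and is unique when
  \<open>g\<^sub>2\<^sup>3 \<noteq> 27g\<^sub>3\<^sup>2\<close>, i.e. when the curve is nonsingular; otherwise the value is unspecified.
\<close>

definition period_lattice :: "complex \<Rightarrow> complex \<Rightarrow> complex set" where
  "period_lattice g\<^sub>2 g\<^sub>3 =
     (THE L. is_lattice L \<and> g\<^sub>2 = 60 * eisenstein_sum 4 L \<and> g\<^sub>3 = 140 * eisenstein_sum 6 L)"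

text \<open>
  The value of \<open>weierstrass_p\<close> at a lattice point (a pole) carries no meaning, so an equation
  \<open>\<wp>(z) = x\<close> of the usual kind has to be accompanied by the condition that \<open>z\<close> is not in
  the lattice.
\<close>

definition weierstrass_p :: "complex \<Rightarrow> complex \<Rightarrow> complex \<Rightarrow> complex" where
  "weierstrass_p g\<^sub>2 g\<^sub>3 z =
     1 / z\<^sup>2 + (\<Sum>\<^sub>\<infinity>\<omega>\<in>period_lattice g\<^sub>2 g\<^sub>3 - {0}. 1 / (z - \<omega>)\<^sup>2 - 1 / \<omega>\<^sup>2)"

text \<open>
  The infinite product over the nonzero lattice points is the unconditional one: the limit of
  the finite subproducts along the net of finite subsets, as for \<^const>\<open>infsum\<close>.
\<close>

definition weierstrass_sigma :: "complex \<Rightarrow> complex \<Rightarrow> complex \<Rightarrow> complex" where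
  "weierstrass_sigma g\<^sub>2 g\<^sub>3 z =
     z * Lim (finite_subsets_at_top (period_lattice g\<^sub>2 g\<^sub>3 - {0}))
           (\<lambda>F. \<Prod>\<omega>\<in>F. (1 - z / \<omega>) * exp (z / \<omega> + z\<^sup>2 / (2 * \<omega>\<^sup>2)))"

text \<open>
  The sequence built from seven parameters. For odd indices the growth factor is
  \<open>- B / \<sigma>(2v)\<close>, which is what the relation \<open>B\<^sub>+ / B\<^sub>- = - \<sigma>(2v)\<close> forces.
\<close>

definition somos5_sigma_sequence ::
  "complex \<Rightarrow> complex \<Rightarrow> complex \<Rightarrow> complex \<Rightarrow> complex \<Rightarrow> complex \<Rightarrow> complex \<Rightarrow> int \<Rightarrow> complex"
where
  "somos5_sigma_sequence g\<^sub>2 g\<^sub>3 u v A A' B k =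
     (let \<sigma> = weierstrass_sigma g\<^sub>2 g\<^sub>3; n = k div 2 in
      (if even k then A * B powi n else A' * (- B / \<sigma> (2 * v)) powi n) *
      \<sigma> (u + of_int k * v) / \<sigma> (2 * v) powi n\<^sup>2)"

end

theory Submission
  imports Defs
begin

text \<open>
  For a lattice with sigma function \<open>\<sigma>\<close>, the function
  \<open>R z = C \<sigma>(z + 2\<kappa>) \<sigma>(z - \<kappa>) / (\<sigma>(z + \<kappa>) \<sigma>(z))\<close> with \<open>C = - \<wp>'(\<kappa>) / \<sigma>(2\<kappa>)\<close> is elliptic, and the addition
  formulas express \<open>R z\<close> and \<open>R (z - \<kappa>)\<close> through \<open>\<wp>(z)\<close> and \<open>\<wp>'(z)\<close> in exactly the way in which
  \<open>h\<^sub>0\<close> and \<open>h\<^sub>-\<^sub>1\<close> are expressed through \<open>x\<^sub>0\<close>. The pair \<open>(R (z - \<kappa>), R z)\<close> moves on the invariant curve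
  of the map \<open>h\<^sub>n\<^sub>+\<^sub>1 h\<^sub>n h\<^sub>n\<^sub>-\<^sub>1 = \<alpha> h\<^sub>n + \<beta>\<close>, so the sigma products satisfy the Somos-5 recurrence up to a
  gauge factor, and a solution without zeros is determined by five consecutive values.

  All addition formulas are derived from one identity for
  \<open>\<zeta>(a) + \<zeta>(b) + \<zeta>(c) - \<zeta>(a + b + c)\<close>, an elliptic function of \<open>a\<close> whose zeros are visible.
  That the period lattice of a nonsingular curve exists amounts to the surjectivity of the modular
  invariant \<open>j\<close> on the upper half plane: its image is open because \<open>j\<close> is holomorphic and not constant,
  and closed because \<open>j\<close> tends to infinity at the cusp of the fundamental domain.
\<close>

section \<open>Infinite sums and lattices\<close>

text \<open>\<open>period_lattice\<close> is a definite description, so the hypotheses on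
  \<open>\<kappa>\<close> and \<open>z\<^sub>0\<close> become usable only once a lattice with the
  given invariants is known to exist and to be unique; this accounts for the long analytic part. R
  is elliptic because its zeros -2\<kappa>, \<kappa> and its poles -\<kappa>, 0 have the same sum.
  The formulas for the parameters are its properties read backwards: g2 is chosen so that J =
  \<wp>''(\<kappa>), g3 so that (lam, \<mu>) lies on the curve, and \<mu> and lam solve the
  relations that express the coefficients of the invariant curve through them. Rescaling by \<mu>
  turns C into -1/\<sigma>(2v), the source of the powers of \<sigma>(2v) and of the sign in the
  final ratio. The gauge acts separately on even and odd indices, hence two amplitudes. The addition
  formulas break down at lattice points; the central ones are multiplied out into identities between
  entire functions, proved off a countable set and extended by continuity.\<close>

lemma infsum_holomorphic_deriv:
  fixes f f' :: "'i \<Rightarrow> complex \<Rightarrow> complex"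
  assumes "open S"
    and der: "\<And>i z. i \<in> I \<Longrightarrow> z \<in> S \<Longrightarrow> (f i has_field_derivative f' i z) (at z)"
    and bound: "\<And>i z. i \<in> I \<Longrightarrow> z \<in> S \<Longrightarrow> norm (f i z) \<le> M i"
    and "M summable_on I" and "z \<in> S"
  shows "((\<lambda>z. \<Sum>\<^sub>\<infinity>i\<in>I. f i z) has_field_derivative (\<Sum>\<^sub>\<infinity>i\<in>I. f' i z)) (at z)"
proof -
  obtain r where r: "r > 0" "cball z r \<subseteq> S"
    using \<open>open S\<close> \<open>z \<in> S\<close> open_contains_cball by blast
  have ul: "uniform_limit (cball z r) (\<lambda>X y. \<Sum>x\<in>X. f x y) (\<lambda>y. \<Sum>\<^sub>\<infinity>x\<in>I. f x y) (finite_subsets_at_top I)"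
    by (rule Weierstrass_m_test_general[OF _ \<open>M summable_on I\<close>]) (use bound r in auto)
  have ev: "\<forall>\<^sub>F X in finite_subsets_at_top I. continuous_on (cball z r) (\<lambda>y. \<Sum>x\<in>X. f x y) \<and>
      (\<forall>w\<in>ball z r. ((\<lambda>y. \<Sum>x\<in>X. f x y) has_field_derivative (\<Sum>x\<in>X. f' x w)) (at w))"
  proof (rule eventually_finite_subsets_at_top_weakI)
    fix X assume X: "finite X" "X \<subseteq> I"
    have *: "((\<lambda>y. \<Sum>x\<in>X. f x y) has_field_derivative (\<Sum>x\<in>X. f' x w)) (at w)" if "w \<in> S" for w
      by (intro DERIV_sum der) (use X that in auto)
    have "continuous_on (cball z r) (\<lambda>y. \<Sum>x\<in>X. f x y)"
      by (rule continuous_at_imp_continuous_on) (use * r DERIV_isCont in blast)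
    then show "continuous_on (cball z r) (\<lambda>y. \<Sum>x\<in>X. f x y) \<and>
      (\<forall>w\<in>ball z r. ((\<lambda>y. \<Sum>x\<in>X. f x y) has_field_derivative (\<Sum>x\<in>X. f' x w)) (at w))"
      using * r ball_subset_cball by blast
  qed
  \<comment> \<open>For holomorphic functions locally uniform convergence carries over to the
    derivatives, so the majorant of \<open>f\<close> also controls the sum of
    \<open>f'\<close>.\<close>
  obtain g' where g': "\<And>w. w \<in> ball z r \<Longrightarrow> ((\<lambda>y. \<Sum>\<^sub>\<infinity>x\<in>I. f x y) has_field_derivative (g' w)) (at w) \<and>
       ((\<lambda>X. \<Sum>x\<in>X. f' x w) \<longlongrightarrow> g' w) (finite_subsets_at_top I)"
    by (rule has_complex_derivative_uniform_limit[OF ev ul finite_subsets_at_top_neq_bot r(1)]) blast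
  have "((\<lambda>i. f' i z) has_sum g' z) I"
    using g'[of z] r by (simp add: has_sum_def)
  then show ?thesis
    using g'[of z] r by (simp add: infsumI)
qed

lemma infsum_holomorphic:
  fixes f :: "'i \<Rightarrow> complex \<Rightarrow> complex"
  assumes "open S" "\<And>i. i \<in> I \<Longrightarrow> f i holomorphic_on S"
    "\<And>i z. i \<in> I \<Longrightarrow> z \<in> S \<Longrightarrow> norm (f i z) \<le> M i" "M summable_on I"
  shows "(\<lambda>z. \<Sum>\<^sub>\<infinity>i\<in>I. f i z) holomorphic_on S"
proof -
  have "((\<lambda>z. \<Sum>\<^sub>\<infinity>i\<in>I. f i z) has_field_derivative (\<Sum>\<^sub>\<infinity>i\<in>I. deriv (f i) z)) (at z)" if "z \<in> S" for z
    using assms(1) holomorphic_derivI[OF assms(2) assms(1)] assms(3,4) that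
    by (rule infsum_holomorphic_deriv)
  then show ?thesis
    by (meson assms(1) holomorphic_on_open)
qed

lemma summable_on_norm_le:
  fixes f :: "'i \<Rightarrow> 'a::banach"
  assumes "M summable_on I" "\<And>i. i \<in> I \<Longrightarrow> norm (f i) \<le> M i"
  shows "f summable_on I"
proof -
  have "(\<lambda>i. norm (f i)) summable_on I"
    using assms(1) by (rule summable_on_comparison_test) (use assms(2) in auto)
  then show ?thesis by (rule abs_summable_summable)
qed

text \<open>A countable set has dense complement, since no disc is countable. Identities can
  therefore be proved for generic arguments, away from lattice points and their translates.\<close>

lemma eq_on_open_if_eq_off_countable:
  fixes f g :: "complex \<Rightarrow> complex"
  assumes "open S" "continuous_on S f" "continuous_on S g" "countable T"
    and "\<And>z. z \<in> S \<Longrightarrow> z \<notin> T \<Longrightarrow> f z = g z" and "z \<in> S"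
  shows "f z = g z"
proof (rule ccontr)
  assume ne: "f z \<noteq> g z"
  have "open (S \<inter> (\<lambda>z. f z - g z) -` (- {0}))"
    by (intro continuous_open_preimage continuous_on_diff assms(1-3) open_Compl closed_singleton)
  also have "S \<inter> (\<lambda>z. f z - g z) -` (- {0}) = {w\<in>S. f w - g w \<noteq> 0}"
    by auto
  finally have op: "open {w\<in>S. f w - g w \<noteq> 0}" .
  have "z \<in> {w\<in>S. f w - g w \<noteq> 0}" using ne assms by auto
  then obtain e where e: "e > 0" "ball z e \<subseteq> {w\<in>S. f w - g w \<noteq> 0}"
    using op openE by blast
  then have "ball z e \<subseteq> T"
    using assms by auto
  then show False
    using assms(4) countable_subset uncountable_ball[OF e(1)] by blast
qed

text \<open>The plane stays connected when a closed countable set is removed. With \<open>T\<close>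
  a lattice, this turns a derivative computed off the poles into constancy.\<close>

lemma constant_on_open_diff_countable:
  fixes f :: "complex \<Rightarrow> complex"
  assumes "countable T" "closed T" "\<And>z. z \<notin> T \<Longrightarrow> (f has_field_derivative 0) (at z)"
    "a \<notin> T" "b \<notin> T"
  shows "f a = f b"
proof -
  have "connected (UNIV - T :: complex set)"
    by (rule connected_open_diff_countable) (use assms in auto)
  then have c: "connected (- T)" by (simp add: Compl_eq_Diff_UNIV)
  have "\<exists>c. \<forall>x\<in>-T. f x = c"
    using has_field_derivative_0_imp_constant_on[OF _ c, of f] assms(2,3)
    by (simp add: constant_on_def open_Compl)
  then show ?thesis using assms(4,5) by fastforce
qed

text \<open>The bound on the regular part of a two-dimensional lattice sum: \<open>X\<^sup>-\<^sup>3\<close> is dominated by a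
  product of one-dimensional summable families as soon as \<open>X\<close> dominates both factors.\<close>

definition int_weight :: "int \<Rightarrow> real" where
  "int_weight n = max 1 \<bar>of_int n\<bar>"

lemma int_weight_ge_1: "int_weight n \<ge> 1" and int_weight_pos [simp]: "int_weight n > 0"
  by (auto simp: int_weight_def)

definition pair_weight :: "int \<times> int \<Rightarrow> real" where
  "pair_weight p = int_weight (fst p) powr (- 3 / 2) * int_weight (snd p) powr (- 3 / 2)"

lemma summable_on_int_weight_powr: "(\<lambda>n. int_weight n powr (- 3 / 2)) summable_on UNIV"
proof -
  have s: "summable (\<lambda>n::nat. real n powr (-3/2))"
    by (simp add: summable_real_powr_iff)
  have "(\<lambda>n::nat. real n powr (-3/2)) summable_on UNIV"
    using s by (subst summable_on_UNIV_nonneg_real_iff) auto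
  then have nat: "(\<lambda>n::nat. real n powr (-3/2)) summable_on {1..}"
    by (rule summable_on_subset_banach) auto
  have "(\<lambda>n. int_weight n powr (-3/2)) summable_on {1..}"
    by (rule iffD1[OF summable_on_reindex_bij_witness[of _ nat int] nat]) (auto simp: int_weight_def)
  moreover have "(\<lambda>n. int_weight n powr (-3/2)) summable_on {..-1}"
    by (rule iffD1[OF summable_on_reindex_bij_witness[of _ "\<lambda>n. nat (-n)" "\<lambda>n. - int n"] nat]) (auto simp: int_weight_def)
  ultimately have un: "(\<lambda>n. int_weight n powr (-3/2)) summable_on ({1..} \<union> {..-1})"
    by (intro summable_on_Un_disjoint) auto
  moreover have "(\<lambda>n. int_weight n powr (-3/2)) summable_on {0}" by simp
  ultimately have "(\<lambda>n. int_weight n powr (-3/2)) summable_on (({1..} \<union> {..-1}) \<union> {0})"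
    by (intro summable_on_Un_disjoint[OF un]) auto
  also have "({1..} \<union> {..-1}) \<union> {0::int} = UNIV" by auto
  finally show ?thesis .
qed

lemma summable_on_pair_weight: "pair_weight summable_on UNIV"
proof -
  let ?f = "\<lambda>n. int_weight n powr (- 3 / 2)"
  have "pair_weight summable_on (SIGMA m:UNIV. UNIV)"
  proof (rule summable_on_SigmaI)
    show "((\<lambda>n. pair_weight (m, n)) has_sum (?f m * (\<Sum>\<^sub>\<infinity>n. ?f n))) UNIV" for m
      unfolding pair_weight_def fst_conv snd_conv
      by (intro has_sum_cmult_right has_sum_infsum summable_on_int_weight_powr)
    show "(\<lambda>m. ?f m * (\<Sum>\<^sub>\<infinity>n. ?f n)) summable_on UNIV"
      by (intro summable_on_cmult_left summable_on_int_weight_powr)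
  qed (simp add: pair_weight_def)
  then show ?thesis by simp
qed

text \<open>The exponent 3 is shared equally between the two factors: 3/2 exceeds 1, so each
  one-dimensional series still converges.\<close>

lemma inverse_cube_le:
  fixes X p q :: real
  assumes "p > 0" "q > 0" "p \<le> X" "q \<le> X"
  shows "1 / X ^ 3 \<le> p powr (- 3 / 2) * q powr (- 3 / 2)"
proof -
  have X: "X > 0" using assms by auto
  have "X ^ 3 = X powr (3/2 + 3/2)" using X by (simp flip: powr_numeral)
  also have "\<dots> = X powr (3/2) * X powr (3/2)" by (rule powr_add)
  finally have "1 / X ^ 3 = X powr (- 3/2) * X powr (- 3/2)"
    by (simp add: powr_minus_divide)
  also have "\<dots> \<le> p powr (- 3 / 2) * q powr (- 3 / 2)"
    using assms by (intro mult_mono powr_mono2') auto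
  finally show ?thesis .
qed

text \<open>After division by \<open>\<omega>\<^sub>1\<close> the imaginary part of the point is
  \<open>b\<close> times that of the ratio of the generators.\<close>

lemma coordinate_mult_Im_le:
  assumes "\<omega>\<^sub>1 \<noteq> 0"
  shows "\<bar>b\<bar> * \<bar>Im (\<omega>\<^sub>2 / \<omega>\<^sub>1)\<bar> * cmod \<omega>\<^sub>1 \<le> cmod (of_real a * \<omega>\<^sub>1 + of_real b * \<omega>\<^sub>2)"
proof -
  have "of_real a * \<omega>\<^sub>1 + of_real b * \<omega>\<^sub>2 = \<omega>\<^sub>1 * (of_real a + of_real b * (\<omega>\<^sub>2 / \<omega>\<^sub>1))"
    using assms by (simp add: field_simps)
  then have "cmod (of_real a * \<omega>\<^sub>1 + of_real b * \<omega>\<^sub>2)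
      = cmod \<omega>\<^sub>1 * cmod (of_real a + of_real b * (\<omega>\<^sub>2 / \<omega>\<^sub>1))"
    by (simp add: norm_mult)
  moreover have "\<bar>b\<bar> * \<bar>Im (\<omega>\<^sub>2 / \<omega>\<^sub>1)\<bar> = \<bar>Im (of_real a + of_real b * (\<omega>\<^sub>2 / \<omega>\<^sub>1))\<bar>"
    by (simp add: abs_mult times_divide_eq_right[symmetric] del: times_divide_eq_right)
  moreover have "\<dots> \<le> cmod (of_real a + of_real b * (\<omega>\<^sub>2 / \<omega>\<^sub>1))"
    by (rule abs_Im_le_cmod)
  ultimately show ?thesis
    by (metis mult.commute mult_left_mono norm_ge_zero)
qed

lemma lattice_norm_ge:
  assumes "Im (\<omega>\<^sub>2 / \<omega>\<^sub>1) \<noteq> 0"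
  obtains c where "c > 0"
    "\<And>a b. c * \<bar>a\<bar> \<le> cmod (of_real a * \<omega>\<^sub>1 + of_real b * \<omega>\<^sub>2)"
    "\<And>a b. c * \<bar>b\<bar> \<le> cmod (of_real a * \<omega>\<^sub>1 + of_real b * \<omega>\<^sub>2)"
proof -
  have nz: "\<omega>\<^sub>1 \<noteq> 0" "\<omega>\<^sub>2 \<noteq> 0" using assms by auto
  \<comment> \<open>The other coordinate is bounded by exchanging the generators, which needs the
    inverse ratio to be non-real.\<close>
  have "Im (\<omega>\<^sub>1 / \<omega>\<^sub>2) \<noteq> 0"
  proof
    assume "Im (\<omega>\<^sub>1 / \<omega>\<^sub>2) = 0"
    then have "\<omega>\<^sub>1 / \<omega>\<^sub>2 \<in> \<real>" by (simp add: complex_is_Real_iff)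
    then have "inverse (\<omega>\<^sub>1 / \<omega>\<^sub>2) \<in> \<real>" by (rule Reals_inverse)
    then have "\<omega>\<^sub>2 / \<omega>\<^sub>1 \<in> \<real>" by (simp add: inverse_eq_divide)
    then show False using assms by (simp add: complex_is_Real_iff)
  qed
  define c1 where "c1 = \<bar>Im (\<omega>\<^sub>2 / \<omega>\<^sub>1)\<bar> * cmod \<omega>\<^sub>1"
  define c2 where "c2 = \<bar>Im (\<omega>\<^sub>1 / \<omega>\<^sub>2)\<bar> * cmod \<omega>\<^sub>2"
  have pos: "c1 > 0" "c2 > 0"
    using assms nz \<open>Im (\<omega>\<^sub>1 / \<omega>\<^sub>2) \<noteq> 0\<close> by (auto simp: c1_def c2_def)
  show ?thesis
  proof (rule that[of "min c1 c2"])
    fix a b :: real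
    have "min c1 c2 * \<bar>b\<bar> \<le> c1 * \<bar>b\<bar>" "min c1 c2 * \<bar>a\<bar> \<le> c2 * \<bar>a\<bar>"
      by (auto intro!: mult_right_mono)
    moreover have "c1 * \<bar>b\<bar> \<le> cmod (of_real a * \<omega>\<^sub>1 + of_real b * \<omega>\<^sub>2)"
      using coordinate_mult_Im_le[OF nz(1), of b \<omega>\<^sub>2 a] by (simp add: c1_def mult_ac)
    moreover have "c2 * \<bar>a\<bar> \<le> cmod (of_real a * \<omega>\<^sub>1 + of_real b * \<omega>\<^sub>2)"
      using coordinate_mult_Im_le[OF nz(2), of a \<omega>\<^sub>1 b] by (simp add: c2_def mult_ac add_ac)
    ultimately show "min c1 c2 * \<bar>a\<bar> \<le> cmod (of_real a * \<omega>\<^sub>1 + of_real b * \<omega>\<^sub>2)"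
      "min c1 c2 * \<bar>b\<bar> \<le> cmod (of_real a * \<omega>\<^sub>1 + of_real b * \<omega>\<^sub>2)" by linarith+
  qed (use pos in auto)
qed

lemma pair_norm_ge:
  fixes m n :: int and c X :: real
  assumes "c > 0" "(m, n) \<noteq> (0, 0)" "c * \<bar>of_int m\<bar> \<le> X" "c * \<bar>of_int n\<bar> \<le> X"
  shows "c \<le> X"
proof -
  have "1 \<le> \<bar>of_int m :: real\<bar> \<or> 1 \<le> \<bar>of_int n :: real\<bar>" using assms(2) by auto
  then have "c * 1 \<le> c * \<bar>of_int m\<bar> \<or> c * 1 \<le> c * \<bar>of_int n\<bar>"
    using assms(1) by (meson less_imp_le mult_left_mono)
  then show ?thesis using assms by linarith
qed

lemma pair_weight_bound:
  assumes "c > 0" "(m, n) \<noteq> (0, 0)" "c * \<bar>of_int m\<bar> \<le> X" "c * \<bar>of_int n\<bar> \<le> X"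
  shows "1 / X ^ 3 \<le> c powr (-3) * pair_weight (m, n)"
proof -
  have "c \<le> X" using pair_norm_ge[OF assms] .
  then have "c * int_weight m \<le> X" "c * int_weight n \<le> X"
    using assms \<open>c \<le> X\<close> by (simp_all add: int_weight_def max_def)
  then have "1 / X ^ 3 \<le> (c * int_weight m) powr (- 3 / 2) * (c * int_weight n) powr (- 3 / 2)"
    using assms by (intro inverse_cube_le) auto
  also have "\<dots> = c powr (-3/2 + -3/2) * pair_weight (m, n)"
    unfolding powr_add using assms by (simp add: pair_weight_def powr_mult)
  finally show ?thesis by simp
qed

text \<open>Injectivity of the parametrization is what allows sums over the lattice to be reindexed
  by pairs of integers.\<close>

lemma is_latticeE:
  assumes "is_lattice L"
  obtains \<omega>\<^sub>1 \<omega>\<^sub>2 where "Im (\<omega>\<^sub>2 / \<omega>\<^sub>1) \<noteq> 0"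
    "L = (\<lambda>(m, n). of_int m * \<omega>\<^sub>1 + of_int n * \<omega>\<^sub>2) ` UNIV"
    "inj (\<lambda>(m, n). of_int m * \<omega>\<^sub>1 + of_int n * \<omega>\<^sub>2)"
proof -
  obtain \<omega>\<^sub>1 \<omega>\<^sub>2 where w: "Im (\<omega>\<^sub>2 / \<omega>\<^sub>1) \<noteq> 0" "L = {of_int m * \<omega>\<^sub>1 + of_int n * \<omega>\<^sub>2 | m n. True}"
    using assms by (auto simp: is_lattice_def)
  obtain c where c: "c > 0" "\<And>a b. c * \<bar>a\<bar> \<le> cmod (of_real a * \<omega>\<^sub>1 + of_real b * \<omega>\<^sub>2)"
    "\<And>a b. c * \<bar>b\<bar> \<le> cmod (of_real a * \<omega>\<^sub>1 + of_real b * \<omega>\<^sub>2)"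
    using lattice_norm_ge[OF w(1)] by blast
  show ?thesis
  proof (rule that[OF w(1)])
    show "L = (\<lambda>(m, n). of_int m * \<omega>\<^sub>1 + of_int n * \<omega>\<^sub>2) ` UNIV" using w by auto
    show "inj (\<lambda>(m, n). of_int m * \<omega>\<^sub>1 + of_int n * \<omega>\<^sub>2)"
    proof (rule injI, clarify)
      fix m n m' n' :: int
      assume "of_int m * \<omega>\<^sub>1 + of_int n * \<omega>\<^sub>2 = of_int m' * \<omega>\<^sub>1 + of_int n' * \<omega>\<^sub>2"
      then have z: "of_real (of_int (m - m')) * \<omega>\<^sub>1 + of_real (of_int (n - n')) * \<omega>\<^sub>2 = 0"
        by (simp add: algebra_simps)
      have "\<bar>of_int (m - m')\<bar> \<le> (0::real)" "\<bar>of_int (n - n')\<bar> \<le> (0::real)"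
        using c(2)[of "of_int (m - m')" "of_int (n - n')"] c(3)[of "of_int (n - n')" "of_int (m - m')"]
        unfolding z using c(1) by (simp_all add: mult_le_0_iff)
      then show "m = m' \<and> n = n'" by auto
    qed
  qed
qed

section \<open>The Weierstrass functions of a lattice\<close>

lemma inverse_square_deriv:
  fixes z w c :: complex
  assumes "z \<noteq> w"
  shows "((\<lambda>z. 1 / (z - w)\<^sup>2 - c) has_field_derivative - 2 / (z - w) ^ 3) (at z)"
proof -
  have "((\<lambda>z. 1 / (z - w)\<^sup>2 - c) has_field_derivative (- (2 * (z - w)) / ((z - w)\<^sup>2 * (z - w)\<^sup>2))) (at z)"
    using assms by (auto intro!: derivative_eq_intros)
  moreover have "- (2 * (z - w)) / ((z - w)\<^sup>2 * (z - w)\<^sup>2) = - 2 / (z - w) ^ 3"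
  proof -
    have "- (2 * d) / (d\<^sup>2 * d\<^sup>2) = - 2 / d ^ 3" if "d \<noteq> 0" for d :: complex
      using that by (simp add: field_simps power2_eq_square power3_eq_cube)
    from this[of "z - w"] show ?thesis using assms by (simp only: right_minus_eq not_False_eq_True)
  qed
  ultimately show ?thesis by simp
qed

locale lattice =
  fixes L :: "complex set"
  assumes is_lattice: "is_lattice L"
begin

section \<open>Group structure and discreteness of a lattice\<close>

lemma zero_mem [simp]: "0 \<in> L"
proof -
  obtain a b where "L = (\<lambda>(m, n). of_int m * a + of_int n * b) ` UNIV"
    using is_lattice by (rule is_latticeE)
  then show ?thesis by (auto intro!: image_eqI[of _ _ "(0, 0)"])
qed

lemma add_mem: "x \<in> L \<Longrightarrow> y \<in> L \<Longrightarrow> x + y \<in> L"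
proof -
  obtain a b where L: "L = (\<lambda>(m, n). of_int m * a + of_int n * b) ` UNIV"
    using is_lattice by (rule is_latticeE)
  assume "x \<in> L" "y \<in> L"
  then obtain m n m' n' where "x = of_int m * a + of_int n * b" "y = of_int m' * a + of_int n' * b"
    unfolding L by auto
  then show ?thesis unfolding L
    by (intro image_eqI[of _ _ "(m + m', n + n')"]) (auto simp: algebra_simps)
qed

lemma uminus_mem: "x \<in> L \<Longrightarrow> - x \<in> L"
proof -
  obtain a b where L: "L = (\<lambda>(m, n). of_int m * a + of_int n * b) ` UNIV"
    using is_lattice by (rule is_latticeE)
  assume "x \<in> L"
  then obtain m n where "x = of_int m * a + of_int n * b"
    unfolding L by auto
  then show ?thesis unfolding L
    by (intro image_eqI[of _ _ "(- m, - n)"]) (auto simp: algebra_simps)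
qed

lemma uminus_mem_iff [simp]: "- x \<in> L \<longleftrightarrow> x \<in> L"
  using uminus_mem[of x] uminus_mem[of "- x"] by auto

lemma diff_mem: "x \<in> L \<Longrightarrow> y \<in> L \<Longrightarrow> x - y \<in> L"
  using add_mem[of x "- y"] by simp

lemma add_mem_iff: "w \<in> L \<Longrightarrow> z + w \<in> L \<longleftrightarrow> z \<in> L" "w \<in> L \<Longrightarrow> w + z \<in> L \<longleftrightarrow> z \<in> L"
  using add_mem[of z w] diff_mem[of "z + w" w] by (auto simp: add.commute)

lemma diff_mem_iff: "w \<in> L \<Longrightarrow> z - w \<in> L \<longleftrightarrow> z \<in> L" "w \<in> L \<Longrightarrow> w - z \<in> L \<longleftrightarrow> z \<in> L"
  using add_mem_iff(1)[of "- w" z] uminus_mem_iff[of "w - z"] by auto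

lemma countable_L [simp]: "countable L"
  using is_latticeE[OF is_lattice] by (metis countable_image countableI_type)

lemma finite_L_cball: "finite {w \<in> L. cmod w \<le> R}"
proof -
  obtain a b where L: "Im (b / a) \<noteq> 0" "L = (\<lambda>(m, n). of_int m * a + of_int n * b) ` UNIV"
    using is_lattice by (rule is_latticeE)
  obtain c where c: "c > 0" "\<And>m n. c * \<bar>m\<bar> \<le> cmod (of_real m * a + of_real n * b)"
    "\<And>m n. c * \<bar>n\<bar> \<le> cmod (of_real m * a + of_real n * b)"
    using lattice_norm_ge[OF L(1)] by blast
  define N where "N = \<lceil>R / c\<rceil>"
  have "{w \<in> L. cmod w \<le> R} \<subseteq> (\<lambda>(m, n). of_int m * a + of_int n * b) ` ({-N..N} \<times> {-N..N})"
  proof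
    fix w assume "w \<in> {w \<in> L. cmod w \<le> R}"
    then obtain m n :: int where w: "w = of_int m * a + of_int n * b" "cmod w \<le> R"
      unfolding L by auto
    have "c * \<bar>of_int m\<bar> \<le> R" "c * \<bar>of_int n\<bar> \<le> R"
      using c(2)[of "of_int m" "of_int n"] c(3)[of "of_int n" "of_int m"] w by simp_all
    then have "\<bar>of_int m\<bar> \<le> R / c" "\<bar>of_int n\<bar> \<le> R / c"
      using c(1) by (simp_all add: field_simps)
    then have "\<bar>m\<bar> \<le> N" "\<bar>n\<bar> \<le> N" unfolding N_def by linarith+
    then show "w \<in> (\<lambda>(m, n). of_int m * a + of_int n * b) ` ({-N..N} \<times> {-N..N})"
      using w by (intro image_eqI[of _ _ "(m, n)"]) auto
  qed
  then show ?thesis using finite_subset by blast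
qed

lemma isolated:
  obtains d where "d > 0" "\<And>w. w \<in> L \<Longrightarrow> cmod w < d \<Longrightarrow> w = 0"
proof -
  obtain d where d: "d > 0" "\<forall>x\<in>{w \<in> L. cmod w \<le> 1}. x \<noteq> 0 \<longrightarrow> d \<le> dist 0 x"
    using finite_set_avoid[OF finite_L_cball] by blast
  show ?thesis
    by (rule that[of "min d 1"]) (use d in force)+
qed

lemma eq_if_near: "w \<in> L \<Longrightarrow> w' \<in> L \<Longrightarrow> d > 0 \<Longrightarrow> (\<And>w. w \<in> L \<Longrightarrow> cmod w < d \<Longrightarrow> w = 0) \<Longrightarrow> dist w w' < d \<Longrightarrow> w = w'"
  using diff_mem[of w w'] by (metis dist_norm eq_iff_diff_eq_0)

lemma closed_L [simp]: "closed L"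
proof -
  obtain d where d: "d > 0" "\<And>w. w \<in> L \<Longrightarrow> cmod w < d \<Longrightarrow> w = 0"
    using isolated by blast
  show ?thesis
    by (rule discrete_imp_closed[OF d(1)]) (use eq_if_near[OF _ _ d] in \<open>auto simp: dist_commute\<close>)
qed

lemma open_minus_L [simp]: "open (- L)" by (simp add: open_Compl)

section \<open>Absolute convergence of the Weierstrass series\<close>

lemma summable_inverse_cube: "(\<lambda>w. 1 / cmod w ^ 3) summable_on (L - {0})"
proof -
  obtain a b where L: "Im (b / a) \<noteq> 0" "L = (\<lambda>(m, n). of_int m * a + of_int n * b) ` UNIV"
    "inj (\<lambda>(m, n). of_int m * a + of_int n * b)"
    using is_lattice by (rule is_latticeE)
  obtain c where c: "c > 0" "\<And>m n. c * \<bar>m\<bar> \<le> cmod (of_real m * a + of_real n * b)"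
    "\<And>m n. c * \<bar>n\<bar> \<le> cmod (of_real m * a + of_real n * b)"
    using lattice_norm_ge[OF L(1)] by blast
  let ?h = "\<lambda>(m, n). of_int m * a + of_int n * b"
  have im: "L - {0} = ?h ` (- {(0, 0)})"
  proof -
    have "?h ` (- {(0,0)}) = ?h ` UNIV - ?h ` {(0,0)}"
      using L(3) by (metis image_set_diff Compl_eq_Diff_UNIV)
    then show ?thesis by (simp add: L(2))
  qed
  have s: "(\<lambda>p. c powr (-3) * pair_weight p) summable_on (- {(0, 0)})"
    by (intro summable_on_cmult_right summable_on_subset_banach[OF summable_on_pair_weight]) auto
  have "((\<lambda>w. 1 / cmod w ^ 3) \<circ> ?h) summable_on (- {(0, 0)})"
  proof (rule summable_on_norm_le[OF s])
    fix p :: "int \<times> int" assume "p \<in> - {(0, 0)}"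
    then obtain m n where p: "p = (m, n)" "(m, n) \<noteq> (0, 0)" by (cases p) auto
    show "norm (((\<lambda>w. 1 / cmod w ^ 3) \<circ> ?h) p) \<le> c powr (-3) * pair_weight p"
      using pair_weight_bound[OF c(1) p(2)] c(2)[of "of_int m" "of_int n"] c(3)[of "of_int n" "of_int m"]
      by (simp add: p)
  qed
  then show ?thesis
    unfolding im by (subst summable_on_reindex) (use L(3) inj_on_subset in auto)
qed

text \<open>The series of \<open>weierstrass_p\<close>, but for an arbitrary lattice: the theory is
  developed without reference to the definite description \<open>period_lattice\<close>.\<close>

definition wp :: "complex \<Rightarrow> complex" where
  "wp z = 1 / z\<^sup>2 + (\<Sum>\<^sub>\<infinity>w\<in>L - {0}. 1 / (z - w)\<^sup>2 - 1 / w\<^sup>2)"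

text \<open>Converges absolutely without subtracted constants, so translation by a lattice vector
  only permutes the terms. The translation laws of \<open>wp\<close>, \<open>zet\<close> and
  \<open>sig\<close> are derived from this one by successive integration.\<close>

definition wp' :: "complex \<Rightarrow> complex" where
  "wp' z = (\<Sum>\<^sub>\<infinity>w\<in>L. - 2 / (z - w) ^ 3)"

definition zet :: "complex \<Rightarrow> complex" where
  "zet z = 1 / z + (\<Sum>\<^sub>\<infinity>w\<in>L - {0}. 1 / (z - w) + 1 / w + z / w\<^sup>2)"

definition sig_factor :: "complex \<Rightarrow> complex \<Rightarrow> complex" where
  "sig_factor w z = (1 - z / w) * exp (z / w + z\<^sup>2 / (2 * w\<^sup>2))"

definition sig :: "complex \<Rightarrow> complex" where
  "sig z = z * Lim (finite_subsets_at_top (L - {0})) (\<lambda>F. \<Prod>w\<in>F. sig_factor w z)"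

text \<open>For \<open>z\<close> in \<open>ball 0 R\<close> the factor 2 gives |z - w| >= |w|/2 on
  \<open>far R\<close>, hence one majorant for the whole disc. Apart from the origin, the finitely
  many points of \<open>near R\<close> carry all poles and zeros in the disc.\<close>

definition near :: "real \<Rightarrow> complex set" where "near R = {w \<in> L - {0}. cmod w \<le> 2 * R}"
definition far :: "real \<Rightarrow> complex set" where "far R = {w \<in> L - {0}. cmod w > 2 * R}"

lemma near_far: "L - {0} = near R \<union> far R" "near R \<inter> far R = {}" "finite (near R)"
  by (auto simp: near_def far_def intro: finite_subset[OF _ finite_L_cball[of "2 * R"]])

lemma infsum_near_far:
  fixes f :: "complex \<Rightarrow> complex"
  assumes "f summable_on far R"
  shows "infsum f (L - {0}) = sum f (near R) + infsum f (far R)"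
  unfolding near_far(1)[of R] by (subst infsum_Un_disjoint) (use assms near_far[of R] in auto)

context
  fixes R :: real and w z :: complex
  assumes R: "R > 0" and w: "w \<in> far R" and z: "z \<in> ball 0 R"
begin

lemma far_basic: "w \<noteq> 0" "z \<noteq> w" "cmod z < R" "2 * R < cmod w" "cmod w / 2 \<le> cmod (z - w)" "cmod z \<le> cmod w / 2"
proof -
  show 1: "w \<noteq> 0" "cmod z < R" "2 * R < cmod w" using w z by (auto simp: far_def)
  show "cmod w / 2 \<le> cmod (z - w)" "cmod z \<le> cmod w / 2"
    using 1 norm_triangle_ineq2[of w z] by (auto simp: norm_minus_commute)
  show "z \<noteq> w" using 1 R by auto
qed

lemma far_bound_wp: "cmod (1 / (z - w)\<^sup>2 - 1 / w\<^sup>2) \<le> 10 * R / cmod w ^ 3"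
proof -
  note b = far_basic
  have "1 / (z - w)\<^sup>2 - 1 / w\<^sup>2 = z * (2 * w - z) / (w\<^sup>2 * (z - w)\<^sup>2)"
    using b by (simp add: divide_simps) (simp add: algebra_simps power2_eq_square)
  then have "cmod (1 / (z - w)\<^sup>2 - 1 / w\<^sup>2) = cmod z * cmod (2 * w - z) / (cmod w ^ 2 * cmod (z - w) ^ 2)"
    by (simp add: norm_mult norm_divide norm_power)
  \<comment> \<open>5/2 bounds |2w - z| / |w|, and the squared 1/2 in the denominator contributes a
    factor 4; together they give 10.\<close>
  also have "\<dots> \<le> R * (5 / 2 * cmod w) / (cmod w ^ 2 * (cmod w / 2) ^ 2)"
  proof (intro frac_le mult_mono power_mono)
    have "cmod (2 * w - z) \<le> 2 * cmod w + cmod z"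
      using norm_triangle_ineq4[of "2 * w" z] by (simp add: norm_mult)
    then show "cmod (2 * w - z) \<le> 5 / 2 * cmod w" using b by linarith
  qed (use b R in auto)
  also have "\<dots> = 10 * R / cmod w ^ 3"
    using b by (simp add: field_simps power2_eq_square power3_eq_cube)
  finally show ?thesis .
qed

lemma far_bound_zet: "cmod (1 / (z - w) + 1 / w + z / w\<^sup>2) \<le> 2 * R\<^sup>2 / cmod w ^ 3"
proof -
  note b = far_basic
  have "1 / (z - w) + 1 / w + z / w\<^sup>2 = z\<^sup>2 / (w\<^sup>2 * (z - w))"
    using b by (simp add: divide_simps) (simp add: algebra_simps power2_eq_square)
  then have "cmod (1 / (z - w) + 1 / w + z / w\<^sup>2) = (cmod z)\<^sup>2 / (cmod w ^ 2 * cmod (z - w))"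
    by (simp add: norm_mult norm_divide norm_power)
  also have "\<dots> \<le> R\<^sup>2 / (cmod w ^ 2 * (cmod w / 2))"
    by (intro frac_le mult_mono power_mono) (use b R in auto)
  also have "\<dots> = 2 * R\<^sup>2 / cmod w ^ 3"
    using b by (simp add: field_simps power2_eq_square power3_eq_cube)
  finally show ?thesis .
qed

lemma far_bound_wp': "cmod (- 2 / (z - w) ^ 3) \<le> 16 / cmod w ^ 3"
proof -
  note b = far_basic
  have "cmod (- 2 / (z - w) ^ 3) = 2 / cmod (z - w) ^ 3"
    by (simp add: norm_divide norm_power)
  also have "\<dots> \<le> 2 / (cmod w / 2) ^ 3"
    by (intro frac_le power_mono) (use b in auto)
  also have "\<dots> = 16 / cmod w ^ 3"
    using b by (simp add: field_simps power2_eq_square power3_eq_cube)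
  finally show ?thesis .
qed

end

text \<open>A logarithm of \<open>sig_factor\<close>: on far points |z / w| < 1/2, so the principal
  branch is holomorphic, and the infinite product becomes the exponential of an absolutely
  convergent sum.\<close>

definition log_factor :: "complex \<Rightarrow> complex \<Rightarrow> complex" where
  "log_factor w z = Ln (1 - z / w) + z / w + z\<^sup>2 / (2 * w\<^sup>2)"

lemma exp_log_factor: "w \<noteq> 0 \<Longrightarrow> z \<noteq> w \<Longrightarrow> exp (log_factor w z) = sig_factor w z"
  by (simp add: log_factor_def sig_factor_def exp_add add.assoc)

lemma log_factor_deriv:
  assumes "R > 0" "w \<in> far R" "z \<in> ball 0 R"
  shows "(log_factor w has_field_derivative (1 / (z - w) + 1 / w + z / w\<^sup>2)) (at z)"
proof -
  note b = far_basic[OF assms]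
  have "cmod (z / w) < 1" using b assms(1) by (simp add: norm_divide divide_simps)
  then have "Re (z / w) < 1" using complex_Re_le_cmod[of "z / w"] by linarith
  then have "1 - z / w \<notin> \<real>\<^sub>\<le>\<^sub>0" by (auto simp: complex_nonpos_Reals_iff)
  then have "(log_factor w has_field_derivative ((- (1 / w)) / (1 - z / w) + 1 / w + z / w\<^sup>2)) (at z)"
    unfolding log_factor_def[abs_def] using b(1)
    by (auto intro!: derivative_eq_intros simp: divide_simps)
  moreover have "(- (1 / w)) / (1 - z / w) = 1 / (z - w)"
    using b by (simp add: divide_simps)
  ultimately show ?thesis by (simp only:)
qed

text \<open>The logarithm vanishes at 0, so its size is at most the bound on its derivative times
  |z| < R.\<close>

lemma log_factor_bound:
  assumes "R > 0" "w \<in> far R" "z \<in> ball 0 R"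
  shows "cmod (log_factor w z) \<le> 2 * R ^ 3 / cmod w ^ 3"
proof -
  have "cmod (log_factor w z - log_factor w 0) \<le> 2 * R\<^sup>2 / cmod w ^ 3 * cmod (z - 0)"
  proof (rule field_differentiable_bound[where S = "ball 0 R"])
    fix x :: complex assume x: "x \<in> ball 0 R"
    show "(log_factor w has_field_derivative (1 / (x - w) + 1 / w + x / w\<^sup>2)) (at x within ball 0 R)"
      using log_factor_deriv[OF assms(1,2) x] has_field_derivative_at_within by blast
    show "cmod (1 / (x - w) + 1 / w + x / w\<^sup>2) \<le> 2 * R\<^sup>2 / cmod w ^ 3"
      by (rule far_bound_zet[OF assms(1,2) x])
  qed (use assms in simp_all)
  also have "\<dots> \<le> 2 * R\<^sup>2 / cmod w ^ 3 * R"
    using assms by (intro mult_left_mono) auto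
  finally show ?thesis by (simp add: log_factor_def power2_eq_square power3_eq_cube)
qed

lemma summable_far: "(\<lambda>w. C / cmod w ^ 3) summable_on far R"
proof -
  have "(\<lambda>w. C * (1 / cmod w ^ 3)) summable_on far R"
    by (intro summable_on_cmult_right summable_on_subset_banach[OF summable_inverse_cube]) (auto simp: far_def)
  then show ?thesis by simp
qed

lemma far_deriv:
  assumes "R > 0" "z \<in> ball 0 R"
  shows "((\<lambda>z. \<Sum>\<^sub>\<infinity>w\<in>far R. log_factor w z) has_field_derivative
           (\<Sum>\<^sub>\<infinity>w\<in>far R. 1 / (z - w) + 1 / w + z / w\<^sup>2)) (at z)"
    "((\<lambda>z. \<Sum>\<^sub>\<infinity>w\<in>far R. 1 / (z - w) + 1 / w + z / w\<^sup>2) has_field_derivative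
           (\<Sum>\<^sub>\<infinity>w\<in>far R. - (1 / (z - w)\<^sup>2 - 1 / w\<^sup>2))) (at z)"
    "((\<lambda>z. \<Sum>\<^sub>\<infinity>w\<in>far R. 1 / (z - w)\<^sup>2 - 1 / w\<^sup>2) has_field_derivative
           (\<Sum>\<^sub>\<infinity>w\<in>far R. - 2 / (z - w) ^ 3)) (at z)"
proof -
  show "((\<lambda>z. \<Sum>\<^sub>\<infinity>w\<in>far R. log_factor w z) has_field_derivative
           (\<Sum>\<^sub>\<infinity>w\<in>far R. 1 / (z - w) + 1 / w + z / w\<^sup>2)) (at z)"
    by (rule infsum_holomorphic_deriv[OF open_ball log_factor_deriv[OF assms(1)]
          log_factor_bound[OF assms(1)] summable_far assms(2)])
  show "((\<lambda>z. \<Sum>\<^sub>\<infinity>w\<in>far R. 1 / (z - w) + 1 / w + z / w\<^sup>2) has_field_derivative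
           (\<Sum>\<^sub>\<infinity>w\<in>far R. - (1 / (z - w)\<^sup>2 - 1 / w\<^sup>2))) (at z)"
  proof (rule infsum_holomorphic_deriv[OF open_ball _ far_bound_zet[OF assms(1)] summable_far assms(2)])
    fix w x assume "w \<in> far R" "x \<in> ball (0::complex) R"
    note b = far_basic[OF assms(1) this]
    show "((\<lambda>z. 1 / (z - w) + 1 / w + z / w\<^sup>2) has_field_derivative - (1 / (x - w)\<^sup>2 - 1 / w\<^sup>2)) (at x)"
      using b by (auto intro!: derivative_eq_intros simp: power2_eq_square)
  qed
  show "((\<lambda>z. \<Sum>\<^sub>\<infinity>w\<in>far R. 1 / (z - w)\<^sup>2 - 1 / w\<^sup>2) has_field_derivative
           (\<Sum>\<^sub>\<infinity>w\<in>far R. - 2 / (z - w) ^ 3)) (at z)"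
  proof (rule infsum_holomorphic_deriv[OF open_ball _ far_bound_wp[OF assms(1)] summable_far assms(2)])
    fix w x assume "w \<in> far R" "x \<in> ball (0::complex) R"
    note b = far_basic[OF assms(1) this]
    show "((\<lambda>z. 1 / (z - w)\<^sup>2 - 1 / w\<^sup>2) has_field_derivative - 2 / (x - w) ^ 3) (at x)"
      using b by (intro inverse_square_deriv) auto
  qed
qed

lemma summable_far_terms:
  assumes "R > 0" "z \<in> ball 0 R"
  shows "(\<lambda>w. log_factor w z) summable_on far R"
    "(\<lambda>w. 1 / (z - w) + 1 / w + z / w\<^sup>2) summable_on far R"
    "(\<lambda>w. 1 / (z - w)\<^sup>2 - 1 / w\<^sup>2) summable_on far R"
    "(\<lambda>w. - 2 / (z - w) ^ 3) summable_on far R"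
  using summable_on_norm_le[OF summable_far log_factor_bound[OF assms(1) _ assms(2)]]
    summable_on_norm_le[OF summable_far far_bound_zet[OF assms(1) _ assms(2)]]
    summable_on_norm_le[OF summable_far far_bound_wp[OF assms(1) _ assms(2)]]
    summable_on_norm_le[OF summable_far far_bound_wp'[OF assms(1) _ assms(2)]] by blast+

lemma wp_near_far:
  assumes "R > 0" "z \<in> ball 0 R"
  shows "wp z = 1 / z\<^sup>2 + (\<Sum>w\<in>near R. 1 / (z - w)\<^sup>2 - 1 / w\<^sup>2) + (\<Sum>\<^sub>\<infinity>w\<in>far R. 1 / (z - w)\<^sup>2 - 1 / w\<^sup>2)"
  unfolding wp_def by (subst infsum_near_far[OF summable_far_terms(3)[OF assms]]) (simp add: add.assoc)

lemma zet_near_far: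
  assumes "R > 0" "z \<in> ball 0 R"
  shows "zet z = 1 / z + (\<Sum>w\<in>near R. 1 / (z - w) + 1 / w + z / w\<^sup>2) + (\<Sum>\<^sub>\<infinity>w\<in>far R. 1 / (z - w) + 1 / w + z / w\<^sup>2)"
  unfolding zet_def by (subst infsum_near_far[OF summable_far_terms(2)[OF assms]]) (simp add: add.assoc)

lemma summable_wp':
  "(\<lambda>w. - 2 / (z - w) ^ 3) summable_on (L - {0})" "(\<lambda>w. - 2 / (z - w) ^ 3) summable_on L"
proof -
  define R where "R = cmod z + 1"
  have R: "R > 0" "z \<in> ball 0 R" by (auto simp: R_def add_nonneg_pos)
  show 1: "(\<lambda>w. - 2 / (z - w) ^ 3) summable_on (L - {0})"
    unfolding near_far(1)[of R]
    by (intro summable_on_Un_disjoint summable_far_terms[OF R] summable_on_finite near_far)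
  have "L = insert 0 (L - {0})" by auto
  then show "(\<lambda>w. - 2 / (z - w) ^ 3) summable_on L"
    using 1 by (metis summable_on_insert_iff)
qed

lemma wp'_near_far:
  assumes "R > 0" "z \<in> ball 0 R"
  shows "wp' z = - 2 / z ^ 3 + (\<Sum>w\<in>near R. - 2 / (z - w) ^ 3) + (\<Sum>\<^sub>\<infinity>w\<in>far R. - 2 / (z - w) ^ 3)"
proof -
  have "L = insert 0 (L - {0})" by auto
  then have "wp' z = infsum (\<lambda>w. - 2 / (z - w) ^ 3) (insert 0 (L - {0}))"
    unfolding wp'_def by simp
  also have "\<dots> = - 2 / z ^ 3 + infsum (\<lambda>w. - 2 / (z - w) ^ 3) (L - {0})"
    by (subst infsum_insert) (use summable_wp' in auto)
  finally show ?thesis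
    by (simp only: infsum_near_far[OF summable_far_terms(4)[OF assms]] add.assoc)
qed

lemma zet_deriv:
  assumes "z \<notin> L"
  shows "(zet has_field_derivative (- wp z)) (at z)"
proof -
  \<comment> \<open>The disc of radius |z| + 1 about 0 is a neighbourhood of \<open>z\<close>; on it
    the function is a finite sum plus a series that may be differentiated term by term.\<close>
  define R where "R = cmod z + 1"
  have R: "R > 0" "z \<in> ball 0 R" by (auto simp: R_def add_nonneg_pos)
  have nz: "z \<noteq> 0" "\<And>w. w \<in> near R \<Longrightarrow> z \<noteq> w" using assms by (auto simp: near_def)
  have n: "((\<lambda>z. \<Sum>w\<in>near R. 1 / (z - w) + 1 / w + z / w\<^sup>2) has_field_derivative
        (\<Sum>w\<in>near R. - (1 / (z - w)\<^sup>2 - 1 / w\<^sup>2))) (at z)"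
    by (rule DERIV_sum) (use nz in \<open>auto intro!: derivative_eq_intros simp: power2_eq_square near_def\<close>)
  have "((\<lambda>z. 1 / z) has_field_derivative - 1 / z\<^sup>2) (at z)"
    using nz by (auto intro!: derivative_eq_intros simp: power2_eq_square)
  from DERIV_add[OF DERIV_add[OF this n] far_deriv(2)[OF R]]
  have "((\<lambda>z. 1 / z + (\<Sum>w\<in>near R. 1 / (z - w) + 1 / w + z / w\<^sup>2) + (\<Sum>\<^sub>\<infinity>w\<in>far R. 1 / (z - w) + 1 / w + z / w\<^sup>2))
     has_field_derivative (- wp z)) (at z)"
    by (rule DERIV_cong) (simp only: wp_near_far[OF R] infsum_uminus sum_negf, simp)
  then show ?thesis
    by (rule has_field_derivative_transform_within_open[of _ _ _ "ball 0 R"])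
       (use R zet_near_far in auto)
qed

lemma wp_deriv:
  assumes "z \<notin> L"
  shows "(wp has_field_derivative wp' z) (at z)"
proof -
  define R where "R = cmod z + 1"
  have R: "R > 0" "z \<in> ball 0 R" by (auto simp: R_def add_nonneg_pos)
  have nz: "z \<noteq> 0" "\<And>w. w \<in> near R \<Longrightarrow> z \<noteq> w" using assms by (auto simp: near_def)
  note * = inverse_square_deriv
  have n: "((\<lambda>z. \<Sum>w\<in>near R. 1 / (z - w)\<^sup>2 - 1 / w\<^sup>2) has_field_derivative
        (\<Sum>w\<in>near R. - 2 / (z - w) ^ 3)) (at z)"
    by (intro DERIV_sum *) (use nz in auto)
  have "((\<lambda>z. 1 / z\<^sup>2) has_field_derivative - 2 / z ^ 3) (at z)"
    using *[of z 0 0] nz by simp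
  from DERIV_add[OF DERIV_add[OF this n] far_deriv(3)[OF R]]
  have "((\<lambda>z. 1 / z\<^sup>2 + (\<Sum>w\<in>near R. 1 / (z - w)\<^sup>2 - 1 / w\<^sup>2) + (\<Sum>\<^sub>\<infinity>w\<in>far R. 1 / (z - w)\<^sup>2 - 1 / w\<^sup>2))
     has_field_derivative wp' z) (at z)"
    by (rule DERIV_cong) (simp add: wp'_near_far[OF R])
  then show ?thesis
    by (rule has_field_derivative_transform_within_open[of _ _ _ "ball 0 R"])
       (use R wp_near_far in auto)
qed

end

section \<open>The sigma product: convergence, zeros and logarithmic derivative\<close>

lemma prod_log_deriv:
  fixes f :: "'i \<Rightarrow> complex \<Rightarrow> complex"
  assumes "finite A" "\<And>i. i \<in> A \<Longrightarrow> (f i has_field_derivative f i z * d i) (at z)"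
  shows "((\<lambda>z. \<Prod>i\<in>A. f i z) has_field_derivative (\<Prod>i\<in>A. f i z) * (\<Sum>i\<in>A. d i)) (at z)"
  using assms
proof (induction A rule: finite_induct)
  case (insert i A)
  then have "((\<lambda>z. f i z * (\<Prod>i\<in>A. f i z)) has_field_derivative
      f i z * d i * (\<Prod>i\<in>A. f i z) + f i z * ((\<Prod>i\<in>A. f i z) * (\<Sum>i\<in>A. d i))) (at z)"
    by (auto intro!: derivative_eq_intros)
  then show ?case using insert by (simp add: algebra_simps)
qed auto

context lattice
begin

text \<open>A finite set containing \<open>near R\<close> contributes the fixed near product times
  the exponential of a finite sum of logarithms, and those sums converge. Near points stay outside
  the exponential because their factors may vanish at \<open>z\<close>.\<close>

lemma sig_tendsto:
  assumes R: "R > 0" "z \<in> ball 0 R"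
  shows "((\<lambda>F. \<Prod>w\<in>F. sig_factor w z) \<longlongrightarrow>
    (\<Prod>w\<in>near R. sig_factor w z) * exp (\<Sum>\<^sub>\<infinity>w\<in>far R. log_factor w z)) (finite_subsets_at_top (L - {0}))"
proof -
  \<comment> \<open>Extending the logarithms by 0 to the near points lets their sum run along the
    same net as the product.\<close>
  define g where "g w = (if w \<in> far R then log_factor w z else 0)" for w
  have "((\<lambda>w. log_factor w z) has_sum (\<Sum>\<^sub>\<infinity>w\<in>far R. log_factor w z)) (far R)"
    by (intro has_sum_infsum summable_far_terms[OF R])
  then have "(g has_sum (\<Sum>\<^sub>\<infinity>w\<in>far R. log_factor w z)) (L - {0})"
    by (subst has_sum_cong_neutral[where T = "far R" and g = "\<lambda>w. log_factor w z"]) (auto simp: g_def far_def)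
  then have "(sum g \<longlongrightarrow> (\<Sum>\<^sub>\<infinity>w\<in>far R. log_factor w z)) (finite_subsets_at_top (L - {0}))"
    by (simp add: has_sum_def)
  then have "((\<lambda>F. (\<Prod>w\<in>near R. sig_factor w z) * exp (sum g F)) \<longlongrightarrow>
     (\<Prod>w\<in>near R. sig_factor w z) * exp (\<Sum>\<^sub>\<infinity>w\<in>far R. log_factor w z)) (finite_subsets_at_top (L - {0}))"
    by (intro tendsto_intros)
  moreover have "\<forall>\<^sub>F F in finite_subsets_at_top (L - {0}).
      (\<Prod>w\<in>near R. sig_factor w z) * exp (sum g F) = (\<Prod>w\<in>F. sig_factor w z)"
    unfolding eventually_finite_subsets_at_top
  proof (intro exI[of _ "near R"] conjI allI impI)
    fix F assume F: "finite F \<and> near R \<subseteq> F \<and> F \<subseteq> L - {0}"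
    have "F - near R \<subseteq> far R" using F near_far(1)[of R] by blast
    have "exp (sum g F) = exp (sum g (F - near R) + sum g (near R))"
      using F by (subst sum.subset_diff[of "near R" F]) auto
    also have "sum g (near R) = 0"
      by (rule sum.neutral) (use near_far(2)[of R] in \<open>auto simp: g_def\<close>)
    also have "exp (sum g (F - near R) + 0) = (\<Prod>w\<in>F - near R. exp (g w))"
      using F by (simp add: exp_sum)
    also have "\<dots> = (\<Prod>w\<in>F - near R. sig_factor w z)"
    proof (rule prod.cong)
      fix w assume "w \<in> F - near R"
      then have w: "w \<in> far R" using \<open>F - near R \<subseteq> far R\<close> by blast
      then show "exp (g w) = sig_factor w z"
        using far_basic[OF R(1) w R(2)] by (simp add: g_def exp_log_factor)
    qed auto
    finally show "(\<Prod>w\<in>near R. sig_factor w z) * exp (sum g F) = (\<Prod>w\<in>F. sig_factor w z)"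
      using F by (subst prod.subset_diff[of "near R" F]) (auto simp: mult.commute)
  qed (use near_far(1,3)[of R] in auto)
  ultimately show ?thesis by (rule Lim_transform_eventually)
qed

lemma sig_near_far:
  assumes R: "R > 0" "z \<in> ball 0 R"
  shows "sig z = z * ((\<Prod>w\<in>near R. sig_factor w z) * exp (\<Sum>\<^sub>\<infinity>w\<in>far R. log_factor w z))"
  unfolding sig_def using tendsto_Lim[OF finite_subsets_at_top_neq_bot sig_tendsto[OF assms]] by simp

lemma sig_factor_deriv:
  assumes "w \<noteq> 0" "z \<noteq> w"
  shows "(sig_factor w has_field_derivative sig_factor w z * (1 / (z - w) + 1 / w + z / w\<^sup>2)) (at z)"
proof -
  let ?e = "exp (z / w + z\<^sup>2 / (2 * w\<^sup>2))"
  have "(sig_factor w has_field_derivative (- (1 / w)) * ?e + (1 - z / w) * (?e * (1 / w + z / w\<^sup>2))) (at z)"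
    unfolding sig_factor_def[abs_def] using assms
    by (auto intro!: derivative_eq_intros simp: divide_simps)
  moreover have "- (1 / w) = (1 - z / w) * (1 / (z - w))"
    using assms by (simp add: divide_simps)
  then have "(- (1 / w)) * ?e + (1 - z / w) * (?e * (1 / w + z / w\<^sup>2))
    = (1 - z / w) * (1 / (z - w)) * ?e + (1 - z / w) * (?e * (1 / w + z / w\<^sup>2))" by (simp only:)
  then have "(- (1 / w)) * ?e + (1 - z / w) * (?e * (1 / w + z / w\<^sup>2))
    = sig_factor w z * (1 / (z - w) + 1 / w + z / w\<^sup>2)"
    unfolding sig_factor_def by (simp only: algebra_simps)
  ultimately show ?thesis by (simp only:)
qed

lemma sig_holomorphic: "sig holomorphic_on A"
proof -
  have "sig field_differentiable at z" for z
  proof -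
    define R where "R = cmod z + 1"
    have R: "R > 0" "z \<in> ball 0 R" by (auto simp: R_def add_nonneg_pos)
    have "(\<lambda>z. \<Sum>\<^sub>\<infinity>w\<in>far R. log_factor w z) holomorphic_on ball 0 R"
      using far_deriv(1)[OF R(1)] by (subst holomorphic_on_open) blast+
    then have "(\<lambda>z. z * ((\<Prod>w\<in>near R. sig_factor w z) * exp (\<Sum>\<^sub>\<infinity>w\<in>far R. log_factor w z))) holomorphic_on ball 0 R"
      unfolding sig_factor_def by (intro holomorphic_intros) (auto simp: near_def)
    then have "sig holomorphic_on ball 0 R"
      by (rule holomorphic_transform) (use sig_near_far R in auto)
    then show ?thesis using R holomorphic_on_imp_differentiable_at by blast
  qed
  then show ?thesis
    using field_differentiable_at_within holomorphic_on_def by blast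
qed

text \<open>Exponentials never vanish, so a zero comes from the factor \<open>z\<close> or from a
  near factor; a nonzero lattice point \<open>z\<close> is itself near, since |z| <= 2R.\<close>

lemma sig_eq_0_iff: "sig z = 0 \<longleftrightarrow> z \<in> L"
proof -
  define R where "R = cmod z + 1"
  have R: "R > 0" "z \<in> ball 0 R" by (auto simp: R_def add_nonneg_pos)
  have "sig z = 0 \<longleftrightarrow> z = 0 \<or> (\<exists>w\<in>near R. z = w)"
    unfolding sig_near_far[OF R] using near_far(3)[of R]
    by (auto simp: sig_factor_def near_def divide_simps)
  also have "\<dots> \<longleftrightarrow> z \<in> L"
    by (auto simp: near_def R_def)
  finally show ?thesis .
qed

lemma sig_deriv:
  assumes "z \<notin> L"
  shows "(sig has_field_derivative sig z * zet z) (at z)"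
proof -
  define R where "R = cmod z + 1"
  have R: "R > 0" "z \<in> ball 0 R" by (auto simp: R_def add_nonneg_pos)
  have nz: "z \<noteq> 0" "\<And>w. w \<in> near R \<Longrightarrow> z \<noteq> w \<and> w \<noteq> 0" using assms by (auto simp: near_def)
  let ?N = "\<Prod>w\<in>near R. sig_factor w z" and ?S = "\<Sum>w\<in>near R. 1 / (z - w) + 1 / w + z / w\<^sup>2"
  let ?G = "\<Sum>\<^sub>\<infinity>w\<in>far R. log_factor w z" and ?Z = "\<Sum>\<^sub>\<infinity>w\<in>far R. 1 / (z - w) + 1 / w + z / w\<^sup>2"
  have p: "((\<lambda>z. \<Prod>w\<in>near R. sig_factor w z) has_field_derivative ?N * ?S) (at z)"
    by (intro prod_log_deriv near_far sig_factor_deriv) (use nz in auto)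
  have e: "((\<lambda>z. exp (\<Sum>\<^sub>\<infinity>w\<in>far R. log_factor w z)) has_field_derivative exp ?G * ?Z) (at z)"
    by (rule DERIV_chain2[OF DERIV_exp far_deriv(1)[OF R]])
  have "((\<lambda>z. z * ((\<Prod>w\<in>near R. sig_factor w z) * exp (\<Sum>\<^sub>\<infinity>w\<in>far R. log_factor w z))) has_field_derivative sig z * zet z) (at z)"
    by (rule DERIV_cong[OF DERIV_mult[OF DERIV_ident DERIV_mult[OF p e]]])
       (use nz in \<open>simp add: sig_near_far[OF R] zet_near_far[OF R] algebra_simps\<close>)
  then show ?thesis
    by (rule has_field_derivative_transform_within_open[of _ _ _ "ball 0 R"])
       (use R sig_near_far in auto)
qed

text \<open>\<open>sig_deriv\<close> does not reach 0, where \<open>zet\<close> has a pole; the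
  product without its leading factor \<open>z\<close> has value 1 there.\<close>

lemma sig_deriv_0: "(sig has_field_derivative 1) (at 0)"
proof -
  have R: "(1::real) > 0" "(0::complex) \<in> ball 0 1" by auto
  let ?h = "\<lambda>z. (\<Prod>w\<in>near 1. sig_factor w z) * exp (\<Sum>\<^sub>\<infinity>w\<in>far 1. log_factor w z)"
  have h0: "?h 0 = 1" by (simp add: sig_factor_def log_factor_def)
  have "?h holomorphic_on ball 0 1"
  proof -
    have "(\<lambda>z. \<Sum>\<^sub>\<infinity>w\<in>far 1. log_factor w z) holomorphic_on ball 0 1"
      using far_deriv(1)[OF R(1)] by (subst holomorphic_on_open) blast+
    then show ?thesis
      unfolding sig_factor_def by (intro holomorphic_intros) (auto simp: near_def)
  qed
  then have "(?h has_field_derivative deriv ?h 0) (at 0)"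
    by (rule holomorphic_derivI) auto
  from DERIV_mult[OF DERIV_ident this]
  have "((\<lambda>z. z * ?h z) has_field_derivative 1) (at 0)"
    by (rule DERIV_cong) (use h0 in simp)
  then show ?thesis
    by (rule has_field_derivative_transform_within_open[of _ _ _ "ball 0 1"])
       (use sig_near_far[OF R(1)] in auto)
qed

lemma deriv_sig: "(sig has_field_derivative deriv sig z) (at z)"
  using sig_holomorphic[of UNIV] by (rule holomorphic_derivI) auto

lemma deriv_sig_eq: "z \<notin> L \<Longrightarrow> deriv sig z = sig z * zet z" and deriv_sig_0: "deriv sig 0 = 1"
  by (auto intro!: DERIV_imp_deriv sig_deriv sig_deriv_0)

section \<open>Parity and translation by lattice vectors\<close>

lemma zet_uminus: "zet (- z) = - zet z"
proof -
  have "zet (- z) = - (1 / z) + (\<Sum>\<^sub>\<infinity>w\<in>L - {0}. 1 / (- z - w) + 1 / w + (- z) / w\<^sup>2)"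
    by (simp add: zet_def)
  also have "(\<Sum>\<^sub>\<infinity>w\<in>L - {0}. 1 / (- z - w) + 1 / w + (- z) / w\<^sup>2) = (\<Sum>\<^sub>\<infinity>w\<in>L - {0}. - (1 / (z - w) + 1 / w + z / w\<^sup>2))"
  proof (rule infsum_reindex_bij_witness[of _ uminus uminus])
    fix w assume "w \<in> L - {0}"
    have "- z - w = - (z - - w)" by simp
    then show "- (1 / (z - - w) + 1 / (- w) + z / (- w)\<^sup>2) = 1 / (- z - w) + 1 / w + (- z) / w\<^sup>2"
      by (simp only: divide_minus_right power2_minus) simp
  qed auto
  finally show ?thesis by (simp add: zet_def infsum_uminus del: minus_add_distrib)
qed

lemma wp_uminus: "wp (- z) = wp z"
proof -
  have "(\<Sum>\<^sub>\<infinity>w\<in>L - {0}. 1 / (- z - w)\<^sup>2 - 1 / w\<^sup>2) = (\<Sum>\<^sub>\<infinity>w\<in>L - {0}. 1 / (z - w)\<^sup>2 - 1 / w\<^sup>2)"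
  proof (rule infsum_reindex_bij_witness[of _ uminus uminus])
    fix w assume "w \<in> L - {0}"
    have "(- z - w)\<^sup>2 = (z - - w)\<^sup>2" by (simp add: power2_eq_square algebra_simps)
    then show "1 / (z - - w)\<^sup>2 - 1 / (- w)\<^sup>2 = 1 / (- z - w)\<^sup>2 - 1 / w\<^sup>2"
      by (simp only: power2_minus)
  qed auto
  then show ?thesis by (simp add: wp_def)
qed

lemma wp'_uminus: "wp' (- z) = - wp' z"
proof -
  have "wp' (- z) = (\<Sum>\<^sub>\<infinity>w\<in>L. - (- 2 / (z - w) ^ 3))"
    unfolding wp'_def
  proof (rule infsum_reindex_bij_witness[of _ uminus uminus])
    fix w assume "w \<in> L"
    have "(- z - w) ^ 3 = - ((z - - w) ^ 3)" by (simp add: power3_eq_cube algebra_simps)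
    then show "- (- 2 / (z - - w) ^ 3) = - 2 / (- z - w) ^ 3" by simp
  qed auto
  then show ?thesis by (simp only: wp'_def infsum_uminus)
qed

lemma wp'_periodic:
  assumes "v \<in> L"
  shows "wp' (z + v) = wp' z"
  unfolding wp'_def
proof (rule infsum_reindex_bij_witness[of _ "\<lambda>w. w + v" "\<lambda>w. w - v"])
  fix w
  have "z - (w - v) = z + v - w" by simp
  then show "- 2 / (z - (w - v)) ^ 3 = - 2 / (z + v - w) ^ 3" by (simp only:)
qed (use assms add_mem diff_mem in auto)

lemma deriv_shift:
  fixes f :: "complex \<Rightarrow> complex"
  assumes "(f has_field_derivative D) (at (z + a))"
  shows "((\<lambda>z. f (z + a)) has_field_derivative D) (at z)"
  using assms DERIV_shift by blast

lemma ex_not_mem: "\<exists>a. a \<notin> L"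
  using countable_L uncountable_UNIV_complex by (metis UNIV_eq_I)

text \<open>The increment wp(z + v) - wp(z) has derivative 0 and is thus constant. Replacing z by -z
  - v reverses its sign by evenness, so the constant is 0. This avoids evaluation at -v/2, which
  could itself be a lattice point.\<close>

lemma wp_periodic:
  assumes v: "v \<in> L" and z: "z \<notin> L"
  shows "wp (z + v) = wp z"
proof -
  have "wp (z + v) - wp z = wp (- z - v + v) - wp (- z - v)"
  proof (rule constant_on_open_diff_countable[of L "\<lambda>z. wp (z + v) - wp z"])
    fix z assume z: "z \<notin> L"
    then have "z + v \<notin> L" using v add_mem_iff by auto
    from DERIV_diff[OF deriv_shift[OF wp_deriv[OF this]] wp_deriv[OF z]]
    show "((\<lambda>z. wp (z + v) - wp z) has_field_derivative 0) (at z)"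
      by (rule DERIV_cong) (use wp'_periodic[OF v] in simp)
  next
    have "- (z + v) \<notin> L" using z v by (simp only: uminus_mem_iff add_mem_iff not_False_eq_True)
    then show "- z - v \<notin> L" by simp
  qed (use z in auto)
  moreover have "wp (- z - v) = wp (z + v)"
    using wp_uminus[of "z + v"] by simp
  ultimately show ?thesis by (simp add: wp_uminus)
qed

lemma zet_quasi_periodic:
  assumes v: "v \<in> L"
  obtains \<eta> where "\<And>z. z \<notin> L \<Longrightarrow> zet (z + v) = zet z + \<eta>"
proof -
  obtain a where a: "a \<notin> L"
    using ex_not_mem by blast
  show ?thesis
  proof (rule that)
    fix z assume z: "z \<notin> L"
    have "zet (z + v) - zet z = zet (a + v) - zet a"
    proof (rule constant_on_open_diff_countable[of L "\<lambda>z. zet (z + v) - zet z"])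
      fix z assume z: "z \<notin> L"
      then have "z + v \<notin> L" using v add_mem_iff by blast
      from DERIV_diff[OF deriv_shift[OF zet_deriv[OF this]] zet_deriv[OF z]]
      show "((\<lambda>z. zet (z + v) - zet z) has_field_derivative 0) (at z)"
        by (rule DERIV_cong) (use wp_periodic[OF v z] in simp)
    qed (use z a in auto)
    then show "zet (z + v) = zet z + (zet (a + v) - zet a)" by (simp add: algebra_simps)
  qed
qed

lemma sig_quasi_periodic:
  assumes v: "v \<in> L"
  obtains c \<eta> where "c \<noteq> 0" "\<And>z. sig (z + v) = c * exp (\<eta> * z) * sig z"
    "\<And>z. z \<notin> L \<Longrightarrow> zet (z + v) = zet z + \<eta>"
proof -
  obtain \<eta> where e: "\<And>z. z \<notin> L \<Longrightarrow> zet (z + v) = zet z + \<eta>"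
    by (rule zet_quasi_periodic[OF v]) blast
  obtain a where a: "a \<notin> L"
    using ex_not_mem by blast
  \<comment> \<open>The exponential makes the logarithmic derivative of \<open>q\<close> equal to
    zet(z + v) - zet(z) - \<eta> = 0.\<close>
  define q where "q z = sig (z + v) / sig z * exp (- \<eta> * z)" for z
  have av: "z + v \<notin> L" if "z \<notin> L" for z
    using that v add_mem_iff by blast
  have q: "q z = q a" if "z \<notin> L" for z
  proof (rule constant_on_open_diff_countable[of L q])
    fix z assume z: "z \<notin> L"
    then have nz: "sig z \<noteq> 0" by (simp add: sig_eq_0_iff)
    have "((\<lambda>z. exp (- \<eta> * z)) has_field_derivative exp (- \<eta> * z) * (- \<eta>)) (at z)"
      by (auto intro!: derivative_eq_intros)
    from DERIV_mult[OF DERIV_divide[OF deriv_shift[OF sig_deriv[OF av[OF z]]] sig_deriv[OF z] nz] this]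
    show "(q has_field_derivative 0) (at z)"
      unfolding q_def[abs_def]
      by (rule DERIV_cong) (use nz e[OF z] in \<open>simp add: divide_simps, simp add: algebra_simps\<close>)
  qed (use that a in auto)
  show ?thesis
  proof (rule that[of "q a" \<eta>])
    show "q a \<noteq> 0" using a av by (simp add: q_def sig_eq_0_iff)
    fix z
    show "sig (z + v) = q a * exp (\<eta> * z) * sig z"
    proof (cases "z \<in> L")
      case True
      then have "sig (z + v) = 0" "sig z = 0" using v add_mem by (simp_all add: sig_eq_0_iff)
      then show ?thesis by simp
    next
      case False
      then have "sig z \<noteq> 0" by (simp add: sig_eq_0_iff)
      then show ?thesis using q[OF False] by (simp add: q_def exp_minus field_simps)
    qed
  qed (use e in auto)
qed

text \<open>Quasi-periodicity carries the derivative 1 at the origin to every lattice point, up to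
  the nonzero factor \<open>c\<close>.\<close>

lemma sig_simple_zero:
  assumes "z \<in> L"
  shows "deriv sig z \<noteq> 0"
proof -
  obtain c \<eta> where c: "c \<noteq> 0" "\<And>x. sig (x + z) = c * exp (\<eta> * x) * sig x"
    "\<And>x. x \<notin> L \<Longrightarrow> zet (x + z) = zet x + \<eta>"
    by (rule sig_quasi_periodic[OF assms]) blast
  have "((\<lambda>x. sig (x + z)) has_field_derivative deriv sig z) (at 0)"
    by (rule deriv_shift) (simp add: deriv_sig)
  moreover have "((\<lambda>x. c * exp (\<eta> * x) * sig x) has_field_derivative c) (at 0)"
  proof -
    have "((\<lambda>x. c * exp (\<eta> * x)) has_field_derivative c * \<eta>) (at 0)"
      by (auto intro!: derivative_eq_intros)
    from DERIV_mult[OF this sig_deriv_0] show ?thesis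
      by (rule DERIV_cong) (simp add: sig_eq_0_iff)
  qed
  ultimately have "deriv sig z = c"
    unfolding c(2) by (rule DERIV_unique)
  then show ?thesis using c(1) by simp
qed

text \<open>The quotient sig(-z) / sig(z) is constant because \<open>zet\<close> is odd; comparing
  derivatives at 0 fixes the constant as -1.\<close>

lemma sig_uminus: "sig (- z) = - sig z"
proof (cases "z \<in> L")
  case True
  then show ?thesis by (metis sig_eq_0_iff uminus_mem_iff neg_equal_zero minus_zero)
next
  case False
  define q where "q z = sig (- z) / sig z" for z
  have q: "q a = q z" if "a \<notin> L" for a
  proof (rule constant_on_open_diff_countable[of L q])
    fix z assume z: "z \<notin> L"
    then have nz: "sig z \<noteq> 0" and mz: "- z \<notin> L" by (simp_all add: sig_eq_0_iff)
    have "((\<lambda>z. sig (- z)) has_field_derivative sig (- z) * zet (- z) * (- 1)) (at z)"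
      by (rule DERIV_chain2[where g = uminus, OF sig_deriv[OF mz]]) (auto intro!: derivative_eq_intros)
    from DERIV_divide[OF this sig_deriv[OF z] nz]
    show "(q has_field_derivative 0) (at z)"
      unfolding q_def[abs_def]
      by (rule DERIV_cong) (use nz in \<open>simp add: divide_simps zet_uminus\<close>)
  qed (use that False in auto)
  have eq: "sig (- x) = q z * sig x" for x
  proof (cases "x \<in> L")
    case True
    then show ?thesis by (metis sig_eq_0_iff uminus_mem_iff mult_zero_right)
  next
    case False
    then show ?thesis using q[OF False] by (simp add: q_def sig_eq_0_iff field_simps)
  qed
  have "((\<lambda>x. sig (- x)) has_field_derivative 1 * (- 1)) (at 0)"
    by (rule DERIV_chain2[where g = uminus]) (auto intro!: derivative_eq_intros sig_deriv_0)
  moreover have "((\<lambda>x. sig (- x)) has_field_derivative q z * 1) (at 0)"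
    unfolding eq by (intro DERIV_cmult sig_deriv_0)
  ultimately have "q z = - 1" using DERIV_unique by fastforce
  then show ?thesis using eq by simp
qed

section \<open>Liouville arguments for elliptic functions\<close>

lemma elliptic_entire_constant:
  assumes f: "f holomorphic_on UNIV" and per: "\<And>v z. v \<in> L \<Longrightarrow> f (z + v) = f z"
  shows "f z = f 0"
proof -
  obtain p q where L: "Im (q / p) \<noteq> 0" "L = (\<lambda>(m, n). of_int m * p + of_int n * q) ` UNIV"
    using is_lattice by (rule is_latticeE)
  define B where "B = cmod p + cmod q"
  have "\<exists>w. w \<in> cball 0 B \<and> f z = f w" for z
  proof -
    have nz: "p \<noteq> 0" using L(1) by auto
    define y where "y = Im (z / p) / Im (q / p)"
    define x where "x = Re (z / p) - y * Re (q / p)"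
    have "z / p = of_real x + of_real y * (q / p)"
    proof (rule complex_eqI)
      show "Im (z / p) = Im (of_real x + of_real y * (q / p))"
        using L(1) by (simp add: y_def del: times_divide_eq_right)
      show "Re (z / p) = Re (of_real x + of_real y * (q / p))"
        by (simp add: x_def del: times_divide_eq_right)
    qed
    then have z: "z = of_real x * p + of_real y * q"
      using nz by (simp add: field_simps)
    \<comment> \<open>Dropping the integer parts of the real coordinates is a translation by a
      lattice vector; it moves \<open>z\<close> into the fundamental parallelogram, which lies in
      \<open>cball 0 B\<close>.\<close>
    define w where "w = of_real (frac x) * p + of_real (frac y) * q"
    have "z = w + (of_int \<lfloor>x\<rfloor> * p + of_int \<lfloor>y\<rfloor> * q)"
      by (simp add: z w_def frac_def algebra_simps)
    moreover have "of_int \<lfloor>x\<rfloor> * p + of_int \<lfloor>y\<rfloor> * q \<in> L"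
      unfolding L(2) by (intro image_eqI[of _ _ "(\<lfloor>x\<rfloor>, \<lfloor>y\<rfloor>)"]) auto
    ultimately have "f z = f w" using per by metis
    moreover have "cmod w \<le> B"
    proof -
      have "cmod w \<le> frac x * cmod p + frac y * cmod q"
        unfolding w_def by (rule norm_triangle_le) (simp add: norm_mult)
      also have "\<dots> \<le> 1 * cmod p + 1 * cmod q"
        by (intro add_mono mult_right_mono) (auto simp: less_imp_le[OF frac_lt_1])
      finally show ?thesis by (simp add: B_def)
    qed
    ultimately show ?thesis by auto
  qed
  then have "range f \<subseteq> f ` cball 0 B" by blast
  moreover have "bounded (f ` cball 0 B)"
    by (intro compact_imp_bounded compact_continuous_image holomorphic_on_imp_continuous_on
        holomorphic_on_subset[OF f]) auto
  ultimately have "bounded (range f)" using bounded_subset by blast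
  then obtain c where "\<And>z. f z = c"
    using Liouville_theorem[OF f] by (auto simp: constant_on_def)
  then show ?thesis by simp
qed

text \<open>If \<open>f / g\<close> is elliptic and \<open>f\<close> vanishes at the zeros of \<open>g\<close>, all of them simple, then \<open>f / g\<close>
  extends to an entire elliptic function.\<close>

lemma elliptic_quotient_constant:
  assumes f: "f holomorphic_on UNIV" and g: "g holomorphic_on UNIV"
    and count: "countable {z. g z = 0}"
    and zero: "\<And>z. g z = 0 \<Longrightarrow> f z = 0 \<and> deriv g z \<noteq> 0"
    and per: "\<And>v z. v \<in> L \<Longrightarrow> f (z + v) * g z = f z * g (z + v)"
  obtains K where "\<And>z. f z = K * g z"
proof -
  define Q where "Q z = (if g z = 0 then deriv f z / deriv g z else f z / g z)" for z
  have "Q field_differentiable (at a)" for a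
  proof (cases "g a = 0")
    case False
    have "open {z. g z \<noteq> 0}"
      by (intro open_Collect_neq holomorphic_on_imp_continuous_on[OF g] continuous_on_const)
    moreover have "(\<lambda>z. f z / g z) holomorphic_on {z. g z \<noteq> 0}"
      by (intro holomorphic_intros holomorphic_on_subset[OF f] holomorphic_on_subset[OF g]) auto
    then have "Q holomorphic_on {z. g z \<noteq> 0}"
      by (rule holomorphic_transform) (auto simp: Q_def)
    ultimately show ?thesis
      using False holomorphic_on_imp_differentiable_at by blast
  next
    case True
    note a = True zero[OF True]
    \<comment> \<open>Dividing numerator and denominator by z - a cancels the simple zero of
      \<open>g\<close>; at \<open>a\<close> itself derivatives remain, which is the value given to
      \<open>Q\<close> there.\<close>
    define f1 where "f1 z = (if z = a then deriv f a else (f z - f a) / (z - a))" for z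
    define g1 where "g1 z = (if z = a then deriv g a else (g z - g a) / (z - a))" for z
    have h: "f1 holomorphic_on UNIV" "g1 holomorphic_on UNIV"
      unfolding f1_def[abs_def] g1_def[abs_def]
      by (intro pole_lemma_open f g open_UNIV)+
    have "g1 a \<noteq> 0" using a by (simp add: g1_def)
    have op: "open {z. g1 z \<noteq> 0}"
      by (intro open_Collect_neq holomorphic_on_imp_continuous_on[OF h(2)] continuous_on_const)
    have "(\<lambda>z. f1 z / g1 z) holomorphic_on {z. g1 z \<noteq> 0}"
      by (intro holomorphic_intros holomorphic_on_subset[OF h(1)] holomorphic_on_subset[OF h(2)]) auto
    then have "Q holomorphic_on {z. g1 z \<noteq> 0}"
    proof (rule holomorphic_transform)
      fix z assume z: "z \<in> {z. g1 z \<noteq> 0}"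
      show "f1 z / g1 z = Q z"
      proof (cases "z = a")
        case False
        then have "g z \<noteq> 0" using z a by (auto simp: g1_def)
        then show ?thesis using False a by (simp add: f1_def g1_def Q_def)
      qed (use a in \<open>simp add: f1_def g1_def Q_def\<close>)
    qed
    then show ?thesis
      using op \<open>g1 a \<noteq> 0\<close> holomorphic_on_imp_differentiable_at by blast
  qed
  then have Q: "Q holomorphic_on UNIV"
    by (simp add: holomorphic_on_def field_differentiable_at_within)
  \<comment> \<open>The cross-multiplied hypothesis gives this where neither denominator vanishes;
    continuity does the rest.\<close>
  have "Q (z + v) = Q z" if v: "v \<in> L" for v z
  proof (rule eq_on_open_if_eq_off_countable[of UNIV "\<lambda>z. Q (z + v)" Q "{z. g z = 0} \<union> (\<lambda>z. z - v) ` {z. g z = 0}"])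
    fix z assume z: "z \<notin> {z. g z = 0} \<union> (\<lambda>z. z - v) ` {z. g z = 0}"
    then have "g z \<noteq> 0" by auto
    moreover have "g (z + v) \<noteq> 0"
    proof
      assume "g (z + v) = 0"
      then have "z \<in> (\<lambda>z. z - v) ` {z. g z = 0}" by (intro image_eqI[of _ _ "z + v"]) auto
      then show False using z by blast
    qed
    ultimately show "Q (z + v) = Q z" using per[OF v, of z] by (simp add: Q_def field_simps)
  next
    show "continuous_on UNIV (\<lambda>z. Q (z + v))"
      by (rule continuous_on_compose2[OF holomorphic_on_imp_continuous_on[OF Q]]) (auto intro!: continuous_intros)
  qed (use count holomorphic_on_imp_continuous_on[OF Q] in auto)
  then have c: "Q z = Q 0" for z
    using elliptic_entire_constant[OF Q] by blast
  show ?thesis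
  proof (rule that[of "Q 0"])
    show "f z = Q 0 * g z" for z
    proof (cases "g z = 0")
      case False
      then have "Q z = f z / g z" by (simp add: Q_def)
      then show ?thesis using c[of z] False by (simp add: nonzero_divide_eq_eq)
    qed (use zero in simp)
  qed
qed

section \<open>Addition formulas\<close>

lemma sig_continuous [continuous_intros]:
  "continuous_on A f \<Longrightarrow> continuous_on A (\<lambda>x. sig (f x))"
  by (rule continuous_on_compose2[OF holomorphic_on_imp_continuous_on[OF sig_holomorphic[of UNIV]]]) auto

lemma deriv_sig_holomorphic: "deriv sig holomorphic_on A"
  by (rule holomorphic_on_subset[OF holomorphic_deriv[OF sig_holomorphic[of UNIV]]]) auto

lemma deriv_sig_continuous [continuous_intros]:
  "continuous_on A f \<Longrightarrow> continuous_on A (\<lambda>x. deriv sig (f x))"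
  by (rule continuous_on_compose2[OF holomorphic_on_imp_continuous_on[OF deriv_sig_holomorphic[of UNIV]]]) auto

lemma sig_holomorphic' [holomorphic_intros]:
  "f holomorphic_on A \<Longrightarrow> (\<lambda>x. sig (f x)) holomorphic_on A"
  using holomorphic_on_compose[OF _ sig_holomorphic, of f A] by (simp add: o_def)

lemma deriv_sig_holomorphic' [holomorphic_intros]:
  "f holomorphic_on A \<Longrightarrow> (\<lambda>x. deriv sig (f x)) holomorphic_on A"
  using holomorphic_on_compose[OF _ deriv_sig_holomorphic, of f A] by (simp add: o_def)

lemma deriv_sig_uminus: "deriv sig (- z) = deriv sig z"
proof -
  have "((\<lambda>z. sig (- z)) has_field_derivative deriv sig (- z) * (- 1)) (at z)"
    by (rule DERIV_chain2[where g = uminus, OF deriv_sig]) (auto intro!: derivative_eq_intros)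
  moreover have "((\<lambda>z. sig (- z)) has_field_derivative - deriv sig z) (at z)"
    unfolding sig_uminus by (intro DERIV_minus deriv_sig)
  ultimately have "deriv sig (- z) * (- 1) = - deriv sig z" by (rule DERIV_unique)
  then show ?thesis by simp
qed

lemma countable_translate: "countable {z. z + a \<in> L}"
proof -
  have "{z. z + a \<in> L} = (\<lambda>w. w - a) ` L" by (auto simp: image_iff) (metis add_diff_cancel)
  then show ?thesis by simp
qed

lemma sig_eq_0: "z \<in> L \<Longrightarrow> sig z = 0" by (simp add: sig_eq_0_iff)

text \<open>The combination \<open>zet a + zet b + zet c - zet (a + b + c)\<close> multiplied by the
  four sigma values. The product is entire in each variable and so has a meaning at lattice
  points.\<close>

definition sig3 :: "complex \<Rightarrow> complex \<Rightarrow> complex \<Rightarrow> complex" where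
  "sig3 a b c = deriv sig a * sig b * sig c * sig (a + b + c)
     + sig a * deriv sig b * sig c * sig (a + b + c)
     + sig a * sig b * deriv sig c * sig (a + b + c)
     - sig a * sig b * sig c * deriv sig (a + b + c)"

lemma sig3_eq_zet:
  assumes "a \<notin> L" "b \<notin> L" "c \<notin> L" "a + b + c \<notin> L"
  shows "sig3 a b c = sig a * sig b * sig c * sig (a + b + c) * (zet a + zet b + zet c - zet (a + b + c))"
  using assms by (simp add: sig3_def deriv_sig_eq algebra_simps)

text \<open>The multiplier of a product of two sigma values depends only on the sum of the
  arguments, and a + (a + b + c) = (a + b) + (a + c). The increments of the two zeta terms that
  contain \<open>a\<close> cancel.\<close>

lemma sig3_quasi_periodic:
  assumes "v \<in> L" "b \<notin> L" "c \<notin> L"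
  obtains M where "\<And>a. sig3 (a + v) b c = M a * sig3 a b c"
    "\<And>a. sig (a + v + b) * sig (a + v + c) = M a * (sig (a + b) * sig (a + c))" "\<And>a. M a \<noteq> 0"
proof -
  obtain k \<eta> where k: "k \<noteq> 0" "\<And>x. sig (x + v) = k * exp (\<eta> * x) * sig x"
    "\<And>x. x \<notin> L \<Longrightarrow> zet (x + v) = zet x + \<eta>"
    by (rule sig_quasi_periodic[OF assms(1)]) blast
  define M where "M a = k * k * exp (\<eta> * (2 * a + b + c))" for a
  have M: "M a = k * exp (\<eta> * a) * (k * exp (\<eta> * (a + b + c)))"
    "M a = k * exp (\<eta> * (a + b)) * (k * exp (\<eta> * (a + c)))" for a
    by (simp_all add: M_def algebra_simps flip: exp_add)
  show ?thesis
  proof (rule that[of M])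
    fix a
    show "M a \<noteq> 0" using k by (simp add: M_def)
    have eq: "a + v + b = a + b + v" "a + v + c = a + c + v" by simp_all
    show "sig (a + v + b) * sig (a + v + c) = M a * (sig (a + b) * sig (a + c))"
      unfolding eq k(2) M(2) by (simp only: mult_ac)
    show "sig3 (a + v) b c = M a * sig3 a b c"
    proof (rule eq_on_open_if_eq_off_countable[of UNIV "\<lambda>a. sig3 (a + v) b c" "\<lambda>a. M a * sig3 a b c"
          "L \<union> {a. a + (b + c) \<in> L}"])
      fix a assume "a \<notin> L \<union> {a. a + (b + c) \<in> L}"
      then have a: "a \<notin> L" "a + b + c \<notin> L" by (simp_all add: add.assoc)
      then have av: "a + v \<notin> L" "a + b + c + v \<notin> L" using assms add_mem_iff by blast+
      have s: "a + v + b + c = a + b + c + v" by simp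
      show "sig3 (a + v) b c = M a * sig3 a b c"
        using a av assms
        by (simp only: s sig3_eq_zet k not_False_eq_True M(1)) (simp add: algebra_simps)
    qed (auto intro!: continuous_intros simp: sig3_def M_def countable_translate)
  qed
qed

text \<open>As a function of \<open>a\<close> the left side vanishes at -b and -c, where the zeta
  terms cancel in pairs, and at their translates. Since b - c is not a lattice point, these are
  simple zeros of sig(a + b) sig(a + c), so the quotient is a constant \<open>K\<close>.\<close>

lemma sig3_generic:
  assumes "b \<notin> L" "c \<notin> L" "b - c \<notin> L"
  shows "sig3 a b c = sig (b + c) * sig (a + c) * sig (a + b)"
proof -
  have g': "((\<lambda>a. sig (a + b) * sig (a + c)) has_field_derivative
      deriv sig (a + b) * sig (a + c) + deriv sig (a + c) * sig (a + b)) (at a)" for a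
    by (rule DERIV_mult[OF deriv_shift[OF deriv_sig] deriv_shift[OF deriv_sig]])
  have zero: "sig3 a b c = 0" if "a + b \<in> L \<or> a + c \<in> L" for a
  proof -
    have 0: "sig3 (- b) b c = 0" "sig3 (- c) b c = 0"
      by (simp_all add: sig3_def sig_uminus deriv_sig_uminus)
    from that show ?thesis
    proof
      assume "a + b \<in> L"
      then obtain M where M: "\<And>x. sig3 (x + (a + b)) b c = M x * sig3 x b c"
        by (rule sig3_quasi_periodic[OF _ assms(1,2)]) blast
      from M[of "- b"] show ?thesis using 0 by simp
    next
      assume "a + c \<in> L"
      then obtain M where M: "\<And>x. sig3 (x + (a + c)) b c = M x * sig3 x b c"
        by (rule sig3_quasi_periodic[OF _ assms(1,2)]) blast
      from M[of "- c"] show ?thesis using 0 by simp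
    qed
  qed
  obtain K where K: "\<And>a. sig3 a b c = K * (sig (a + b) * sig (a + c))"
  proof (rule elliptic_quotient_constant[of "\<lambda>a. sig3 a b c" "\<lambda>a. sig (a + b) * sig (a + c)"])
    have "{z. sig (z + b) * sig (z + c) = 0} = {z. z + b \<in> L} \<union> {z. z + c \<in> L}"
      by (auto simp: sig_eq_0_iff)
    then show "countable {z. sig (z + b) * sig (z + c) = 0}"
      by (simp add: countable_translate)
    fix z assume "sig (z + b) * sig (z + c) = 0"
    then have z: "z + b \<in> L \<or> z + c \<in> L" by (simp add: sig_eq_0_iff)
    have "\<not> (z + b \<in> L \<and> z + c \<in> L)"
      using diff_mem[of "z + b" "z + c"] assms by auto
    then show "sig3 z b c = 0 \<and> deriv (\<lambda>a. sig (a + b) * sig (a + c)) z \<noteq> 0"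
      using z zero[of z] DERIV_imp_deriv[OF g', of z] sig_simple_zero[of "z + b"] sig_simple_zero[of "z + c"]
        sig_eq_0_iff[of "z + b"] sig_eq_0_iff[of "z + c"] by auto
  next
    fix v z assume "v \<in> L"
    then obtain M where
      "\<And>a. sig3 (a + v) b c = M a * sig3 a b c"
      "\<And>a. sig (a + v + b) * sig (a + v + c) = M a * (sig (a + b) * sig (a + c))"
      by (rule sig3_quasi_periodic[OF _ assms(1,2)]) blast
    then show "sig3 (z + v) b c * (sig (z + b) * sig (z + c)) = sig3 z b c * (sig (z + v + b) * sig (z + v + c))"
      by simp
  qed (auto intro!: holomorphic_intros simp: sig3_def)
  have "sig b * sig c \<noteq> 0" using assms by (simp add: sig_eq_0_iff)
  \<comment> \<open>At a = 0 only the term with \<open>deriv sig a\<close> survives, and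
    \<open>deriv sig 0\<close> is 1.\<close>
  moreover have "sig b * sig c * sig (b + c) = K * (sig b * sig c)"
    using K[of 0] by (simp add: sig3_def sig_eq_0 deriv_sig_0)
  ultimately have "K = sig (b + c)" by (simp add: field_simps)
  then show ?thesis using K by (simp add: mult_ac)
qed

text \<open>Both sides are continuous: the exceptional \<open>b\<close> are filled in for fixed
  \<open>c\<close>, then the exceptional \<open>c\<close>.\<close>

theorem sig3_eq: "sig3 a b c = sig (b + c) * sig (a + c) * sig (a + b)"
proof -
  have c: "sig3 a b c = sig (b + c) * sig (a + c) * sig (a + b)" if "c \<notin> L" for b c
  proof (rule eq_on_open_if_eq_off_countable[of UNIV "\<lambda>b. sig3 a b c" "\<lambda>b. sig (b + c) * sig (a + c) * sig (a + b)"
          "L \<union> {b. b + (- c) \<in> L}"])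
    fix b :: complex assume "b \<notin> L \<union> {b. b + (- c) \<in> L}"
    then show "sig3 a b c = sig (b + c) * sig (a + c) * sig (a + b)"
      using that by (intro sig3_generic) auto
  qed (auto intro!: continuous_intros simp: sig3_def countable_translate simp del: add_uminus_conv_diff)
  show ?thesis
    by (rule eq_on_open_if_eq_off_countable[of UNIV "\<lambda>c. sig3 a b c" "\<lambda>c. sig (b + c) * sig (a + c) * sig (a + b)" L])
       (use c in \<open>auto intro!: continuous_intros simp: sig3_def\<close>)
qed

text \<open>The factor \<open>sig (b + c)\<close> is kept apart because it vanishes at c = -b, where
  the derivative of the right side is then the value of the remaining quotient.\<close>

lemma zet3:
  assumes "a \<notin> L" "b \<notin> L" "c \<notin> L" "a + b + c \<notin> L"
  shows "zet a + zet b + zet c - zet (a + b + c)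
    = sig (b + c) * (sig (a + c) * sig (a + b) / (sig a * sig b * sig c * sig (a + b + c)))"
  using sig3_eq[of a b c] assms
  by (simp add: sig3_eq_zet[OF assms] sig_eq_0_iff divide_simps) (simp add: mult_ac)

lemma open_add_mem: "open {z. z + c \<notin> L}"
proof -
  have "open ((\<lambda>z. z + c) -` (- L))"
    by (intro continuous_open_vimage) (auto intro!: continuous_intros)
  then show ?thesis by (simp add: vimage_def)
qed

text \<open>Differentiate \<open>zet3\<close> in \<open>c\<close> at \<open>c = -b\<close>.\<close>

lemma wp_diff:
  assumes a: "a \<notin> L" and b: "b \<notin> L"
  shows "wp a - wp b = - sig (a + b) * sig (a - b) / ((sig a)\<^sup>2 * (sig b)\<^sup>2)"
proof -
  let ?r = "\<lambda>c. sig (a + c) * sig (a + b) / (sig a * sig b * sig c * sig (a + b + c))"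
  define l where "l c = zet a + zet b + zet c - zet (c + (a + b))" for c
  have mb: "- b \<notin> L" using b by auto
  have "((\<lambda>c. zet (c + (a + b))) has_field_derivative - wp a) (at (- b))"
    by (rule deriv_shift) (use zet_deriv[OF a] in simp)
  from DERIV_diff[OF DERIV_add[OF DERIV_const zet_deriv[OF mb]] this]
  have l: "(l has_field_derivative wp a - wp b) (at (- b))"
    unfolding l_def[abs_def] by (rule DERIV_cong) (simp add: wp_uminus)
  have nz: "sig a \<noteq> 0" "sig b \<noteq> 0" using a b by (auto simp: sig_eq_0_iff)
  have den: "(\<lambda>c. sig a * sig b * sig c * sig (a + b + c)) field_differentiable (at (- b))"
    by (rule holomorphic_on_imp_differentiable_at[of _ UNIV]) (auto intro!: holomorphic_intros)
  have num: "(\<lambda>c. sig (a + c) * sig (a + b)) field_differentiable (at (- b))"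
    by (rule holomorphic_on_imp_differentiable_at[of _ UNIV]) (auto intro!: holomorphic_intros)
  have "?r field_differentiable (at (- b))"
    by (rule field_differentiable_divide[OF num den]) (use nz in \<open>simp add: sig_uminus\<close>)
  then obtain D where D: "(?r has_field_derivative D) (at (- b))"
    by (auto simp: field_differentiable_def)
  have "((\<lambda>c. sig (c + b)) has_field_derivative 1) (at (- b))"
    by (rule deriv_shift) (use sig_deriv_0 in simp)
  from DERIV_mult[OF this D]
  have "((\<lambda>c. sig (c + b) * ?r c) has_field_derivative ?r (- b)) (at (- b))"
    by (rule DERIV_cong) (simp add: sig_eq_0)
  then have "(l has_field_derivative ?r (- b)) (at (- b))"
  proof (rule has_field_derivative_transform_within_open)
    show "open (- L \<inter> {z. z + (a + b) \<notin> L})" by (intro open_Int open_minus_L open_add_mem)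
    show "- b \<in> - L \<inter> {z. z + (a + b) \<notin> L}" using a b by simp
    fix c assume "c \<in> - L \<inter> {z. z + (a + b) \<notin> L}"
    then have "c \<notin> L" "a + b + c \<notin> L" by (auto simp: add_ac)
    from zet3[OF a b this] show "sig (c + b) * ?r c = l c"
      by (simp add: l_def add_ac)
  qed
  from DERIV_unique[OF l this] show ?thesis
    by (simp add: sig_uminus power2_eq_square mult_ac)
qed

lemma wp_eq_iff:
  assumes "a \<notin> L" "b \<notin> L"
  shows "wp a = wp b \<longleftrightarrow> a + b \<in> L \<or> a - b \<in> L"
proof -
  have "wp a = wp b \<longleftrightarrow> wp a - wp b = 0" by simp
  also have "\<dots> \<longleftrightarrow> sig (a + b) = 0 \<or> sig (a - b) = 0"
    unfolding wp_diff[OF assms] using assms by (simp add: sig_eq_0_iff)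
  finally show ?thesis by (simp add: sig_eq_0_iff)
qed

text \<open>The confluent case of \<open>wp_diff\<close>: as z tends to a, the right side vanishes
  through sig(z - a), whose derivative there is 1.\<close>

lemma wp'_eq:
  assumes a: "a \<notin> L"
  shows "wp' a = - sig (2 * a) / sig a ^ 4"
proof -
  let ?r = "\<lambda>z. - sig (z + a) / ((sig z)\<^sup>2 * (sig a)\<^sup>2)"
  have nz: "sig a \<noteq> 0" using a by (auto simp: sig_eq_0_iff)
  have den: "(\<lambda>z. (sig z)\<^sup>2 * (sig a)\<^sup>2) field_differentiable (at a)"
    by (rule holomorphic_on_imp_differentiable_at[of _ UNIV]) (auto intro!: holomorphic_intros)
  have num: "(\<lambda>z. - sig (z + a)) field_differentiable (at a)"
    by (rule holomorphic_on_imp_differentiable_at[of _ UNIV]) (auto intro!: holomorphic_intros)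
  have "?r field_differentiable (at a)"
    by (rule field_differentiable_divide[OF num den]) (use nz in simp)
  then obtain D where D: "(?r has_field_derivative D) (at a)"
    by (auto simp: field_differentiable_def)
  have "((\<lambda>z. sig (z + - a)) has_field_derivative 1) (at a)"
    by (rule deriv_shift) (use sig_deriv_0 in simp)
  then have "((\<lambda>z. sig (z - a)) has_field_derivative 1) (at a)" by simp
  from DERIV_mult[OF this D]
  have "((\<lambda>z. sig (z - a) * ?r z) has_field_derivative ?r a) (at a)"
    by (rule DERIV_cong) (simp add: sig_eq_0)
  then have "((\<lambda>z. wp z - wp a) has_field_derivative ?r a) (at a)"
  proof (rule has_field_derivative_transform_within_open)
    fix z assume "z \<in> - L"
    then show "sig (z - a) * ?r z = wp z - wp a"
      using wp_diff[of z a] a by simp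
  qed (use a in auto)
  moreover have "((\<lambda>z. wp z - wp a) has_field_derivative wp' a) (at a)"
    using DERIV_diff[OF wp_deriv[OF a] DERIV_const] by simp
  ultimately have "?r a = wp' a" by (rule DERIV_unique)
  moreover have "a + a = 2 * a" "(sig a)\<^sup>2 * (sig a)\<^sup>2 = sig a ^ 4"
    by (simp_all flip: power_add)
  ultimately show ?thesis by (simp only:)
qed

lemma wp'_eq_0_iff:
  assumes "a \<notin> L"
  shows "wp' a = 0 \<longleftrightarrow> 2 * a \<in> L"
  unfolding wp'_eq[OF assms] using assms by (simp add: sig_eq_0_iff)

lemma zet_add_algebra:
  fixes x y :: complex
  assumes "x \<noteq> 0" "y \<noteq> 0"
  shows "(- d * (s * z * 2) * (x\<^sup>2 * y\<^sup>2) - - d * s * (2 * x * (x * p) * y\<^sup>2 + x\<^sup>2 * (2 * y * (y * q))))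
      / (x\<^sup>2 * y\<^sup>2 * (x\<^sup>2 * y\<^sup>2)) = - d * s / (x\<^sup>2 * y\<^sup>2) * (2 * (z - p - q))"
  using assms by (simp add: divide_simps) (simp add: algebra_simps power2_eq_square)

text \<open>The logarithmic derivative of \<open>wp_diff\<close> when both arguments move at the
  same speed: a - b stays fixed, so only sig(a + b) and the two denominators contribute.\<close>

lemma zet_add:
  assumes a: "a \<notin> L" and b: "b \<notin> L" and ab: "a + b \<notin> L"
  shows "wp' a - wp' b = 2 * (wp a - wp b) * (zet (a + b) - zet a - zet b)"
proof -
  let ?n = "\<lambda>t. sig (2 * t + (a + b))" and ?d = "\<lambda>t. (sig (t + a))\<^sup>2 * (sig (t + b))\<^sup>2"
  let ?f = "\<lambda>t. - sig (a - b) * ?n t / ?d t"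
  have nz: "sig a \<noteq> 0" "sig b \<noteq> 0" using a b by (auto simp: sig_eq_0_iff)
  have sa: "((\<lambda>t. sig (t + a)) has_field_derivative sig a * zet a) (at 0)"
    by (rule deriv_shift) (use sig_deriv[OF a] in simp)
  have sb: "((\<lambda>t. sig (t + b)) has_field_derivative sig b * zet b) (at 0)"
    by (rule deriv_shift) (use sig_deriv[OF b] in simp)
  have sab: "(?n has_field_derivative sig (a + b) * zet (a + b) * 2) (at 0)"
    by (rule DERIV_chain2[where g = "\<lambda>t. 2 * t + (a + b)"])
       (use sig_deriv[OF ab] in simp, auto intro!: derivative_eq_intros)
  have "(?d has_field_derivative
      2 * sig a * (sig a * zet a) * (sig b)\<^sup>2 + (sig a)\<^sup>2 * (2 * sig b * (sig b * zet b))) (at 0)"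
    by (rule DERIV_cong[OF DERIV_mult[OF DERIV_power[OF sa, of 2] DERIV_power[OF sb, of 2]]]) simp
  note d = this
  have "(?f has_field_derivative (- sig (a - b) * sig (a + b) / ((sig a)\<^sup>2 * (sig b)\<^sup>2)) *
      (2 * (zet (a + b) - zet a - zet b))) (at 0)"
    by (rule DERIV_cong[OF DERIV_divide[OF DERIV_cmult[OF sab, of "- sig (a - b)"] d]])
       (use nz in simp, simp only: add_0 mult_zero_right zet_add_algebra[OF nz])
  then have f: "(?f has_field_derivative (wp a - wp b) * (2 * (zet (a + b) - zet a - zet b))) (at 0)"
    using wp_diff[OF a b] by (simp add: mult_ac)
  have "((\<lambda>t. wp (t + a) - wp (t + b)) has_field_derivative (wp a - wp b) * (2 * (zet (a + b) - zet a - zet b))) (at 0)"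
  proof (rule has_field_derivative_transform_within_open[OF f])
    show "open ({z. z + a \<notin> L} \<inter> {z. z + b \<notin> L})" by (intro open_Int open_add_mem)
    show "0 \<in> {z. z + a \<notin> L} \<inter> {z. z + b \<notin> L}" using a b by simp
    fix t assume "t \<in> {z. z + a \<notin> L} \<inter> {z. z + b \<notin> L}"
    then have "t + a \<notin> L" "t + b \<notin> L" by auto
    from wp_diff[OF this] show "?f t = wp (t + a) - wp (t + b)"
      by (simp add: algebra_simps)
  qed
  note 1 = this
  have "((\<lambda>t. wp (t + a) - wp (t + b)) has_field_derivative wp' a - wp' b) (at 0)"
    by (intro DERIV_diff deriv_shift) (simp_all add: wp_deriv a b)
  from DERIV_unique[OF this 1] show ?thesis by (simp only: mult_ac)
qed

text \<open>The derivative of \<open>zet_add\<close> in its first argument, the second being fixed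
  at \<open>a\<close>: the factor wp(z) - wp(a) vanishes at \<open>a\<close>, so only its derivative
  enters.\<close>

lemma wp_double_deriv:
  assumes a: "a \<notin> L" and aa: "2 * a \<notin> L" and d: "(wp' has_field_derivative D) (at a)"
  shows "D = 2 * wp' a * (zet (2 * a) - 2 * zet a)"
proof -
  let ?h = "\<lambda>z. zet (z + a) - zet z - zet a"
  have "((\<lambda>z. zet (z + a)) has_field_derivative - wp (2 * a)) (at a)"
    by (rule deriv_shift) (use zet_deriv[OF aa] in \<open>simp only: mult_2\<close>)
  from DERIV_diff[OF DERIV_diff[OF this zet_deriv[OF a]] DERIV_const]
  have h: "(?h has_field_derivative - wp (2 * a) + wp a) (at a)" by simp
  have w: "((\<lambda>z. 2 * (wp z - wp a)) has_field_derivative 2 * wp' a) (at a)"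
    using DERIV_cmult[OF DERIV_diff[OF wp_deriv[OF a] DERIV_const], of 2] by simp
  have "((\<lambda>z. 2 * (wp z - wp a) * ?h z) has_field_derivative 2 * wp' a * ?h a) (at a)"
    by (rule DERIV_cong[OF DERIV_mult[OF w h]]) simp
  then have "((\<lambda>z. wp' z - wp' a) has_field_derivative 2 * wp' a * ?h a) (at a)"
  proof (rule has_field_derivative_transform_within_open)
    show "open (- L \<inter> {z. z + a \<notin> L})" by (intro open_Int open_minus_L open_add_mem)
    show "a \<in> - L \<inter> {z. z + a \<notin> L}" using a aa by (simp only: mult_2 Int_iff Compl_iff mem_Collect_eq simp_thms)
    fix z assume "z \<in> - L \<inter> {z. z + a \<notin> L}"
    then show "2 * (wp z - wp a) * ?h z = wp' z - wp' a"
      using zet_add[of z a] a by simp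
  qed
  moreover have "((\<lambda>z. wp' z - wp' a) has_field_derivative D) (at a)"
    using DERIV_diff[OF d DERIV_const] by simp
  ultimately have "2 * wp' a * ?h a = D" by (rule DERIV_unique)
  moreover have "?h a = zet (2 * a) - 2 * zet a" by simp
  ultimately show ?thesis by (simp only:)
qed

section \<open>The differential equation\<close>

definition G :: "nat \<Rightarrow> complex" where "G k = eisenstein_sum k L"

section \<open>Laurent expansion at the origin\<close>

lemma summable_inverse_power:
  assumes "k \<ge> 3"
  shows "(\<lambda>w. 1 / w ^ k) summable_on (L - {0})"
proof -
  obtain d where d: "d > 0" "\<And>w. w \<in> L \<Longrightarrow> cmod w < d \<Longrightarrow> w = 0"
    using isolated by blast
  have s: "(\<lambda>w. 1 / d ^ (k - 3) * (1 / cmod w ^ 3)) summable_on (L - {0})"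
    by (intro summable_on_cmult_right summable_inverse_cube)
  show ?thesis
  proof (rule summable_on_norm_le[OF s])
    fix w assume w: "w \<in> L - {0}"
    then have "d \<le> cmod w" using d(2)[of w] by force
    then have "d ^ (k - 3) * cmod w ^ 3 \<le> cmod w ^ (k - 3) * cmod w ^ 3"
      using d(1) by (intro mult_right_mono power_mono) auto
    also have "\<dots> = cmod w ^ k" using assms by (simp flip: power_add)
    finally have "1 / cmod w ^ k \<le> 1 / (d ^ (k - 3) * cmod w ^ 3)"
      using w d(1) by (intro divide_left_mono) auto
    then show "norm (1 / w ^ k) \<le> 1 / d ^ (k - 3) * (1 / cmod w ^ 3)"
      by (simp add: norm_divide norm_power)
  qed
qed

text \<open>The Laurent terms (2k+1) z^(2k) / w^(2k+2) with k >= 3, divided by z^6 and summed over k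
  in closed form. Keeping the remainder as an explicit lattice series makes it holomorphic by
  domination.\<close>

definition wp_rem :: "complex \<Rightarrow> complex" where
  "wp_rem z = (\<Sum>\<^sub>\<infinity>w\<in>L - {0}. (7 * w\<^sup>2 - 5 * z\<^sup>2) / (w ^ 6 * (z\<^sup>2 - w\<^sup>2)\<^sup>2))"

text \<open>The Laurent expansion at \<open>0\<close> comes from averaging the summand over \<open>w\<close> and \<open>-w\<close>.\<close>

lemma laurent_algebra:
  fixes w z :: complex
  assumes "w \<noteq> 0" "z \<noteq> w" "z \<noteq> - w"
  shows "(1 / (z - w)\<^sup>2 - 1 / w\<^sup>2 + (1 / (z + w)\<^sup>2 - 1 / w\<^sup>2)) / 2
    = 3 * z\<^sup>2 * (1 / w ^ 4) + 5 * z ^ 4 * (1 / w ^ 6) + z ^ 6 * ((7 * w\<^sup>2 - 5 * z\<^sup>2) / (w ^ 6 * (z\<^sup>2 - w\<^sup>2)\<^sup>2))"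
proof -
  define W Z where "W = w\<^sup>2" and "Z = z\<^sup>2"
  define p q where "p = z - w" and "q = z + w"
  have nz: "p \<noteq> 0" "q \<noteq> 0" "W \<noteq> 0" using assms by (auto simp: p_def q_def W_def add_eq_0_iff2)
  have pq: "p * q = Z - W" by (simp add: p_def q_def W_def Z_def power2_eq_square algebra_simps)
  define D where "D = (Z - W)\<^sup>2"
  have D: "D \<noteq> 0" using nz by (simp add: D_def flip: pq)
  have pqD: "p\<^sup>2 * q\<^sup>2 = D" by (simp add: D_def power_mult_distrib flip: pq)
  have pw: "w ^ 4 = W ^ 2" "w ^ 6 = W ^ 3" "z ^ 4 = Z ^ 2" "z ^ 6 = Z ^ 3"
    by (simp_all add: W_def Z_def flip: power_mult)
  have "1 / p\<^sup>2 + 1 / q\<^sup>2 = (q\<^sup>2 + p\<^sup>2) / D"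
    using nz unfolding pqD[symmetric] by (simp add: add_divide_distrib)
  also have "q\<^sup>2 + p\<^sup>2 = 2 * (Z + W)"
    by (simp add: p_def q_def W_def Z_def power2_eq_square algebra_simps)
  finally have e: "1 / p\<^sup>2 + 1 / q\<^sup>2 = 2 * (Z + W) / D" .
  have "(1 / p\<^sup>2 - 1 / W + (1 / q\<^sup>2 - 1 / W)) / 2 = (1 / p\<^sup>2 + 1 / q\<^sup>2) / 2 - 1 / W"
    by (simp add: add_divide_distrib diff_divide_distrib)
  also have "2 * x / D / 2 = x / D" for x by simp
  then have "(1 / p\<^sup>2 + 1 / q\<^sup>2) / 2 - 1 / W = (Z + W) / D - 1 / W" unfolding e by (simp only:)
  also have "\<dots> = ((Z + W) * W ^ 3 - W ^ 2 * D) / (W ^ 3 * D)"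
    using D nz(3) by (simp add: divide_simps) (simp add: algebra_simps power2_eq_square power3_eq_cube)
  also have "(Z + W) * W ^ 3 - W ^ 2 * D = 3 * Z * W * D + 5 * Z ^ 2 * D + Z ^ 3 * (7 * W - 5 * Z)"
    unfolding D_def by algebra
  also have "\<dots> / (W ^ 3 * D) = 3 * Z * (1 / W ^ 2) + 5 * Z ^ 2 * (1 / W ^ 3) + Z ^ 3 * ((7 * W - 5 * Z) / (W ^ 3 * D))"
    using D nz(3) by (simp add: add_divide_distrib power2_eq_square power3_eq_cube)
  finally show ?thesis
    unfolding pw D_def p_def q_def by (simp only: W_def Z_def)
qed

lemma wp_summable: "(\<lambda>w. 1 / (z - w)\<^sup>2 - 1 / w\<^sup>2) summable_on (L - {0})"
proof -
  define R where "R = cmod z + 1"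
  have R: "R > 0" "z \<in> ball 0 R" by (auto simp: R_def add_nonneg_pos)
  show ?thesis
    unfolding near_far(1)[of R]
    by (intro summable_on_Un_disjoint summable_far_terms[OF R] summable_on_finite near_far)
qed

context
  fixes d :: real
  assumes d: "d > 0" and dL: "\<forall>w\<in>L. cmod w < 2 * d \<longrightarrow> w = 0"
begin

lemma small_basic:
  assumes "w \<in> L - {0}" "z \<in> ball 0 d"
  shows "2 * d \<le> cmod w" "w \<noteq> 0" "z \<noteq> w" "z \<noteq> - w" "cmod z \<le> cmod w / 2"
    "z\<^sup>2 - w\<^sup>2 \<noteq> 0" "(cmod w)\<^sup>2 * 3 / 4 \<le> cmod (z\<^sup>2 - w\<^sup>2)"
proof -
  show 1: "2 * d \<le> cmod w" "w \<noteq> 0" using dL assms by force+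
  show 2: "cmod z \<le> cmod w / 2" "z \<noteq> w" "z \<noteq> - w" using 1 assms d by auto
  have "(cmod z)\<^sup>2 \<le> (cmod w / 2)\<^sup>2" using 2(1) by (intro power_mono) auto
  then have z: "cmod (z\<^sup>2) \<le> (cmod w)\<^sup>2 / 4" by (simp add: norm_power power_divide)
  have "cmod (w\<^sup>2) - cmod (z\<^sup>2) \<le> cmod (z\<^sup>2 - w\<^sup>2)"
    by (metis norm_minus_commute norm_triangle_ineq2)
  then show 3: "(cmod w)\<^sup>2 * 3 / 4 \<le> cmod (z\<^sup>2 - w\<^sup>2)"
    using z by (simp add: norm_power)
  have "(cmod w)\<^sup>2 * 3 / 4 > 0" using 1 by simp
  then show "z\<^sup>2 - w\<^sup>2 \<noteq> 0" using 3 by (metis linorder_not_le norm_zero)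
qed

lemma wp_rem_bound:
  assumes "w \<in> L - {0}" "z \<in> ball 0 d"
  shows "cmod ((7 * w\<^sup>2 - 5 * z\<^sup>2) / (w ^ 6 * (z\<^sup>2 - w\<^sup>2)\<^sup>2)) \<le> (16 / d ^ 5) / cmod w ^ 3"
proof -
  note b = small_basic[OF assms]
  have "(cmod z)\<^sup>2 \<le> (cmod w / 2)\<^sup>2" using b by (intro power_mono) auto
  then have z: "cmod (z\<^sup>2) \<le> (cmod w)\<^sup>2 / 4" by (simp add: norm_power power_divide)
  have "cmod (7 * w\<^sup>2 - 5 * z\<^sup>2) \<le> cmod (7 * w\<^sup>2) + cmod (5 * z\<^sup>2)"
    by (rule norm_triangle_ineq4)
  moreover have "cmod (7 * w\<^sup>2) = 7 * (cmod w)\<^sup>2" "cmod (5 * z\<^sup>2) = 5 * cmod (z\<^sup>2)"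
    by (simp_all add: norm_mult norm_power)
  moreover have "0 \<le> (cmod w)\<^sup>2" by simp
  \<comment> \<open>Since |z|^2 <= |w|^2 / 4, the factor is at most 7 + 5/4, rounded up to 9 so that
    it cancels against (3/4)^2 = 9/16 below.\<close>
  ultimately have num: "cmod (7 * w\<^sup>2 - 5 * z\<^sup>2) \<le> 9 * (cmod w)\<^sup>2"
    using z by linarith
  have "((cmod w)\<^sup>2 * 3 / 4)\<^sup>2 \<le> (cmod (z\<^sup>2 - w\<^sup>2))\<^sup>2"
    using b by (intro power_mono) auto
  then have den: "cmod w ^ 6 * ((cmod w)\<^sup>2 * 3 / 4)\<^sup>2 \<le> cmod (w ^ 6 * (z\<^sup>2 - w\<^sup>2)\<^sup>2)"
    by (simp add: norm_mult norm_power mult_left_mono)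
  have "cmod ((7 * w\<^sup>2 - 5 * z\<^sup>2) / (w ^ 6 * (z\<^sup>2 - w\<^sup>2)\<^sup>2))
      \<le> 9 * (cmod w)\<^sup>2 / (cmod w ^ 6 * ((cmod w)\<^sup>2 * 3 / 4)\<^sup>2)"
    unfolding norm_divide by (rule frac_le[OF _ num _ den]) (use b in auto)
  also have "\<dots> = 16 / cmod w ^ 8"
    using b by (simp add: field_simps power2_eq_square power_numeral_reduce)
  also have "\<dots> = 16 / (cmod w ^ 5 * cmod w ^ 3)" by (simp flip: power_add)
  also have "\<dots> \<le> 16 / (d ^ 5 * cmod w ^ 3)"
    using b d by (intro divide_left_mono mult_right_mono power_mono) auto
  finally show ?thesis by simp
qed

lemma summable_wp_rem: "(\<lambda>w. (16 / d ^ 5) / cmod w ^ 3) summable_on (L - {0})"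
  using summable_on_cmult_right[OF summable_inverse_cube, of "16 / d ^ 5"] by simp

lemma wp_rem_holomorphic: "wp_rem holomorphic_on ball 0 d"
  unfolding wp_rem_def[abs_def]
proof (rule infsum_holomorphic[OF open_ball _ wp_rem_bound summable_wp_rem])
  fix w assume "w \<in> L - {0}"
  then show "(\<lambda>z. (7 * w\<^sup>2 - 5 * z\<^sup>2) / (w ^ 6 * (z\<^sup>2 - w\<^sup>2)\<^sup>2)) holomorphic_on ball 0 d"
    using small_basic(2,6) by (intro holomorphic_intros) auto
qed

lemma wp_laurent:
  assumes z: "z \<in> ball 0 d"
  shows "wp z = 1 / z\<^sup>2 + 3 * G 4 * z\<^sup>2 + 5 * G 6 * z ^ 4 + z ^ 6 * wp_rem z"
proof -
  let ?f = "\<lambda>w. 1 / (z - w)\<^sup>2 - 1 / w\<^sup>2" and ?g = "\<lambda>w. 1 / (z + w)\<^sup>2 - 1 / w\<^sup>2"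
  let ?r = "\<lambda>w. (7 * w\<^sup>2 - 5 * z\<^sup>2) / (w ^ 6 * (z\<^sup>2 - w\<^sup>2)\<^sup>2)"
  have fg: "infsum ?g (L - {0}) = infsum ?f (L - {0})"
    by (rule infsum_reindex_bij_witness[of _ uminus uminus]) auto
  have sg: "?g summable_on (L - {0})"
    by (rule iffD1[OF summable_on_reindex_bij_witness[of _ uminus uminus] wp_summable[of z]]) auto
  have sr: "?r summable_on (L - {0})"
    by (rule summable_on_norm_le[OF summable_wp_rem]) (use wp_rem_bound z in auto)
  have "((\<lambda>w. (?f w + ?g w) / 2) has_sum (infsum ?f (L - {0}) + infsum ?g (L - {0})) / 2) (L - {0})"
    by (intro has_sum_divide_const has_sum_add has_sum_infsum wp_summable sg)
  then have "infsum ?f (L - {0}) = (\<Sum>\<^sub>\<infinity>w\<in>L - {0}. (?f w + ?g w) / 2)"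
    unfolding fg by (simp add: infsumI)
  also have "\<dots> = (\<Sum>\<^sub>\<infinity>w\<in>L - {0}. 3 * z\<^sup>2 * (1 / w ^ 4) + 5 * z ^ 4 * (1 / w ^ 6) + z ^ 6 * ?r w)"
    by (rule infsum_cong, rule laurent_algebra) (use small_basic(2-4)[OF _ z] in auto)
  also have "\<dots> = 3 * z\<^sup>2 * G 4 + 5 * z ^ 4 * G 6 + z ^ 6 * wp_rem z"
    unfolding G_def eisenstein_sum_def wp_rem_def
    by (intro infsumI has_sum_add has_sum_cmult_right has_sum_infsum summable_inverse_power sr) auto
  finally show ?thesis by (simp add: wp_def mult_ac)
qed

lemma wp'_laurent:
  assumes z: "z \<in> ball 0 d" "z \<noteq> 0"
  shows "wp' z = - 2 / z ^ 3 + 6 * G 4 * z + 20 * G 6 * z ^ 3 + 6 * z ^ 5 * wp_rem z + z ^ 6 * deriv wp_rem z"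
proof -
  have "z \<notin> L" using dL z d by auto
  then have 1: "(wp has_field_derivative wp' z) (at z)" by (rule wp_deriv)
  have r: "(wp_rem has_field_derivative deriv wp_rem z) (at z)"
    by (rule holomorphic_derivI[OF wp_rem_holomorphic open_ball z(1)])
  have i: "((\<lambda>z. 1 / z\<^sup>2) has_field_derivative - 2 / z ^ 3) (at z)"
    using inverse_square_deriv[OF z(2), of 0] by simp
  have "((\<lambda>z. 3 * G 4 * z\<^sup>2 + 5 * G 6 * z ^ 4 + z ^ 6 * wp_rem z) has_field_derivative
     (6 * G 4 * z + 20 * G 6 * z ^ 3 + 6 * z ^ 5 * wp_rem z + z ^ 6 * deriv wp_rem z)) (at z)"
    by (auto intro!: derivative_eq_intros r)
  from DERIV_add[OF i this]
  have "((\<lambda>z. 1 / z\<^sup>2 + 3 * G 4 * z\<^sup>2 + 5 * G 6 * z ^ 4 + z ^ 6 * wp_rem z) has_field_derivative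
     (- 2 / z ^ 3 + 6 * G 4 * z + 20 * G 6 * z ^ 3 + 6 * z ^ 5 * wp_rem z + z ^ 6 * deriv wp_rem z)) (at z)"
    by (simp only: add.assoc)
  then have "(wp has_field_derivative
     (- 2 / z ^ 3 + 6 * G 4 * z + 20 * G 6 * z ^ 3 + 6 * z ^ 5 * wp_rem z + z ^ 6 * deriv wp_rem z)) (at z)"
    by (rule has_field_derivative_transform_within_open[of _ _ _ "ball 0 d"]) (use z wp_laurent in auto)
  from DERIV_unique[OF 1 this] show ?thesis .
qed

end

lemma small_radius:
  obtains d where "d > 0" "\<forall>w\<in>L. cmod w < 2 * d \<longrightarrow> w = 0"
proof -
  obtain d where "d > 0" "\<And>w. w \<in> L \<Longrightarrow> cmod w < d \<Longrightarrow> w = 0"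
    using isolated by blast
  then show ?thesis by (intro that[of "d / 2"]) auto
qed

text \<open>Periodicity transports the removable singularity at 0 to every lattice point, so
  \<open>f\<close> extends to an entire elliptic function. Liouville makes it constant, and
  \<open>F 0 = 0\<close> is its value.\<close>

lemma elliptic_vanishing:
  assumes f: "f holomorphic_on - L" and per: "\<And>v z. v \<in> L \<Longrightarrow> z \<notin> L \<Longrightarrow> f (z + v) = f z"
    and F: "F holomorphic_on ball 0 e" "F 0 = 0" "e > 0"
    and eq: "\<And>z. z \<in> ball 0 e \<Longrightarrow> z \<notin> L \<Longrightarrow> f z = F z"
    and z: "z \<notin> L"
  shows "f z = 0"
proof -
  define h where "h z = (if z \<in> L then 0 else f z)" for z
  obtain d where d: "d > 0" "\<And>w. w \<in> L \<Longrightarrow> cmod w < d \<Longrightarrow> w = 0"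
    using isolated by blast
  have "h field_differentiable (at x)" for x
  proof (cases "x \<in> L")
    case False
    have "h holomorphic_on - L"
      by (rule holomorphic_transform[OF f]) (auto simp: h_def)
    then show ?thesis
      using False holomorphic_on_imp_differentiable_at[OF _ open_minus_L] by blast
  next
    case True
    let ?r = "min d e"
    have "F \<circ> (\<lambda>y. y - x) holomorphic_on ball x ?r"
      by (rule holomorphic_on_compose_gen[OF _ F(1)])
         (auto simp: dist_norm norm_minus_commute intro!: holomorphic_intros)
    then have "(\<lambda>y. F (y - x)) holomorphic_on ball x ?r" by (simp add: o_def)
    then have "h holomorphic_on ball x ?r"
    proof (rule holomorphic_transform)
      fix y assume y: "y \<in> ball x ?r"
      show "F (y - x) = h y"
      proof (cases "y \<in> L")
        case True
        then have "y - x = 0"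
          using d(2)[of "y - x"] \<open>x \<in> L\<close> diff_mem y by (auto simp: dist_norm norm_minus_commute)
        then show ?thesis using True F by (simp add: h_def)
      next
        case False
        then have "y - x \<notin> L" using diff_mem_iff \<open>x \<in> L\<close> by blast
        moreover have "y - x \<in> ball 0 e" using y by (auto simp: dist_norm norm_minus_commute)
        ultimately show ?thesis
          using eq[of "y - x"] per[OF \<open>x \<in> L\<close>, of "y - x"] False by (simp add: h_def)
      qed
    qed
    then show ?thesis
      using F d by (intro holomorphic_on_imp_differentiable_at[of _ "ball x ?r"]) auto
  qed
  then have "h holomorphic_on UNIV"
    by (simp add: holomorphic_on_def field_differentiable_at_within)
  moreover have "h (z + v) = h z" if "v \<in> L" for z v
    using that per add_mem_iff(1)[OF that] by (auto simp: h_def)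
  ultimately have "h z = h 0" by (rule elliptic_entire_constant)
  then show ?thesis using z by (simp add: h_def)
qed

lemma wp_holomorphic: "wp holomorphic_on - L"
  using wp_deriv by (subst holomorphic_on_open) auto

lemma wp'_holomorphic: "wp' holomorphic_on - L"
proof -
  have "deriv wp holomorphic_on - L"
    by (rule holomorphic_deriv[OF wp_holomorphic open_minus_L])
  then show ?thesis
    by (rule holomorphic_transform) (use wp_deriv DERIV_imp_deriv in auto)
qed

text \<open>All negative powers of \<open>z\<close> cancel and a factor z^2 remains, so the right
  side is of the form required by \<open>elliptic_vanishing\<close>.\<close>

lemma ode_algebra:
  fixes z x y a b r r' :: complex
  assumes "z \<noteq> 0" "x = 1 / z\<^sup>2 + 3 * a * z\<^sup>2 + 5 * b * z ^ 4 + z ^ 6 * r"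
    "y = - 2 / z ^ 3 + 6 * a * z + 20 * b * z ^ 3 + 6 * z ^ 5 * r + z ^ 6 * r'"
  shows "y\<^sup>2 - (4 * x ^ 3 - 60 * a * x - 140 * b) =
    z\<^sup>2 * (- 36 * r - 4 * z * r' + (6 * a + 20 * b * z\<^sup>2 + 6 * z ^ 4 * r + z ^ 5 * r')\<^sup>2
      - 12 * (3 * a + 5 * b * z\<^sup>2 + z ^ 4 * r)\<^sup>2 - 4 * z ^ 4 * (3 * a + 5 * b * z\<^sup>2 + z ^ 4 * r) ^ 3
      + 60 * a * (3 * a + 5 * b * z\<^sup>2 + z ^ 4 * r))"
proof -
  \<comment> \<open>A separate letter \<open>u\<close> with u * z = 1 turns the Laurent polynomials
    into polynomials, for which ideal membership decides the identity.\<close>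
  define u where "u = 1 / z"
  have u: "u * z = 1" using assms(1) by (simp add: u_def)
  have x: "x = u\<^sup>2 + 3 * a * z\<^sup>2 + 5 * b * z ^ 4 + z ^ 6 * r"
    using assms(2) by (simp add: u_def power_divide)
  have y: "y = - 2 * u ^ 3 + 6 * a * z + 20 * b * z ^ 3 + 6 * z ^ 5 * r + z ^ 6 * r'"
    using assms(3) by (simp add: u_def power_divide)
  define P where "P = 3 * a + 5 * b * z\<^sup>2 + z ^ 4 * r"
  define Q where "Q = 6 * a + 20 * b * z\<^sup>2 + 6 * z ^ 4 * r + z ^ 5 * r'"
  have x: "x = u\<^sup>2 + z\<^sup>2 * P" unfolding x P_def by algebra
  have y: "y = - 2 * u ^ 3 + z * Q" unfolding y Q_def by algebra
  have PQ: "- 4 * Q - 12 * P = - 60 * a - 140 * b * z\<^sup>2 - 36 * z ^ 4 * r - 4 * z ^ 5 * r'"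
    unfolding P_def Q_def by algebra
  have "y\<^sup>2 - (4 * x ^ 3 - 60 * a * x - 140 * b) =
      u\<^sup>2 * (- 4 * Q - 12 * P + 60 * a) + z\<^sup>2 * Q\<^sup>2 - 12 * z\<^sup>2 * P\<^sup>2 - 4 * z ^ 6 * P ^ 3
        + 60 * a * z\<^sup>2 * P + 140 * b"
    using u unfolding x y by algebra
  also have "\<dots> = z\<^sup>2 * (- 36 * r - 4 * z * r' + Q\<^sup>2 - 12 * P\<^sup>2 - 4 * z ^ 4 * P ^ 3 + 60 * a * P)"
    using u unfolding PQ by algebra
  finally show ?thesis by (simp only: P_def Q_def)
qed

theorem wp_ode:
  assumes "z \<notin> L"
  shows "(wp' z)\<^sup>2 = 4 * wp z ^ 3 - 60 * G 4 * wp z - 140 * G 6"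
proof -
  obtain d where d: "d > 0" "\<forall>w\<in>L. cmod w < 2 * d \<longrightarrow> w = 0"
    by (rule small_radius) blast
  note r = wp_rem_holomorphic[OF d]
  have r': "deriv wp_rem holomorphic_on ball 0 d" by (rule holomorphic_deriv[OF r open_ball])
  have "(wp' z)\<^sup>2 - (4 * wp z ^ 3 - 60 * G 4 * wp z - 140 * G 6) = 0"
  proof (rule elliptic_vanishing[of "\<lambda>z. (wp' z)\<^sup>2 - (4 * wp z ^ 3 - 60 * G 4 * wp z - 140 * G 6)" _ d z])
    show "(\<lambda>z. (wp' z)\<^sup>2 - (4 * wp z ^ 3 - 60 * G 4 * wp z - 140 * G 6)) holomorphic_on - L"
      by (intro holomorphic_intros wp_holomorphic wp'_holomorphic)
    show "(wp' (z + v))\<^sup>2 - (4 * wp (z + v) ^ 3 - 60 * G 4 * wp (z + v) - 140 * G 6)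
        = (wp' z)\<^sup>2 - (4 * wp z ^ 3 - 60 * G 4 * wp z - 140 * G 6)" if "v \<in> L" "z \<notin> L" for v z
      using wp_periodic[OF that] wp'_periodic[OF that(1)] by simp
    let ?F = "\<lambda>z. z\<^sup>2 * (- 36 * wp_rem z - 4 * z * deriv wp_rem z
      + (6 * G 4 + 20 * G 6 * z\<^sup>2 + 6 * z ^ 4 * wp_rem z + z ^ 5 * deriv wp_rem z)\<^sup>2
      - 12 * (3 * G 4 + 5 * G 6 * z\<^sup>2 + z ^ 4 * wp_rem z)\<^sup>2 - 4 * z ^ 4 * (3 * G 4 + 5 * G 6 * z\<^sup>2 + z ^ 4 * wp_rem z) ^ 3
      + 60 * G 4 * (3 * G 4 + 5 * G 6 * z\<^sup>2 + z ^ 4 * wp_rem z))"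
    show "?F holomorphic_on ball 0 d"
      by (intro holomorphic_intros r r')
    show "?F 0 = 0" by simp
    fix z assume z: "z \<in> ball 0 d" "z \<notin> L"
    then have nz: "z \<noteq> 0" using zero_mem by metis
    show "(wp' z)\<^sup>2 - (4 * wp z ^ 3 - 60 * G 4 * wp z - 140 * G 6) = ?F z"
      by (rule ode_algebra[OF nz wp_laurent[OF d z(1)] wp'_laurent[OF d z(1) nz]])
  qed (use d assms in auto)
  then show ?thesis by simp
qed

text \<open>Differentiating the differential equation and cancelling \<open>wp'\<close> proves this
  off the half-periods; continuity covers the points where \<open>wp'\<close> vanishes.\<close>

lemma wp'_deriv:
  assumes z: "z \<notin> L"
  shows "(wp' has_field_derivative 6 * (wp z)\<^sup>2 - 30 * G 4) (at z)"
proof -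
  have D: "(wp' has_field_derivative deriv wp' z) (at z)" if "z \<notin> L" for z
    by (rule holomorphic_derivI[OF wp'_holomorphic open_minus_L]) (use that in auto)
  have "deriv wp' z = 6 * (wp z)\<^sup>2 - 30 * G 4"
  proof (rule eq_on_open_if_eq_off_countable[of "- L" "deriv wp'" "\<lambda>z. 6 * (wp z)\<^sup>2 - 30 * G 4" "{z. 2 * z \<in> L}"])
    show "continuous_on (- L) (deriv wp')"
      by (intro holomorphic_on_imp_continuous_on holomorphic_deriv wp'_holomorphic open_minus_L)
    show "continuous_on (- L) (\<lambda>z. 6 * (wp z)\<^sup>2 - 30 * G 4)"
      by (intro continuous_intros holomorphic_on_imp_continuous_on wp_holomorphic)
    have "{z. 2 * z \<in> L} \<subseteq> (\<lambda>w. w / 2) ` L" by (auto intro!: image_eqI[where x = "2 * _"])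
    then show "countable {z. 2 * z \<in> L}" using countable_subset countable_image countable_L by metis
    fix z assume z: "z \<in> - L" "z \<notin> {z. 2 * z \<in> L}"
    then have nz: "wp' z \<noteq> 0" using wp'_eq_0_iff by simp
    have zL: "z \<notin> L" using z by simp
    have "((\<lambda>z. (wp' z)\<^sup>2) has_field_derivative 2 * wp' z * deriv wp' z) (at z)"
      using DERIV_power[OF D[OF zL], of 2] by (simp add: mult_ac)
    moreover have "((\<lambda>z. 4 * wp z ^ 3 - 60 * G 4 * wp z - 140 * G 6) has_field_derivative
        12 * (wp z)\<^sup>2 * wp' z - 60 * G 4 * wp' z) (at z)"
      by (auto intro!: derivative_eq_intros wp_deriv[OF zL])
    then have "((\<lambda>z. (wp' z)\<^sup>2) has_field_derivative 12 * (wp z)\<^sup>2 * wp' z - 60 * G 4 * wp' z) (at z)"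
      by (rule has_field_derivative_transform_within_open[of _ _ _ "- L"]) (use zL wp_ode in auto)
    ultimately have "2 * wp' z * deriv wp' z = 12 * (wp z)\<^sup>2 * wp' z - 60 * G 4 * wp' z"
      by (rule DERIV_unique)
    then have "2 * wp' z * (deriv wp' z - (6 * (wp z)\<^sup>2 - 30 * G 4)) = 0"
      by (simp add: algebra_simps)
    then show "deriv wp' z = 6 * (wp z)\<^sup>2 - 30 * G 4" using nz by simp
  qed (use z in auto)
  then show ?thesis using D[OF z] by simp
qed

text \<open>The discriminant is 16 times the squared product of the root differences. Since the
  roots sum to 0, the two differences involving \<open>e1\<close> combine into an expression in
  \<open>p\<close> and e2 - e3. In this form the discriminant visibly tends to 0 with e2 - e3 when
  \<open>p\<close> stays bounded.\<close>

lemma discriminant_algebra: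
  fixes e1 e2 e3 p q :: complex
  assumes "4 * e1 ^ 3 - p * e1 - q = 0" "4 * e2 ^ 3 - p * e2 - q = 0" "4 * e3 ^ 3 - p * e3 - q = 0"
    and "e1 \<noteq> e2" "e1 \<noteq> e3" "e2 \<noteq> e3"
  shows "p ^ 3 - 27 * q\<^sup>2 = (e2 - e3)\<^sup>2 * (3 * p - 4 * (e2 - e3)\<^sup>2)\<^sup>2" "p ^ 3 - 27 * q\<^sup>2 \<noteq> 0"
proof -
  have "(e1 - e2) * (4 * (e1\<^sup>2 + e1 * e2 + e2\<^sup>2) - p) = 0" using assms(1,2) by algebra
  then have 1: "p = 4 * (e1\<^sup>2 + e1 * e2 + e2\<^sup>2)" using assms(4) by simp
  have "(e1 - e3) * (4 * (e1\<^sup>2 + e1 * e3 + e3\<^sup>2) - p) = 0" using assms(1,3) by algebra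
  then have "p = 4 * (e1\<^sup>2 + e1 * e3 + e3\<^sup>2)" using assms(5) by simp
  then have "(e2 - e3) * (e1 + e2 + e3) = 0" using 1 by algebra
  then have "e1 + e2 + e3 = 0" using assms(6) by simp
  then have e1: "e1 = - e2 - e3" by algebra
  have p: "p = 4 * (e2\<^sup>2 + e2 * e3 + e3\<^sup>2)" unfolding 1 e1 by algebra
  have q: "q = - 4 * e2 * e3 * (e2 + e3)" using assms(2) unfolding p by algebra
  have d: "p ^ 3 - 27 * q\<^sup>2 = 16 * ((e1 - e2) * (e1 - e3) * (e2 - e3))\<^sup>2"
    unfolding p q e1 by algebra
  show "p ^ 3 - 27 * q\<^sup>2 \<noteq> 0" unfolding d using assms(4-6) by simp
  show "p ^ 3 - 27 * q\<^sup>2 = (e2 - e3)\<^sup>2 * (3 * p - 4 * (e2 - e3)\<^sup>2)\<^sup>2"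
    unfolding p q by algebra
qed

text \<open>At the half-periods a, b and a + b the derivative \<open>wp'\<close> vanishes, so the
  differential equation makes their \<open>wp\<close> values roots of the cubic;
  \<open>wp_eq_iff\<close> separates them.\<close>

lemma discriminant:
  assumes ab: "a \<notin> L" "b \<notin> L" "a - b \<notin> L" "a + b \<notin> L" "2 * a \<in> L" "2 * b \<in> L"
  shows "(60 * G 4) ^ 3 - 27 * (140 * G 6)\<^sup>2
      = (wp b - wp (a + b))\<^sup>2 * (3 * (60 * G 4) - 4 * (wp b - wp (a + b))\<^sup>2)\<^sup>2"
    "(60 * G 4) ^ 3 - 27 * (140 * G 6)\<^sup>2 \<noteq> 0"
proof -
  have root: "4 * wp x ^ 3 - 60 * G 4 * wp x - 140 * G 6 = 0" if "x \<notin> L" "2 * x \<in> L" for x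
    using wp_ode[OF that(1)] wp'_eq_0_iff[OF that(1)] that(2) by simp
  have "2 * (a + b) \<in> L" using add_mem[OF ab(5,6)] by (simp add: distrib_left)
  then have roots: "4 * wp a ^ 3 - 60 * G 4 * wp a - 140 * G 6 = 0"
      "4 * wp b ^ 3 - 60 * G 4 * wp b - 140 * G 6 = 0"
      "4 * wp (a + b) ^ 3 - 60 * G 4 * wp (a + b) - 140 * G 6 = 0"
    using ab root by blast+
  have "a + (a + b) \<notin> L" "b + (a + b) \<notin> L"
    using add_mem_iff(2)[OF ab(5), of b] add_mem_iff(2)[OF ab(6), of a] ab
    by (simp_all add: algebra_simps)
  moreover have "a - (a + b) \<notin> L" "b - (a + b) \<notin> L" using ab by simp_all
  ultimately have ne: "wp a \<noteq> wp b" "wp a \<noteq> wp (a + b)" "wp b \<noteq> wp (a + b)"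
    using ab by (simp_all add: wp_eq_iff)
  show "(60 * G 4) ^ 3 - 27 * (140 * G 6)\<^sup>2
      = (wp b - wp (a + b))\<^sup>2 * (3 * (60 * G 4) - 4 * (wp b - wp (a + b))\<^sup>2)\<^sup>2"
    "(60 * G 4) ^ 3 - 27 * (140 * G 6)\<^sup>2 \<noteq> 0"
    by (rule discriminant_algebra[OF roots ne])+
qed

end

section \<open>Uniqueness of the lattice with given invariants\<close>

lemma pow_deriv:
  fixes w :: complex
  shows "((\<lambda>w. w ^ n) has_field_derivative of_nat n * w ^ (n - 1)) (at w)"
  using DERIV_power[OF DERIV_ident, of n w] by simp

lemma ball_imp_radius_pos:
  assumes "x \<in> ball 0 r"
  shows "(r::real) > 0"
  using assms by (auto intro: le_less_trans[OF zero_le_dist])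

text \<open>The exponent may be 0; this covers a function that does not vanish at the origin and
  spares the caller a distinction.\<close>

lemma factor_zero:
  fixes f :: "complex \<Rightarrow> complex"
  assumes f: "f holomorphic_on ball 0 r" and x: "x \<in> ball 0 r" "f x \<noteq> 0"
  obtains n g s where "0 < s" "s \<le> r" "g holomorphic_on ball 0 s" "g 0 \<noteq> 0"
    "\<And>w. w \<in> ball 0 s \<Longrightarrow> f w = w ^ n * g w"
proof (cases "f 0 = 0")
  case False
  have "r > 0" by (rule ball_imp_radius_pos[OF x(1)])
  then show ?thesis using False f by (intro that[of r f 0]) auto
next
  case True
  have r: "r > 0" by (rule ball_imp_radius_pos[OF x(1)])
  have nc: "\<not> f constant_on ball 0 r"
    using x True r centre_in_ball unfolding constant_on_def by metis
  show ?thesis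
  proof (rule holomorphic_factor_zero_nonconstant[OF f open_ball connected_ball _ True nc])
    show "0 \<in> ball (0::complex) r" using r by simp
    fix g s and n :: nat
    assume "0 < n" "0 < s" "ball 0 s \<subseteq> ball (0::complex) r" "g holomorphic_on ball 0 s"
      "\<And>w. w \<in> ball 0 s \<Longrightarrow> f w = (w - 0) ^ n * g w" "\<And>w. w \<in> ball 0 s \<Longrightarrow> g w \<noteq> 0"
    then show ?thesis
      using r by (intro that[of s g n]) (auto simp: ball_subset_ball_iff)
  qed
qed

text \<open>Both functions solve \<open>y'' = 6y\<^sup>2 - g\<^sub>2/2\<close>, so a zero of order \<open>N\<close> of their difference at the origin
  satisfies \<open>N (N - 1) = 12\<close>. But the Laurent expansions agree up to order \<open>5\<close>.\<close>

lemma wp_eq_near_0: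
  assumes "lattice L" "lattice M"
    and G: "lattice.G L 4 = lattice.G M 4" "lattice.G L 6 = lattice.G M 6"
  obtains d where "d > 0" "\<And>z. z \<in> ball 0 d \<Longrightarrow> lattice.wp L z = lattice.wp M z"
proof -
  interpret A: lattice L by fact
  interpret B: lattice M by fact
  obtain dA where dA: "dA > 0" "\<forall>w\<in>L. cmod w < 2 * dA \<longrightarrow> w = 0"
    by (rule A.small_radius) blast
  obtain dB where dB: "dB > 0" "\<forall>w\<in>M. cmod w < 2 * dB \<longrightarrow> w = 0"
    by (rule B.small_radius) blast
  define d where "d = min dA dB"
  have d: "d > 0" "\<forall>w\<in>L. cmod w < 2 * d \<longrightarrow> w = 0" "\<forall>w\<in>M. cmod w < 2 * d \<longrightarrow> w = 0"
    using dA dB by (auto simp: d_def)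
  note rA = A.wp_rem_holomorphic[OF d(1,2)] and rB = B.wp_rem_holomorphic[OF d(1,3)]
  note lA = A.wp_laurent[OF d(1,2)] and lB = B.wp_laurent[OF d(1,3)]
  have notin: "z \<notin> L" "z \<notin> M" if "z \<in> ball 0 d" "z \<noteq> 0" for z
    using d that by auto
  define \<rho> where "\<rho> z = A.wp_rem z - B.wp_rem z" for z
  have hol: "\<rho> holomorphic_on ball 0 d"
    unfolding \<rho>_def by (intro holomorphic_intros rA rB)
  have diff: "A.wp z - B.wp z = z ^ 6 * \<rho> z" if "z \<in> ball 0 d" for z
    using lA[OF that] lB[OF that] G by (simp add: \<rho>_def algebra_simps)
  have "\<rho> z = 0" if z: "z \<in> ball 0 d" for z
  proof (rule ccontr)
    assume "\<rho> z \<noteq> 0"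
    then obtain n g s where g: "0 < s" "s \<le> d" "g holomorphic_on ball 0 s" "g 0 \<noteq> 0"
      "\<And>w. w \<in> ball 0 s \<Longrightarrow> \<rho> w = w ^ n * g w"
      by (rule factor_zero[OF hol z]) blast
    \<comment> \<open>The difference of the two functions has order N = n + 6 at 0; writing N = m +
      2 keeps the exponents natural after two differentiations.\<close>
    define m where "m = n + 4"
    define g1 where "g1 = deriv g"
    define g2 where "g2 = deriv g1"
    have h1: "g1 holomorphic_on ball 0 s" unfolding g1_def by (rule holomorphic_deriv[OF g(3) open_ball])
    have h2: "g2 holomorphic_on ball 0 s" unfolding g2_def by (rule holomorphic_deriv[OF h1 open_ball])
    have D0: "(g has_field_derivative g1 w) (at w)" if "w \<in> ball 0 s" for w
      unfolding g1_def by (rule holomorphic_derivI[OF g(3) open_ball that])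
    have D1: "(g1 has_field_derivative g2 w) (at w)" if "w \<in> ball 0 s" for w
      unfolding g2_def by (rule holomorphic_derivI[OF h1 open_ball that])
    have e0: "A.wp w - B.wp w = w ^ (m + 2) * g w" if "w \<in> ball 0 s" for w
    proof -
      have "w ^ 6 * (w ^ n * g w) = w ^ (m + 2) * g w" by (simp add: m_def power_add algebra_simps flip: power_add)
      then show ?thesis using diff[of w] g(2) g(5)[OF that] that by auto
    qed
    have e1: "A.wp' w - B.wp' w = of_nat (m + 2) * w ^ (m + 1) * g w + w ^ (m + 2) * g1 w"
      if w: "w \<in> ball 0 s - {0}" for w
    proof -
      have n: "w \<notin> L" "w \<notin> M" using notin[of w] w g(2) by auto
      have "((\<lambda>w. w ^ (m + 2) * g w) has_field_derivative
          of_nat (m + 2) * w ^ (m + 1) * g w + w ^ (m + 2) * g1 w) (at w)"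
        using DERIV_mult[OF pow_deriv[of "m + 2" w] D0[of w]] w by (simp add: mult_ac)
      then have "((\<lambda>w. A.wp w - B.wp w) has_field_derivative
          of_nat (m + 2) * w ^ (m + 1) * g w + w ^ (m + 2) * g1 w) (at w)"
        by (rule has_field_derivative_transform_within_open[of _ _ _ "ball 0 s"]) (use w e0 in auto)
      from DERIV_unique[OF DERIV_diff[OF A.wp_deriv[OF n(1)] B.wp_deriv[OF n(2)]] this] show ?thesis .
    qed
    have e2: "6 * ((A.wp w)\<^sup>2 - (B.wp w)\<^sup>2) = of_nat ((m + 2) * (m + 1)) * w ^ m * g w
        + 2 * of_nat (m + 2) * w ^ (m + 1) * g1 w + w ^ (m + 2) * g2 w"
      if w: "w \<in> ball 0 s - {0}" for w
    proof -
      have n: "w \<notin> L" "w \<notin> M" using notin[of w] w g(2) by auto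
      have w': "w \<in> ball 0 s" using w by simp
      have "((\<lambda>w. of_nat (m + 2) * w ^ (m + 1) * g w + w ^ (m + 2) * g1 w) has_field_derivative
          (of_nat (m + 2) * (of_nat (m + 1) * w ^ m) * g w + g1 w * (of_nat (m + 2) * w ^ (m + 1)))
           + (of_nat (m + 2) * w ^ (m + 1) * g1 w + g2 w * w ^ (m + 2))) (at w)"
        using DERIV_add[OF DERIV_mult[OF DERIV_cmult[OF pow_deriv[of "m + 1" w], of "of_nat (m + 2)"] D0[OF w']]
            DERIV_mult[OF pow_deriv[of "m + 2" w] D1[OF w']]] by simp
      then have "((\<lambda>w. A.wp' w - B.wp' w) has_field_derivative
          (of_nat (m + 2) * (of_nat (m + 1) * w ^ m) * g w + g1 w * (of_nat (m + 2) * w ^ (m + 1)))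
           + (of_nat (m + 2) * w ^ (m + 1) * g1 w + g2 w * w ^ (m + 2))) (at w)"
        by (rule has_field_derivative_transform_within_open[of _ _ _ "ball 0 s - {0}"]) (use w e1 in auto)
      from DERIV_unique[OF DERIV_diff[OF A.wp'_deriv[OF n(1)] B.wp'_deriv[OF n(2)]] this]
      have "6 * (A.wp w)\<^sup>2 - 30 * A.G 4 - (6 * (B.wp w)\<^sup>2 - 30 * B.G 4) =
         (of_nat (m + 2) * (of_nat (m + 1) * w ^ m) * g w + g1 w * (of_nat (m + 2) * w ^ (m + 1)))
           + (of_nat (m + 2) * w ^ (m + 1) * g1 w + g2 w * w ^ (m + 2))" .
      then show ?thesis using G(1) unfolding of_nat_mult by (simp only: algebra_simps) (simp add: algebra_simps)
    qed
    \<comment> \<open>The sum of the two functions times w^2. Its value 2 at the origin produces the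
      12 = 6 * 2 of the indicial equation.\<close>
    define S where "S w = 2 + w ^ 4 * (6 * A.G 4 + 10 * A.G 6 * w\<^sup>2 + w ^ 4 * (A.wp_rem w + B.wp_rem w))" for w
    have S: "w\<^sup>2 * (A.wp w + B.wp w) = S w" if w: "w \<in> ball 0 s - {0}" for w
    proof -
      have "A.wp w + B.wp w = 2 * (1 / w\<^sup>2) + 6 * A.G 4 * w\<^sup>2 + 10 * A.G 6 * w ^ 4 + w ^ 6 * (A.wp_rem w + B.wp_rem w)"
        using lA[of w] lB[of w] w g(2) G by (simp add: algebra_simps)
      moreover have "w\<^sup>2 * (1 / w\<^sup>2) = 1" using w by simp
      ultimately show ?thesis unfolding S_def by algebra
    qed
    have eq: "of_nat ((m + 2) * (m + 1)) * g w + 2 * of_nat (m + 2) * w * g1 w + w\<^sup>2 * g2 w = 6 * S w * g w"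
      if w: "w \<in> ball 0 s - {0}" for w
    proof -
      have "6 * ((A.wp w)\<^sup>2 - (B.wp w)\<^sup>2) * w\<^sup>2 = 6 * (w\<^sup>2 * (A.wp w + B.wp w)) * (A.wp w - B.wp w)"
        by algebra
      also have "\<dots> = 6 * S w * (w ^ m * w\<^sup>2 * g w)"
        using S[OF w] e0[of w] w by (simp only: power_add Diff_iff mult.assoc)
      finally have e: "6 * ((A.wp w)\<^sup>2 - (B.wp w)\<^sup>2) * w\<^sup>2 = 6 * S w * (w ^ m * w\<^sup>2 * g w)" .
      have *: "w ^ m * w\<^sup>2 * (n1 * g w + 2 * n2 * w * g1 w + w\<^sup>2 * g2 w)
          = (n1 * w ^ m * g w + 2 * n2 * w ^ (m + 1) * g1 w + w ^ (m + 2) * g2 w) * w\<^sup>2" for n1 n2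
        unfolding power_add by algebra
      have "w ^ m * w\<^sup>2 * (of_nat ((m + 2) * (m + 1)) * g w + 2 * of_nat (m + 2) * w * g1 w + w\<^sup>2 * g2 w)
          = w ^ m * w\<^sup>2 * (6 * S w * g w)"
        unfolding * e2[OF w, symmetric] e by (simp only: mult_ac)
      then show ?thesis using w by simp
    qed
    have "of_nat ((m + 2) * (m + 1)) * g 0 + 2 * of_nat (m + 2) * 0 * g1 0 + 0\<^sup>2 * g2 0 = 6 * S 0 * g 0"
    proof (rule eq_on_open_if_eq_off_countable[of "ball 0 s"
          "\<lambda>w. of_nat ((m + 2) * (m + 1)) * g w + 2 * of_nat (m + 2) * w * g1 w + w\<^sup>2 * g2 w"
          "\<lambda>w. 6 * S w * g w" "{0}" 0])
      have sub: "ball 0 s \<subseteq> ball (0::complex) d" using g(2) by auto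
      note c = holomorphic_on_imp_continuous_on[OF g(3)] holomorphic_on_imp_continuous_on[OF h1]
        holomorphic_on_imp_continuous_on[OF h2]
        holomorphic_on_imp_continuous_on[OF holomorphic_on_subset[OF rA sub]]
        holomorphic_on_imp_continuous_on[OF holomorphic_on_subset[OF rB sub]]
      show "continuous_on (ball 0 s) (\<lambda>w. of_nat ((m + 2) * (m + 1)) * g w + 2 * of_nat (m + 2) * w * g1 w + w\<^sup>2 * g2 w)"
        by (intro continuous_intros c)
      show "continuous_on (ball 0 s) (\<lambda>w. 6 * S w * g w)"
        unfolding S_def
        by (intro continuous_intros c)
    qed (use eq g(1) in auto)
    then have "(of_nat ((m + 2) * (m + 1)) :: complex) = of_nat 12"
      using g(4) by (simp add: S_def)
    then have "(m + 2) * (m + 1) = 12" by (simp only: of_nat_eq_iff)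
    moreover have "(m + 2) * (m + 1) \<ge> 6 * 5" by (intro mult_mono) (auto simp: m_def)
    ultimately show False by simp
  qed
  then show ?thesis using diff d(1) by (intro that[of d]) auto
qed

lemma lattice_subset:
  assumes "lattice L" "lattice M"
    and G: "lattice.G L 4 = lattice.G M 4" "lattice.G L 6 = lattice.G M 6"
  shows "L \<subseteq> M"
proof (rule ccontr)
  interpret A: lattice L by fact
  interpret B: lattice M by fact
  assume "\<not> L \<subseteq> M"
  then obtain v where v: "v \<in> L" "v \<notin> M" by blast
  obtain d where d: "d > 0" "\<And>z. z \<in> ball 0 d \<Longrightarrow> A.wp z = B.wp z"
    by (rule wp_eq_near_0[OF assms]) blast
  let ?S = "- (L \<union> M)"
  \<comment> \<open>With both lattices removed the plane is still connected, so agreement near 0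
    propagates everywhere else.\<close>
  have conn: "connected ?S"
  proof -
    have "connected (UNIV - (L \<union> M))"
      by (rule connected_open_diff_countable) auto
    then show ?thesis by (simp add: Compl_eq_Diff_UNIV)
  qed
  have op: "open ?S" by (intro open_Compl closed_Un A.closed_L B.closed_L)
  obtain a where a: "a \<in> ball 0 d" "a \<notin> L \<union> M"
  proof -
    have "countable (L \<union> M)" by simp
    then have "\<not> ball 0 d \<subseteq> L \<union> M"
      using uncountable_ball[OF d(1)] countable_subset by blast
    then show ?thesis using that by blast
  qed
  have eq: "A.wp z - B.wp z = 0" if z: "z \<in> ?S" for z
  proof (rule analytic_continuation_open[of "ball 0 d \<inter> ?S" ?S "\<lambda>z. A.wp z - B.wp z" "\<lambda>_. 0"])
    show "(\<lambda>z. A.wp z - B.wp z) holomorphic_on ?S"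
      by (intro holomorphic_intros holomorphic_on_subset[OF A.wp_holomorphic] holomorphic_on_subset[OF B.wp_holomorphic]) auto
  qed (use op conn a z d in auto)
  obtain e where e: "e > 0" "\<forall>w\<in>L. cmod w < 2 * e \<longrightarrow> w = 0"
    by (rule A.small_radius) blast
  \<comment> \<open>Multiplied by z^2, the equality of \<open>A.wp z\<close> and
    \<open>B.wp (z + v)\<close> reads 1 + c z = 0, with \<open>c\<close> continuous and zero at the
    origin.\<close>
  define c where "c z = z\<^sup>2 * (3 * A.G 4 * z\<^sup>2 + 5 * A.G 6 * z ^ 4 + z ^ 6 * A.wp_rem z) - z\<^sup>2 * B.wp (z + v)" for z
  text \<open>Near the putative point of \<open>L - M\<close> one function has a double pole and the other does not.\<close>
  obtain r where r: "r > 0" "r \<le> e" "ball v r \<subseteq> - M"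
  proof -
    obtain r where "r > 0" "ball v r \<subseteq> - M"
      using B.open_minus_L v(2) open_contains_ball by blast
    then show ?thesis using e(1) by (intro that[of "min r e"]) (auto simp: subset_iff)
  qed
  have "1 + c 0 = 0"
  proof (rule eq_on_open_if_eq_off_countable[of "ball 0 r" "\<lambda>z. 1 + c z" "\<lambda>_. 0" "{0}" 0])
    have sub: "ball 0 r \<subseteq> ball (0::complex) e" using r by auto
    have im: "(\<lambda>z. z + v) ` ball 0 r \<subseteq> - M"
    proof clarify
      fix z :: complex assume "z \<in> ball 0 r" "z + v \<in> M"
      then have "z + v \<in> ball v r" by (simp add: dist_norm)
      then show False using r(3) \<open>z + v \<in> M\<close> by blast
    qed
    have cB: "continuous_on (ball 0 r) (\<lambda>z. B.wp (z + v))"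
      by (rule continuous_on_compose2[OF holomorphic_on_imp_continuous_on[OF B.wp_holomorphic] _ im])
         (intro continuous_intros)
    show "continuous_on (ball 0 r) (\<lambda>z. 1 + c z)"
      unfolding c_def
      by (intro continuous_intros cB
          holomorphic_on_imp_continuous_on[OF holomorphic_on_subset[OF A.wp_rem_holomorphic[OF e] sub]])
    fix z :: complex assume z: "z \<in> ball 0 r" "z \<notin> {0}"
    have zL: "z \<notin> L" using e z r(2) by auto
    have "z + v \<in> ball v r" using z by (simp add: dist_norm)
    then have "z + v \<notin> M" using r(3) by blast
    moreover have "z + v \<notin> L" using zL v(1) A.add_mem_iff by blast
    ultimately have "B.wp (z + v) = A.wp (z + v)" using eq[of "z + v"] by simp
    also have "\<dots> = A.wp z" by (rule A.wp_periodic[OF v(1) zL])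
    also have "\<dots> = 1 / z\<^sup>2 + 3 * A.G 4 * z\<^sup>2 + 5 * A.G 6 * z ^ 4 + z ^ 6 * A.wp_rem z"
      by (rule A.wp_laurent[OF e]) (use z r in auto)
    finally have "z\<^sup>2 * B.wp (z + v) = z\<^sup>2 * (1 / z\<^sup>2) + z\<^sup>2 * (3 * A.G 4 * z\<^sup>2 + 5 * A.G 6 * z ^ 4 + z ^ 6 * A.wp_rem z)"
      by (simp only: algebra_simps)
    moreover have "z\<^sup>2 * (1 / z\<^sup>2) = 1" using z by simp
    ultimately show "1 + c z = 0" unfolding c_def by simp
  qed (use r in auto)
  then show False by (simp add: c_def)
qed

theorem lattice_unique:
  assumes "is_lattice L" "is_lattice M"
    "60 * eisenstein_sum 4 L = 60 * eisenstein_sum 4 M" "140 * eisenstein_sum 6 L = 140 * eisenstein_sum 6 M"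
  shows "L = M"
proof -
  interpret A: lattice L by unfold_locales fact
  interpret B: lattice M by unfold_locales fact
  have "A.G 4 = B.G 4" "A.G 6 = B.G 6" using assms by (simp_all add: A.G_def B.G_def)
  then show ?thesis
    using lattice_subset[OF A.lattice_axioms B.lattice_axioms] lattice_subset[OF B.lattice_axioms A.lattice_axioms]
    by auto
qed

section \<open>Homogeneity of lattices and Eisenstein sums\<close>

lemma is_lattice_scale:
  assumes "is_lattice L" "c \<noteq> 0"
  shows "is_lattice ((*) c ` L)"
proof -
  obtain a b where ab: "Im (b / a) \<noteq> 0" "L = {of_int m * a + of_int n * b | m n. True}"
    using assms by (auto simp: is_lattice_def)
  have "(*) c ` L = {of_int m * (c * a) + of_int n * (c * b) | m n. True}"
  proof (intro equalityI subsetI)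
    fix x assume "x \<in> (*) c ` L"
    then obtain m n where "x = c * (of_int m * a + of_int n * b)" using ab by auto
    then have "x = of_int m * (c * a) + of_int n * (c * b)" by (simp add: algebra_simps)
    then show "x \<in> {of_int m * (c * a) + of_int n * (c * b) | m n. True}" by blast
  next
    fix x assume "x \<in> {of_int m * (c * a) + of_int n * (c * b) | m n. True}"
    then obtain m n where "x = of_int m * (c * a) + of_int n * (c * b)" by blast
    then have "x = c * (of_int m * a + of_int n * b)" by (simp add: algebra_simps)
    then show "x \<in> (*) c ` L" using ab by blast
  qed
  moreover have "Im (c * b / (c * a)) \<noteq> 0" using ab assms by simp
  ultimately show ?thesis unfolding is_lattice_def by blast
qed

lemma eisenstein_sum_scale:
  assumes "c \<noteq> 0"
  shows "eisenstein_sum k ((*) c ` L) = eisenstein_sum k L / c ^ k"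
proof -
  have inj: "inj_on ((*) c) A" for A using assms by (auto intro: inj_onI)
  have "(*) c ` L - {0} = (*) c ` (L - {0})" using assms by auto
  then have "eisenstein_sum k ((*) c ` L) = (\<Sum>\<^sub>\<infinity>w\<in>L - {0}. 1 / (c * w) ^ k)"
    by (simp add: eisenstein_sum_def infsum_reindex[OF inj] o_def)
  also have "\<dots> = (\<Sum>\<^sub>\<infinity>w\<in>L - {0}. 1 / w ^ k * (1 / c ^ k))"
    by (simp add: power_mult_distrib mult.commute)
  also have "\<dots> = (\<Sum>\<^sub>\<infinity>w\<in>L - {0}. 1 / w ^ k) * (1 / c ^ k)"
    by (rule infsum_cmult_left')
  finally show ?thesis by (simp add: eisenstein_sum_def)
qed

section \<open>Existence of the lattice with given invariants\<close>

definition std_lattice :: "complex \<Rightarrow> complex set" where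
  "std_lattice \<tau> = (\<lambda>(m, n). of_int m + of_int n * \<tau>) ` UNIV"

lemma is_lattice_std: "Im \<tau> \<noteq> 0 \<Longrightarrow> is_lattice (std_lattice \<tau>)"
  unfolding is_lattice_def std_lattice_def by (rule exI[of _ 1], rule exI[of _ \<tau>]) auto

lemma inj_std_lattice: "Im \<tau> \<noteq> 0 \<Longrightarrow> inj (\<lambda>(m, n). of_int m + of_int n * \<tau>)"
  by (rule injI) (auto simp: complex_eq_iff)

lemma std_lattice_minus_0:
  "Im \<tau> \<noteq> 0 \<Longrightarrow> std_lattice \<tau> - {0} = (\<lambda>(m, n). of_int m + of_int n * \<tau>) ` (- {(0, 0)})"
  unfolding std_lattice_def by (auto simp: complex_eq_iff)

lemma eisenstein_std:
  assumes "Im \<tau> \<noteq> 0"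
  shows "eisenstein_sum k (std_lattice \<tau>) = (\<Sum>\<^sub>\<infinity>p\<in>- {(0, 0)}. 1 / (of_int (fst p) + of_int (snd p) * \<tau>) ^ k)"
  unfolding eisenstein_sum_def std_lattice_minus_0[OF assms]
  by (subst infsum_reindex[OF inj_on_subset[OF inj_std_lattice[OF assms]]])
     (auto simp: o_def case_prod_unfold)

text \<open>Real rather than integral coordinates make the bounds applicable to lattice points
  shifted by half-periods.\<close>

lemma std_coordinates:
  assumes "Im \<tau> > 0"
  shows "\<bar>b\<bar> * Im \<tau> \<le> cmod (of_real a + of_real b * \<tau>)"
    "\<bar>a\<bar> \<le> (1 + cmod \<tau> / Im \<tau>) * cmod (of_real a + of_real b * \<tau>)"
proof -
  let ?X = "cmod (of_real a + of_real b * \<tau>)"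
  show 1: "\<bar>b\<bar> * Im \<tau> \<le> ?X"
    using abs_Im_le_cmod[of "of_real a + of_real b * \<tau>"] assms by (simp add: abs_mult)
  have "\<bar>a\<bar> = cmod (of_real a + of_real b * \<tau> - of_real b * \<tau>)" by simp
  also have "\<dots> \<le> ?X + cmod (of_real b * \<tau>)" by (rule norm_triangle_ineq4)
  also have "cmod (of_real b * \<tau>) = \<bar>b\<bar> * Im \<tau> * (cmod \<tau> / Im \<tau>)" using assms by (simp add: norm_mult)
  also have "\<dots> \<le> ?X * (cmod \<tau> / Im \<tau>)" using 1 assms by (intro mult_right_mono) auto
  finally show "\<bar>a\<bar> \<le> (1 + cmod \<tau> / Im \<tau>) * ?X" by (simp add: algebra_simps)
qed

lemma inverse_power_le_cube:
  fixes X c :: real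
  assumes "0 < c" "c \<le> X" "k \<ge> 3"
  shows "1 / X ^ k \<le> 1 / c ^ (k - 3) * (1 / X ^ 3)"
proof -
  have "c ^ (k - 3) * X ^ 3 \<le> X ^ (k - 3) * X ^ 3"
    using assms by (intro mult_right_mono power_mono) auto
  also have "\<dots> = X ^ k" using assms by (simp flip: power_add)
  finally have "1 / X ^ k \<le> 1 / (c ^ (k - 3) * X ^ 3)"
    using assms by (intro divide_left_mono) auto
  then show ?thesis by simp
qed

lemma eisenstein_holomorphic:
  assumes "k \<ge> 3"
  shows "(\<lambda>\<tau>. eisenstein_sum k (std_lattice \<tau>)) holomorphic_on {\<tau>. Im \<tau> > 0}"
proof -
  let ?f = "\<lambda>p \<tau>. 1 / (of_int (fst p) + of_int (snd p) * \<tau>) ^ k"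
  have "(\<lambda>\<tau>. \<Sum>\<^sub>\<infinity>p\<in>- {(0, 0)}. ?f p \<tau>) field_differentiable (at \<tau>\<^sub>0)" if t0: "Im \<tau>\<^sub>0 > 0" for \<tau>\<^sub>0
  proof -
    \<comment> \<open>On the disc of radius \<open>y\<close> about the centre all imaginary parts
      are at least \<open>y\<close>, and \<open>C\<close> bounds 1 + |\<tau>| / Im \<tau>; so a
      single \<open>c\<close> serves the whole disc.\<close>
    define y where "y = Im \<tau>\<^sub>0 / 2"
    define C where "C = 1 + (cmod \<tau>\<^sub>0 + y) / y"
    define c where "c = min y (1 / C)"
    have y: "y > 0" using t0 by (simp add: y_def)
    have C: "C > 0" using y unfolding C_def by (intro add_pos_nonneg divide_nonneg_nonneg) auto
    have c: "c > 0" using y C by (simp add: c_def)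
    have bnd: "c * \<bar>of_int m\<bar> \<le> cmod (of_int m + of_int n * \<tau>)"
      "c * \<bar>of_int n\<bar> \<le> cmod (of_int m + of_int n * \<tau>)" if t: "\<tau> \<in> ball \<tau>\<^sub>0 y" for m n \<tau>
    proof -
      let ?X = "cmod (of_int m + of_int n * \<tau>)"
      have d: "cmod (\<tau> - \<tau>\<^sub>0) < y" using t by (simp add: dist_norm norm_minus_commute)
      have "\<bar>Im \<tau> - Im \<tau>\<^sub>0\<bar> < y" using abs_Im_le_cmod[of "\<tau> - \<tau>\<^sub>0"] d by simp
      then have im: "y \<le> Im \<tau>" by (simp add: y_def abs_if split: if_splits)
      have "cmod \<tau> \<le> cmod \<tau>\<^sub>0 + y" using norm_triangle_sub[of \<tau> \<tau>\<^sub>0] d by linarith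
      then have "cmod \<tau> / Im \<tau> \<le> (cmod \<tau>\<^sub>0 + y) / y"
        using im y by (intro frac_le) auto
      then have C': "1 + cmod \<tau> / Im \<tau> \<le> C" by (simp add: C_def)
      have imp: "Im \<tau> > 0" using im y by linarith
      have "c * \<bar>of_int n\<bar> \<le> \<bar>of_int n\<bar> * Im \<tau>"
        unfolding mult.commute[of c] using im by (intro mult_left_mono) (auto simp: c_def)
      then show "c * \<bar>of_int n\<bar> \<le> ?X"
        using std_coordinates(1)[OF imp, of "of_int n" "of_int m"] by simp
      have "\<bar>of_int m\<bar> \<le> C * ?X"
        using std_coordinates(2)[OF imp, of "of_int m" "of_int n"] mult_right_mono[OF C', of ?X] by simp
      then have "\<bar>of_int m\<bar> / C \<le> ?X" using C by (simp add: field_simps)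
      moreover have "c * \<bar>of_int m\<bar> \<le> 1 / C * \<bar>of_int m\<bar>" by (intro mult_right_mono) (auto simp: c_def)
      ultimately show "c * \<bar>of_int m\<bar> \<le> ?X" by simp
    qed
    have "(\<lambda>\<tau>. \<Sum>\<^sub>\<infinity>p\<in>- {(0, 0)}. ?f p \<tau>) holomorphic_on ball \<tau>\<^sub>0 y"
    proof (rule infsum_holomorphic)
      show "(\<lambda>p. 1 / c ^ (k - 3) * (c powr (-3) * pair_weight p)) summable_on (- {(0, 0)})"
        by (intro summable_on_cmult_right summable_on_subset_banach[OF summable_on_pair_weight]) auto
      fix p :: "int \<times> int" assume p: "p \<in> - {(0, 0)}"
      obtain m n where mn: "p = (m, n)" "(m, n) \<noteq> (0, 0)" using p by (cases p) auto
      have ge: "c \<le> cmod (of_int m + of_int n * \<tau>)" if "\<tau> \<in> ball \<tau>\<^sub>0 y" for \<tau>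
        using pair_norm_ge[OF c mn(2) bnd[OF that]] .
      have "of_int m + of_int n * \<tau> \<noteq> 0" if "\<tau> \<in> ball \<tau>\<^sub>0 y" for \<tau>
        using ge[OF that] c by auto
      then show "?f p holomorphic_on ball \<tau>\<^sub>0 y"
        unfolding mn by (intro holomorphic_intros) auto
      fix \<tau> assume t: "\<tau> \<in> ball \<tau>\<^sub>0 y"
      let ?X = "cmod (of_int m + of_int n * \<tau>)"
      have "cmod (?f p \<tau>) = 1 / ?X ^ k" by (simp add: mn norm_divide norm_power)
      also have "\<dots> \<le> 1 / c ^ (k - 3) * (1 / ?X ^ 3)"
        by (rule inverse_power_le_cube[OF c ge[OF t] assms])
      also have "\<dots> \<le> 1 / c ^ (k - 3) * (c powr (-3) * pair_weight (m, n))"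
        using c by (intro mult_left_mono pair_weight_bound[OF c mn(2) bnd[OF t]]) auto
      finally show "cmod (?f p \<tau>) \<le> 1 / c ^ (k - 3) * (c powr (-3) * pair_weight p)" by (simp add: mn)
    qed auto
    then show ?thesis
      using y by (intro holomorphic_on_imp_differentiable_at[of _ "ball \<tau>\<^sub>0 y"]) auto
  qed
  then have "(\<lambda>\<tau>. \<Sum>\<^sub>\<infinity>p\<in>- {(0, 0)}. ?f p \<tau>) holomorphic_on {\<tau>. Im \<tau> > 0}"
    by (simp add: holomorphic_on_def field_differentiable_at_within)
  then show ?thesis
    by (rule holomorphic_transform) (simp add: eisenstein_std)
qed

section \<open>Behaviour at the cusp\<close>

lemma cusp_coordinates:
  assumes "Im \<tau> \<ge> 1" "\<bar>Re \<tau>\<bar> \<le> 1 / 2"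
  shows "\<bar>b\<bar> * Im \<tau> \<le> cmod (of_real a + of_real b * \<tau>)"
    "\<bar>a\<bar> \<le> 3 * cmod (of_real a + of_real b * \<tau>)"
proof -
  have imp: "Im \<tau> > 0" using assms by linarith
  show "\<bar>b\<bar> * Im \<tau> \<le> cmod (of_real a + of_real b * \<tau>)" by (rule std_coordinates(1)[OF imp])
  have "cmod \<tau> \<le> \<bar>Re \<tau>\<bar> + \<bar>Im \<tau>\<bar>" by (rule cmod_le)
  then have "cmod \<tau> \<le> 2 * Im \<tau>" using assms by linarith
  then have "1 + cmod \<tau> / Im \<tau> \<le> 3" using imp by (simp add: field_simps)
  from mult_right_mono[OF this norm_ge_zero] std_coordinates(2)[OF imp, of a b]
  show "\<bar>a\<bar> \<le> 3 * cmod (of_real a + of_real b * \<tau>)" by (meson order_trans)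
qed

text \<open>Pulling out the height \<open>y\<close>, which accompanies the second coordinate, leaves
  a summable majorant times a factor that tends to 0 at the cusp.\<close>

lemma pair_weight_bound_cusp:
  assumes "y > 0" "p > 0" "q > 0" "p * int_weight m \<le> X" "q * (int_weight n * y) \<le> X"
  shows "1 / X ^ 3 \<le> (p * q) powr (-3/2) * y powr (-3/2) * pair_weight (m, n)"
proof -
  have "1 / X ^ 3 \<le> (p * int_weight m) powr (-3/2) * (q * (int_weight n * y)) powr (-3/2)"
    using assms by (intro inverse_cube_le) auto
  also have "\<dots> = (p * q) powr (-3/2) * y powr (-3/2) * pair_weight (m, n)"
    using assms by (simp add: pair_weight_def powr_mult)
  finally show ?thesis .
qed

text \<open>Growing imaginary part inside a vertical strip. By \<open>lattice_reduced\<close> the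
  strip contains a representative of every lattice up to scaling, and its bounded width makes the
  estimates uniform.\<close>

definition cusp :: "complex filter" where
  "cusp = inf (filtercomap Im at_top) (principal {\<tau>. \<bar>Re \<tau>\<bar> \<le> 1 / 2})"

lemma Im_cusp: "filterlim Im at_top cusp"
  unfolding cusp_def by (rule filterlim_mono[OF filterlim_filtercomap order_refl inf.cobounded1])

lemma eventually_cuspI:
  assumes "\<And>\<tau>. Im \<tau> \<ge> Y \<Longrightarrow> \<bar>Re \<tau>\<bar> \<le> 1 / 2 \<Longrightarrow> P \<tau>"
  shows "eventually P cusp"
  unfolding cusp_def eventually_inf_principal eventually_filtercomap
  using assms eventually_ge_at_top[of Y] by (intro exI[of _ "\<lambda>y. Y \<le> y"]) auto

lemma eventually_cuspD:
  assumes "eventually P cusp"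
  obtains Y where "\<And>\<tau>. Im \<tau> \<ge> Y \<Longrightarrow> \<bar>Re \<tau>\<bar> \<le> 1 / 2 \<Longrightarrow> P \<tau>"
  using assms unfolding cusp_def eventually_inf_principal eventually_filtercomap eventually_at_top_linorder
  by fastforce

lemma cusp_tendsto_0:
  fixes f :: "complex \<Rightarrow> complex"
  assumes "\<And>\<tau>. Im \<tau> \<ge> 1 \<Longrightarrow> \<bar>Re \<tau>\<bar> \<le> 1 / 2 \<Longrightarrow> cmod (f \<tau>) \<le> Im \<tau> powr (-3/2) * K"
  shows "(f \<longlongrightarrow> 0) cusp"
proof (rule Lim_null_comparison)
  show "\<forall>\<^sub>F \<tau> in cusp. cmod (f \<tau>) \<le> Im \<tau> powr (-3/2) * K"
    by (rule eventually_cuspI[of 1]) (use assms in auto)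
  have "((\<lambda>\<tau>. Im \<tau> powr (-3/2)) \<longlongrightarrow> 0) cusp"
    by (rule tendsto_neg_powr[OF _ Im_cusp]) auto
  then show "((\<lambda>\<tau>. Im \<tau> powr (-3/2) * K) \<longlongrightarrow> 0) cusp"
    using tendsto_mult_left_zero by blast
qed

lemma summable_inverse_fourth:
  "(\<lambda>m::int. 1 / (of_int m :: real) ^ 4) summable_on - {0}"
proof (rule summable_on_norm_le)
  show "(\<lambda>m. int_weight m powr (-3/2)) summable_on - {0}"
    by (rule summable_on_subset_banach[OF summable_on_int_weight_powr]) auto
  fix m :: int assume "m \<in> - {0}"
  then have w: "int_weight m = \<bar>of_int m\<bar>" by (auto simp: int_weight_def)
  have "1 / (of_int m :: real) ^ 4 = int_weight m powr (-4)"
    unfolding w using \<open>m \<in> - {0}\<close> by (simp add: powr_minus_divide powr_numeral)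
  also have "\<dots> \<le> int_weight m powr (-3/2)" by (intro powr_mono) (auto simp: int_weight_ge_1)
  finally show "norm (1 / (of_int m :: real) ^ 4) \<le> int_weight m powr (-3/2)" by simp
qed

text \<open>The terms with second coordinate 0 do not depend on \<tau> and sum to the limit; all
  other rows of the lattice recede to infinity.\<close>

lemma eisenstein_4_cusp:
  obtains Z where "Z \<noteq> 0" "((\<lambda>\<tau>. eisenstein_sum 4 (std_lattice \<tau>)) \<longlongrightarrow> Z) cusp"
proof -
  define Zr where "Zr = (\<Sum>\<^sub>\<infinity>m\<in>- {0}. 1 / (of_int m :: real) ^ 4)"
  define S where "S = (\<Sum>\<^sub>\<infinity>p. pair_weight p)"
  \<comment> \<open>The terms are positive, so the limit is at least the term m = 1 and hence
    nonzero.\<close>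
  have "(\<Sum>m\<in>{1}. 1 / (of_int m :: real) ^ 4) \<le> Zr"
    unfolding Zr_def by (rule finite_sum_le_infsum[OF summable_inverse_fourth]) auto
  then have Z1: "Zr \<ge> 1" by simp
  have hs: "((\<lambda>m. 1 / (of_int m :: complex) ^ 4) has_sum of_real Zr) (- {0})"
  proof -
    have "((\<lambda>m. complex_of_real (1 / (of_int m :: real) ^ 4)) has_sum of_real Zr) (- {0})"
      unfolding Zr_def by (intro has_sum_of_real has_sum_infsum summable_inverse_fourth)
    then show ?thesis by simp
  qed
  have "((\<lambda>\<tau>. eisenstein_sum 4 (std_lattice \<tau>) - of_real Zr) \<longlongrightarrow> 0) cusp"
  proof (rule cusp_tendsto_0)
    fix \<tau> assume t: "Im \<tau> \<ge> 1" "\<bar>Re \<tau>\<bar> \<le> 1 / 2"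
    let ?f = "\<lambda>p. 1 / (of_int (fst p) + of_int (snd p) * \<tau>) ^ 4"
    let ?A = "(\<lambda>m. (m, 0)) ` (- {0::int})" and ?B = "{p::int \<times> int. snd p \<noteq> 0}"
    let ?g = "\<lambda>p. (1/3) powr (-3/2) * Im \<tau> powr (-3/2) * pair_weight p"
    have AB: "- {(0, 0)} = ?A \<union> ?B" "?A \<inter> ?B = {}" by auto
    have fA: "(?f has_sum of_real Zr) ?A"
      by (subst has_sum_reindex) (use hs in \<open>auto simp: o_def inj_on_def\<close>)
    have sg: "?g summable_on ?B"
      by (intro summable_on_cmult_right summable_on_subset_banach[OF summable_on_pair_weight]) auto
    have bnd: "norm (?f p) \<le> ?g p" if "p \<in> ?B" for p
    proof -
      have p: "p = (fst p, snd p)" "snd p \<noteq> 0" using that by auto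
      define m n where "m = fst p" and "n = snd p"
      note p = p[folded m_def n_def]
      let ?X = "cmod (of_int m + of_int n * \<tau>)"
      have c: "\<bar>of_int n\<bar> * Im \<tau> \<le> ?X" "\<bar>of_int m\<bar> \<le> 3 * ?X"
        using cusp_coordinates[OF t, where a = "of_int m" and b = "of_int n"] by simp_all
      have wn: "int_weight n = \<bar>of_int n\<bar>" using p(2) by (auto simp: int_weight_def)
      have "1 * 1 \<le> \<bar>of_int n\<bar> * Im \<tau>" using p(2) t by (intro mult_mono) auto
      then have X1: "1 \<le> ?X" using c by linarith
      then have wm: "1/3 * int_weight m \<le> ?X" using c by (auto simp: int_weight_def)
      have "norm (?f p) = 1 / ?X ^ 4" by (simp add: p norm_divide norm_power)
      also have "\<dots> \<le> 1 / 1 ^ (4 - 3) * (1 / ?X ^ 3)" by (rule inverse_power_le_cube) (use X1 in auto)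
      also have "\<dots> = 1 / ?X ^ 3" by simp
      also have "\<dots> \<le> (1/3 * 1) powr (-3/2) * Im \<tau> powr (-3/2) * pair_weight (m, n)"
        by (rule pair_weight_bound_cusp) (use t c wn wm in auto)
      finally show ?thesis by (simp add: p)
    qed
    have sB: "?f summable_on ?B" by (rule summable_on_norm_le[OF sg bnd])
    have "eisenstein_sum 4 (std_lattice \<tau>) = infsum ?f (- {(0, 0)})"
      using t by (intro eisenstein_std) auto
    also have "\<dots> = of_real Zr + infsum ?f ?B"
      unfolding AB(1) using fA sB AB(2)
      by (subst infsum_Un_disjoint) (auto simp: has_sum_iff)
    finally have "cmod (eisenstein_sum 4 (std_lattice \<tau>) - of_real Zr) = cmod (infsum ?f ?B)" by simp
    also have "\<dots> \<le> infsum ?g ?B"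
      by (rule norm_infsum_le[OF has_sum_infsum[OF sB] has_sum_infsum[OF sg] bnd])
    also have "\<dots> \<le> infsum ?g UNIV"
      by (rule infsum_mono_neutral[OF sg summable_on_cmult_right[OF summable_on_pair_weight]])
         (auto simp: pair_weight_def)
    also have "\<dots> = Im \<tau> powr (-3/2) * ((1/3) powr (-3/2) * S)"
      unfolding S_def by (subst infsum_cmult_right') simp
    finally show "cmod (eisenstein_sum 4 (std_lattice \<tau>) - of_real Zr) \<le> Im \<tau> powr (-3/2) * ((1/3) powr (-3/2) * S)" .
  qed
  then have "((\<lambda>\<tau>. eisenstein_sum 4 (std_lattice \<tau>)) \<longlongrightarrow> of_real Zr) cusp"
    by (subst Lim_null)
  moreover have "complex_of_real Zr \<noteq> 0" using Z1 by simp
  ultimately show ?thesis using that by blast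
qed

text \<open>The subtracted constants cancel in the difference, so the sum runs over the whole
  lattice, 0 included, and can be reindexed by all pairs of integers.\<close>

lemma (in lattice) wp_diff_sum:
  "wp a - wp b = (\<Sum>\<^sub>\<infinity>w\<in>L. 1 / (a - w)\<^sup>2 - 1 / (b - w)\<^sup>2)"
  "(\<lambda>w. 1 / (a - w)\<^sup>2 - 1 / (b - w)\<^sup>2) summable_on L"
proof -
  let ?f = "\<lambda>w. 1 / (a - w)\<^sup>2 - 1 / (b - w)\<^sup>2"
  have "((\<lambda>w. (1 / (a - w)\<^sup>2 - 1 / w\<^sup>2) + - (1 / (b - w)\<^sup>2 - 1 / w\<^sup>2)) has_sum
      ((\<Sum>\<^sub>\<infinity>w\<in>L - {0}. 1 / (a - w)\<^sup>2 - 1 / w\<^sup>2) + - (\<Sum>\<^sub>\<infinity>w\<in>L - {0}. 1 / (b - w)\<^sup>2 - 1 / w\<^sup>2))) (L - {0})"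
    by (intro has_sum_add has_sum_uminusI has_sum_infsum wp_summable)
  then have "(?f has_sum ((\<Sum>\<^sub>\<infinity>w\<in>L - {0}. 1 / (a - w)\<^sup>2 - 1 / w\<^sup>2) - (\<Sum>\<^sub>\<infinity>w\<in>L - {0}. 1 / (b - w)\<^sup>2 - 1 / w\<^sup>2))) (L - {0})"
    by simp
  then have "(?f has_sum (?f 0 + ((\<Sum>\<^sub>\<infinity>w\<in>L - {0}. 1 / (a - w)\<^sup>2 - 1 / w\<^sup>2) - (\<Sum>\<^sub>\<infinity>w\<in>L - {0}. 1 / (b - w)\<^sup>2 - 1 / w\<^sup>2))))
      (insert 0 (L - {0}))"
    by (intro has_sum_insert) auto
  moreover have "insert 0 (L - {0}) = L" by auto
  ultimately have "(?f has_sum (wp a - wp b)) L"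
    by (simp add: wp_def algebra_simps)
  then show "wp a - wp b = infsum ?f L" "?f summable_on L" by (auto simp: has_sum_iff)
qed

text \<open>Taking the difference gains one power, from X^-2 to X^-3, and cubic decay is summable
  over a lattice.\<close>

lemma inverse_square_diff_bound:
  fixes A :: complex
  assumes "0 < X" "X \<le> cmod A" "X \<le> cmod (A + 1/2)"
  shows "cmod (1 / A\<^sup>2 - 1 / (A + 1/2)\<^sup>2) \<le> 1 / X ^ 3"
proof -
  define B where "B = A + 1/2"
  define a b where "a = cmod A" and "b = cmod B"
  have ab: "0 < X" "X \<le> a" "X \<le> b" "A \<noteq> 0" "B \<noteq> 0" using assms by (auto simp: a_def b_def B_def)
  have "1 / A\<^sup>2 - 1 / B\<^sup>2 = (B - A) * (A + B) / (A\<^sup>2 * B\<^sup>2)"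
    using ab by (simp add: divide_simps) (simp add: algebra_simps power2_eq_square)
  also have "B - A = 1/2" by (simp add: B_def)
  finally have "cmod (1 / A\<^sup>2 - 1 / B\<^sup>2) = 1/2 * cmod (A + B) / (a\<^sup>2 * b\<^sup>2)"
    by (simp add: norm_mult norm_divide norm_power a_def b_def)
  also have "\<dots> \<le> 1/2 * (a + b) / (a\<^sup>2 * b\<^sup>2)"
    using norm_triangle_ineq[of A B] ab by (intro divide_right_mono mult_left_mono) (auto simp: a_def b_def)
  also have "\<dots> = 1/2 * (1 / (a * (b * b)) + 1 / (a * a * b))"
    using ab by (simp add: power2_eq_square divide_simps)
  also have "\<dots> \<le> 1/2 * (1 / (X * (X * X)) + 1 / (X * X * X))"
    using ab by (intro mult_left_mono add_mono divide_left_mono mult_mono) auto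
  also have "\<dots> = 1 / X ^ 3" by (simp add: power3_eq_cube)
  finally show ?thesis by (simp add: B_def)
qed

text \<open>Both points lie halfway between two rows of the lattice, so every row recedes from them
  as Im \<tau> grows, and each term of the difference decays cubically.\<close>

lemma wp_half_periods_cusp:
  "((\<lambda>\<tau>. lattice.wp (std_lattice \<tau>) (\<tau> / 2) - lattice.wp (std_lattice \<tau>) (1 / 2 + \<tau> / 2)) \<longlongrightarrow> 0) cusp"
proof (rule cusp_tendsto_0)
  fix \<tau> assume t: "Im \<tau> \<ge> 1" "\<bar>Re \<tau>\<bar> \<le> 1 / 2"
  define S where "S = (\<Sum>\<^sub>\<infinity>p. pair_weight p)"
  interpret lattice "std_lattice \<tau>" using is_lattice_std[of \<tau>] t by unfold_locales auto
  let ?h = "\<lambda>(m, n). of_int m + of_int n * \<tau>"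
  let ?f = "\<lambda>w. 1 / (\<tau> / 2 - w)\<^sup>2 - 1 / (1 / 2 + \<tau> / 2 - w)\<^sup>2"
  let ?g = "\<lambda>p. (1/12) powr (-3/2) * Im \<tau> powr (-3/2) * pair_weight p"
  have inj: "inj ?h" using t by (intro inj_std_lattice) auto
  have hs: "((?f \<circ> ?h) has_sum (wp (\<tau> / 2) - wp (1 / 2 + \<tau> / 2))) UNIV"
    using wp_diff_sum[of "\<tau> / 2" "1 / 2 + \<tau> / 2"] unfolding has_sum_reindex[OF inj, symmetric]
    by (simp add: std_lattice_def has_sum_iff)
  have bnd: "cmod ((?f \<circ> ?h) p) \<le> ?g p" for p
  proof -
    obtain m n where p: "p = (m, n)" by (cases p)
    define A where "A = of_real (- of_int m) + of_real (1/2 - of_int n) * \<tau>"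
    have B: "A + 1/2 = of_real (1/2 - of_int m) + of_real (1/2 - of_int n) * \<tau>" by (simp add: A_def)
    \<comment> \<open>A half-integer is never 0, so twice its modulus dominates the weight; equality
      holds at i = 0 and i = 1.\<close>
    have w: "int_weight i \<le> 2 * \<bar>1/2 - of_int i\<bar>" for i
    proof -
      have "i \<ge> 1 \<or> i \<le> 0" by linarith
      then have "1 \<le> (of_int i :: real) \<or> of_int i \<le> (0 :: real)" by auto
      then show ?thesis by (auto simp: int_weight_def max_def abs_if)
    qed
    have cA: "\<bar>1/2 - of_int n\<bar> * Im \<tau> \<le> cmod A" "\<bar>of_int m\<bar> \<le> 3 * cmod A"
      using cusp_coordinates[OF t, where a = "- of_int m" and b = "1/2 - of_int n"] unfolding A_def by (simp_all only: abs_minus_cancel)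
    have cB: "\<bar>1/2 - of_int n\<bar> * Im \<tau> \<le> cmod (A + 1/2)" "\<bar>1/2 - of_int m\<bar> \<le> 3 * cmod (A + 1/2)"
      using cusp_coordinates[OF t, where a = "1/2 - of_int m" and b = "1/2 - of_int n"] unfolding B by (simp_all only:)
    have wn: "1/2 * (int_weight n * Im \<tau>) \<le> \<bar>1/2 - of_int n\<bar> * Im \<tau>"
      using w[of n] t by simp
    have "1 * 1 \<le> int_weight n * Im \<tau>" using t by (intro mult_mono int_weight_ge_1 less_imp_le[OF int_weight_pos]) auto
    then have "1/2 \<le> cmod A" using wn cA by linarith
    then have "1/6 * int_weight m \<le> cmod A" using cA(2) by (auto simp: int_weight_def max_def)
    moreover have "1/6 * int_weight m \<le> cmod (A + 1/2)" 
    proof -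
      have "1/6 * w \<le> x" if "a \<le> 3 * x" "w \<le> 2 * a" for w x a :: real using that by linarith
      from this[OF cB(2) w[of m]] show ?thesis .
    qed
    ultimately have X: "1/6 * int_weight m \<le> min (cmod A) (cmod (A + 1/2))"
      "1/2 * (int_weight n * Im \<tau>) \<le> min (cmod A) (cmod (A + 1/2))"
      using wn cA(1) cB(1) by auto
    have Xpos: "0 < min (cmod A) (cmod (A + 1/2))"
      using X(1) int_weight_pos[of m] by linarith
    have e: "\<tau> / 2 - (of_int m + of_int n * \<tau>) = A" "1 / 2 + \<tau> / 2 - (of_int m + of_int n * \<tau>) = A + 1/2"
      by (simp_all add: A_def algebra_simps)
    have "cmod ((?f \<circ> ?h) p) = cmod (1 / A\<^sup>2 - 1 / (A + 1/2)\<^sup>2)"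
      by (simp only: p o_def prod.case e)
    also have "\<dots> \<le> 1 / min (cmod A) (cmod (A + 1/2)) ^ 3"
      by (rule inverse_square_diff_bound[OF Xpos]) auto
    also have "\<dots> \<le> (1/6 * (1/2)) powr (-3/2) * Im \<tau> powr (-3/2) * pair_weight (m, n)"
      by (rule pair_weight_bound_cusp[OF _ _ _ X]) (use t in auto)
    finally show ?thesis by (simp add: p)
  qed
  have sg: "(?g has_sum (1/12) powr (-3/2) * Im \<tau> powr (-3/2) * S) UNIV"
    unfolding S_def by (intro has_sum_cmult_right has_sum_infsum summable_on_pair_weight)
  have "cmod (wp (\<tau> / 2) - wp (1 / 2 + \<tau> / 2)) \<le> (1/12) powr (-3/2) * Im \<tau> powr (-3/2) * S"
    by (rule norm_infsum_le[OF hs sg bnd])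
  then show "cmod (wp (\<tau> / 2) - wp (1 / 2 + \<tau> / 2)) \<le> Im \<tau> powr (-3/2) * ((1/12) powr (-3/2) * (\<Sum>\<^sub>\<infinity>p. pair_weight p))"
    by (simp add: S_def mult_ac)
qed

section \<open>The modular invariant\<close>

definition disc :: "complex set \<Rightarrow> complex" where
  "disc L = (60 * eisenstein_sum 4 L) ^ 3 - 27 * (140 * eisenstein_sum 6 L)\<^sup>2"

text \<open>Klein's invariant without the customary factor 1728.\<close>

definition j_inv :: "complex \<Rightarrow> complex" where
  "j_inv \<tau> = (60 * eisenstein_sum 4 (std_lattice \<tau>)) ^ 3 / disc (std_lattice \<tau>)"

text \<open>\<open>discriminant\<close> with a = 1/2 and b = \<tau>/2, so that the root difference
  singled out is the one that tends to 0 at the cusp.\<close>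

lemma disc_std:
  assumes "Im \<tau> \<noteq> 0"
  shows "disc (std_lattice \<tau>) \<noteq> 0"
    "disc (std_lattice \<tau>) =
      (lattice.wp (std_lattice \<tau>) (\<tau> / 2) - lattice.wp (std_lattice \<tau>) (1 / 2 + \<tau> / 2))\<^sup>2 *
      (3 * (60 * eisenstein_sum 4 (std_lattice \<tau>)) - 4 *
       (lattice.wp (std_lattice \<tau>) (\<tau> / 2) - lattice.wp (std_lattice \<tau>) (1 / 2 + \<tau> / 2))\<^sup>2)\<^sup>2"
proof -
  interpret lattice "std_lattice \<tau>" using is_lattice_std[OF assms] by unfold_locales
  have *: "of_int i * (1 / 2) + of_int j * (\<tau> / 2) \<notin> std_lattice \<tau>" if "odd i \<or> odd j" for i j
  proof
    assume "of_int i * (1 / 2) + of_int j * (\<tau> / 2) \<in> std_lattice \<tau>"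
    then obtain m n where "of_int i * (1 / 2) + of_int j * (\<tau> / 2) = of_int m + of_int n * \<tau>"
      unfolding std_lattice_def by auto
    then have "of_int i + of_int j * \<tau> = of_int (2 * m) + of_int (2 * n) * \<tau>"
      by (simp add: field_simps)
    then have "(i, j) = (2 * m, 2 * n)"
      using inj_std_lattice[OF assms, THEN injD, of "(i, j)" "(2 * m, 2 * n)"] by simp
    then show False using that by auto
  qed
  have h: "1 / 2 \<notin> std_lattice \<tau>" "\<tau> / 2 \<notin> std_lattice \<tau>" "1 / 2 - \<tau> / 2 \<notin> std_lattice \<tau>"
    "1 / 2 + \<tau> / 2 \<notin> std_lattice \<tau>"
    using *[of 1 0] *[of 0 1] *[of 1 "-1"] *[of 1 1] by simp_all
  have "2 * (1 / 2) \<in> std_lattice \<tau>" "2 * (\<tau> / 2) \<in> std_lattice \<tau>"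
    unfolding std_lattice_def by (rule image_eqI[of _ _ "(1, 0)"], simp_all, rule image_eqI[of _ _ "(0, 1)"], simp_all)
  note D = discriminant[OF h this]
  show "disc (std_lattice \<tau>) \<noteq> 0" unfolding disc_def using D(2) unfolding G_def .
  show "disc (std_lattice \<tau>) =
      (lattice.wp (std_lattice \<tau>) (\<tau> / 2) - lattice.wp (std_lattice \<tau>) (1 / 2 + \<tau> / 2))\<^sup>2 *
      (3 * (60 * eisenstein_sum 4 (std_lattice \<tau>)) - 4 *
       (lattice.wp (std_lattice \<tau>) (\<tau> / 2) - lattice.wp (std_lattice \<tau>) (1 / 2 + \<tau> / 2))\<^sup>2)\<^sup>2"
    unfolding disc_def using D(1) unfolding G_def .
qed

lemma inverse_bound_swap:
  fixes x C :: real
  assumes "0 < x" "x < 1 / (\<bar>C\<bar> + 1)"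
  shows "\<bar>C\<bar> + 1 < 1 / x"
proof -
  have "0 < \<bar>C\<bar> + 1" by simp
  then show ?thesis using assms by (simp add: field_simps)
qed

text \<open>The reciprocal of the invariant is d^2 (3g - 4d^2)^2 / g^3, where d tends to 0 and g to
  a nonzero limit. It never vanishes where g is nonzero, so the invariant itself becomes
  large.\<close>

lemma j_inv_cusp:
  obtains Y where "\<And>\<tau>. Im \<tau> \<ge> Y \<Longrightarrow> \<bar>Re \<tau>\<bar> \<le> 1 / 2 \<Longrightarrow> C < cmod (j_inv \<tau>)"
proof -
  obtain Z where Z: "Z \<noteq> 0" "((\<lambda>\<tau>. eisenstein_sum 4 (std_lattice \<tau>)) \<longlongrightarrow> Z) cusp"
    by (rule eisenstein_4_cusp)
  let ?d = "\<lambda>\<tau>. lattice.wp (std_lattice \<tau>) (\<tau> / 2) - lattice.wp (std_lattice \<tau>) (1 / 2 + \<tau> / 2)"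
  let ?g = "\<lambda>\<tau>. 60 * eisenstein_sum 4 (std_lattice \<tau>)"
  let ?q = "\<lambda>\<tau>. (?d \<tau>)\<^sup>2 * (3 * ?g \<tau> - 4 * (?d \<tau>)\<^sup>2)\<^sup>2 / ?g \<tau> ^ 3"
  have "(?q \<longlongrightarrow> 0\<^sup>2 * (3 * (60 * Z) - 4 * 0\<^sup>2)\<^sup>2 / (60 * Z) ^ 3) cusp"
    by (intro tendsto_intros Z wp_half_periods_cusp) (use Z in auto)
  then have "(?q \<longlongrightarrow> 0) cusp" by simp
  then have "\<forall>\<^sub>F \<tau> in cusp. dist (?q \<tau>) 0 < 1 / (\<bar>C\<bar> + 1)"
    by (rule tendstoD) auto
  moreover have "\<forall>\<^sub>F \<tau> in cusp. eisenstein_sum 4 (std_lattice \<tau>) \<noteq> 0"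
    using tendsto_imp_eventually_ne[OF Z(2,1)] .
  moreover have "\<forall>\<^sub>F \<tau> in cusp. Im \<tau> > 0"
    by (rule eventually_cuspI[of 1]) auto
  ultimately have "\<forall>\<^sub>F \<tau> in cusp. C < cmod (j_inv \<tau>)"
  proof eventually_elim
    case (elim \<tau>)
    have i: "Im \<tau> \<noteq> 0" using elim by simp
    have g: "?g \<tau> \<noteq> 0" using elim by simp
    have q: "?q \<tau> = disc (std_lattice \<tau>) / ?g \<tau> ^ 3" unfolding disc_std(2)[OF i] ..
    then have qn: "?q \<tau> \<noteq> 0" using disc_std(1)[OF i] g by simp
    have "j_inv \<tau> = 1 / ?q \<tau>" unfolding q j_inv_def by simp
    then have j: "cmod (j_inv \<tau>) = 1 / cmod (?q \<tau>)" by (simp only: norm_divide norm_one)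
    have qp: "cmod (?q \<tau>) > 0" using qn by (simp only: zero_less_norm_iff not_False_eq_True)
    have "cmod (?q \<tau>) < 1 / (\<bar>C\<bar> + 1)" using elim(1) by (simp only: dist_norm diff_zero)
    then have "\<bar>C\<bar> + 1 < 1 / cmod (?q \<tau>)"
      using inverse_bound_swap[OF qp] by blast
    then show ?case unfolding j by linarith
  qed
  then show ?thesis using that by (rule eventually_cuspD)
qed

lemma j_inv_holomorphic: "j_inv holomorphic_on {\<tau>. Im \<tau> > 0}"
  unfolding j_inv_def[abs_def]
proof (rule holomorphic_on_divide)
  have E: "(\<lambda>\<tau>. eisenstein_sum 4 (std_lattice \<tau>)) holomorphic_on {\<tau>. Im \<tau> > 0}"
    "(\<lambda>\<tau>. eisenstein_sum 6 (std_lattice \<tau>)) holomorphic_on {\<tau>. Im \<tau> > 0}"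
    by (rule eisenstein_holomorphic, simp)+
  show "(\<lambda>\<tau>. (60 * eisenstein_sum 4 (std_lattice \<tau>)) ^ 3) holomorphic_on {\<tau>. Im \<tau> > 0}"
    by (intro holomorphic_intros E)
  show "(\<lambda>\<tau>. disc (std_lattice \<tau>)) holomorphic_on {\<tau>. Im \<tau> > 0}"
    unfolding disc_def by (intro holomorphic_intros E)
  show "disc (std_lattice \<tau>) \<noteq> 0" if "\<tau> \<in> {\<tau>. Im \<tau> > 0}" for \<tau>
    by (rule disc_std(1)) (use that in simp)
qed

text \<open>A shortest nonzero vector is primitive and so belongs to a basis; an integer shift
  brings the real part into the strip. Minimality gives |\<tau>| >= 1, and a small real part then
  forces a large imaginary part.\<close>

lemma lattice_reduced:
  assumes "is_lattice L"
  obtains c \<tau> where "c \<noteq> 0" "L = (*) c ` std_lattice \<tau>" "\<bar>Re \<tau>\<bar> \<le> 1 / 2" "Im \<tau> \<ge> 1 / 2"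
proof -
  interpret lattice L using assms by unfold_locales
  obtain a b where L: "Im (b / a) \<noteq> 0" "L = (\<lambda>(m, n). of_int m * a + of_int n * b) ` UNIV"
    using assms by (rule is_latticeE)
  have memI: "of_int m * a + of_int n * b \<in> L" for m n unfolding L(2) by (intro image_eqI[of _ _ "(m, n)"]) auto
  have a0: "a \<noteq> 0" using L(1) by auto
  let ?A = "{w \<in> L. cmod w \<le> cmod a} - {0}"
  have A: "finite ?A" "a \<in> ?A" using finite_L_cball[of "cmod a"] a0 memI[of 1 0] by auto
  then have ne: "?A \<noteq> {}" by blast
  define \<omega> where "\<omega> = arg_min_on cmod ?A"
  have w: "\<omega> \<in> ?A" "\<And>x. x \<in> ?A \<Longrightarrow> cmod \<omega> \<le> cmod x"
    using arg_min_if_finite[OF A(1) ne, of cmod] unfolding \<omega>_def by (auto simp: not_less)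
  have min: "cmod \<omega> \<le> cmod x" if "x \<in> L" "x \<noteq> 0" for x
    using w that by (cases "cmod x \<le> cmod a") auto
  have w0: "\<omega> \<noteq> 0" "\<omega> \<in> L" using w by auto
  obtain m n where mn: "\<omega> = of_int m * a + of_int n * b" using w0(2) unfolding L(2) by auto
  \<comment> \<open>A common divisor of at least 2 could be divided out, leaving a shorter lattice
    vector.\<close>
  have "gcd m n = 1"
  proof (rule ccontr)
    assume ne1: "gcd m n \<noteq> 1"
    define g where "g = gcd m n"
    have "g \<noteq> 0" using mn w0 by (auto simp: g_def)
    then have g: "g \<ge> 2" using ne1 unfolding g_def by (metis gcd_ge_0_int int_one_le_iff_zero_less leI order_antisym
          le_less zle_add1_eq_le one_add_one add.commute)
    obtain m' n' where "m = g * m'" "n = g * n'" unfolding g_def by (meson dvdE gcd_dvd1 gcd_dvd2)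
    then have e: "\<omega> = of_int g * (of_int m' * a + of_int n' * b)" unfolding mn by (simp add: algebra_simps)
    let ?x = "of_int m' * a + of_int n' * b"
    have "?x \<noteq> 0" using e w0 by auto
    then have "cmod \<omega> \<le> cmod ?x" using min memI by blast
    moreover have "cmod \<omega> = of_int g * cmod ?x" using g unfolding e by (simp add: norm_mult)
    moreover have "2 * cmod ?x \<le> of_int g * cmod ?x" using g by (intro mult_right_mono) auto
    moreover have "cmod ?x > 0" using \<open>?x \<noteq> 0\<close> by simp
    ultimately show False by linarith
  qed
  then obtain p q where pq: "p * m + q * n = 1" using bezout_int[of m n] by metis
  have pqc: "of_int p * of_int m + of_int q * of_int n = (1 :: complex)"
    using pq by (metis of_int_1 of_int_add of_int_mult)
  \<comment> \<open>The Bezout relation says that the change of basis has determinant 1, so it can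
    be inverted over the integers, as in \<open>ab\<close>.\<close>
  define \<omega>2 where "\<omega>2 = of_int (- q) * a + of_int p * b"
  have w2: "\<omega>2 \<in> L" unfolding \<omega>2_def by (rule memI)
  have ab: "a = of_int p * \<omega> - of_int n * \<omega>2" "b = of_int q * \<omega> + of_int m * \<omega>2"
    unfolding mn \<omega>2_def using pqc by (simp_all add: algebra_simps) (algebra+)
  define \<tau>0 where "\<tau>0 = \<omega>2 / \<omega>"
  have w2': "\<omega>2 = \<tau>0 * \<omega>" using w0 by (simp add: \<tau>0_def)
  have im0: "Im \<tau>0 \<noteq> 0"
  proof
    assume "Im \<tau>0 = 0"
    then have r: "\<tau>0 \<in> \<real>" by (simp add: complex_is_Real_iff)
    have "b / a = ((of_int q + of_int m * \<tau>0) * \<omega>) / ((of_int p - of_int n * \<tau>0) * \<omega>)"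
      unfolding ab(1) unfolding ab(2) w2' by (simp add: algebra_simps)
    also have "\<dots> = (of_int q + of_int m * \<tau>0) / (of_int p - of_int n * \<tau>0)" using w0 by simp
    also have "\<dots> \<in> \<real>" using r by (intro Reals_divide Reals_add Reals_diff Reals_mult Reals_of_int)
    finally show False using L(1) by (simp add: complex_is_Real_iff)
  qed
  \<comment> \<open>The sign \<open>e\<close> moves the ratio into the upper half plane;
    \<open>k\<close> is the integer shift of its real part.\<close>
  define e :: int where "e = (if Im \<tau>0 > 0 then 1 else - 1)"
  define k where "k = round (Re (of_int e * \<tau>0))"
  define \<tau> where "\<tau> = of_int e * \<tau>0 - of_int k"
  have e: "e * e = 1" by (simp add: e_def)
  have ec: "of_int e * of_int e = (1 :: complex)" using e by (metis of_int_1 of_int_mult)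
  have im: "Im \<tau> > 0" using im0 by (auto simp: \<tau>_def e_def)
  have re: "\<bar>Re \<tau>\<bar> \<le> 1 / 2"
    using of_int_round_abs_le[of "Re (of_int e * \<tau>0)"] by (simp add: \<tau>_def k_def abs_minus_commute)
  have t0: "\<tau>0 = of_int e * (\<tau> + of_int k)" using ec by (simp add: \<tau>_def algebra_simps flip: mult.assoc)
  have stdI: "of_int i + of_int j * \<tau> \<in> std_lattice \<tau>" for i j
    unfolding std_lattice_def by (intro image_eqI[of _ _ "(i, j)"]) auto
  have LL: "L = (*) \<omega> ` std_lattice \<tau>"
  proof (intro equalityI subsetI)
    fix x assume "x \<in> L"
    then obtain i j where "x = of_int i * a + of_int j * b" unfolding L(2) by auto
    then have "x = \<omega> * (of_int (i * p + j * q + (j * m - i * n) * e * k) + of_int ((j * m - i * n) * e) * \<tau>)"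
      unfolding ab(1) unfolding ab(2) w2' t0 by (simp add: algebra_simps)
    then show "x \<in> (*) \<omega> ` std_lattice \<tau>" using stdI by (rule image_eqI)
  next
    fix x assume "x \<in> (*) \<omega> ` std_lattice \<tau>"
    then obtain i j where "x = \<omega> * (of_int i + of_int j * \<tau>)" unfolding std_lattice_def by auto
    then have "x = of_int i * \<omega> + of_int j * (of_int e * \<omega>2 - of_int k * \<omega>)"
      unfolding w2' \<tau>_def by (simp add: algebra_simps)
    also have "\<dots> = of_int (i * m - j * e * q - j * k * m) * a + of_int (i * n + j * e * p - j * k * n) * b"
      unfolding mn \<omega>2_def by (simp add: algebra_simps)
    finally have x: "x = of_int (i * m - j * e * q - j * k * m) * a + of_int (i * n + j * e * p - j * k * n) * b" .
    show "x \<in> L" unfolding x by (rule memI)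
  qed
  have "\<omega> * \<tau> \<in> L" unfolding LL std_lattice_def by (intro imageI image_eqI[of _ _ "(0, 1)"]) auto
  moreover have "\<omega> * \<tau> \<noteq> 0" using w0 im by auto
  ultimately have "cmod \<omega> \<le> cmod (\<omega> * \<tau>)" by (rule min)
  then have "1 \<le> cmod \<tau>" using w0 by (simp add: norm_mult)
  then have "1 \<le> (cmod \<tau>)\<^sup>2" by (rule one_le_power)
  then have "1 \<le> (Re \<tau>)\<^sup>2 + (Im \<tau>)\<^sup>2" by (simp only: cmod_power2)
  moreover have "(Re \<tau>)\<^sup>2 \<le> (1/2)\<^sup>2" using power_mono[OF re abs_ge_zero, of 2] by simp
  ultimately have "(1/2)\<^sup>2 \<le> (Im \<tau>)\<^sup>2" by (simp add: power2_eq_square)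
  then have "1/2 \<le> Im \<tau>" by (rule power2_le_imp_le[OF _ less_imp_le[OF im]])
  then show ?thesis using that[OF w0(1) LL re] by blast
qed

text \<open>Numerator and discriminant are both homogeneous of degree -12 in the lattice.\<close>

lemma j_inv_scale:
  assumes "c \<noteq> 0"
  shows "(60 * eisenstein_sum 4 ((*) c ` L)) ^ 3 / disc ((*) c ` L) = (60 * eisenstein_sum 4 L) ^ 3 / disc L"
proof -
  have 4: "(60 * eisenstein_sum 4 ((*) c ` L)) ^ 3 = (60 * eisenstein_sum 4 L) ^ 3 / c ^ 12"
    by (simp add: eisenstein_sum_scale[OF assms] power_divide power_mult_distrib flip: power_mult)
  have "27 * (140 * eisenstein_sum 6 ((*) c ` L))\<^sup>2 = 27 * (140 * eisenstein_sum 6 L)\<^sup>2 / c ^ 12"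
    by (simp add: eisenstein_sum_scale[OF assms] power_divide power_mult_distrib flip: power_mult)
  then have "disc ((*) c ` L) = disc L / c ^ 12"
    unfolding disc_def 4 by (simp add: diff_divide_distrib)
  then show ?thesis unfolding 4 using assms by simp
qed

lemma j_inv_reduced:
  assumes "Im \<tau> > 0"
  obtains \<tau>' where "\<bar>Re \<tau>'\<bar> \<le> 1 / 2" "Im \<tau>' \<ge> 1 / 2" "j_inv \<tau>' = j_inv \<tau>"
proof -
  have "is_lattice (std_lattice \<tau>)" using assms by (intro is_lattice_std) auto
  then obtain c \<tau>' where t: "c \<noteq> 0" "std_lattice \<tau> = (*) c ` std_lattice \<tau>'" "\<bar>Re \<tau>'\<bar> \<le> 1 / 2" "Im \<tau>' \<ge> 1 / 2"
    by (rule lattice_reduced)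
  then show ?thesis
    using j_inv_scale[OF t(1), of "std_lattice \<tau>'"] by (intro that[of \<tau>']) (simp_all add: j_inv_def)
qed

lemma j_inv_surj: "\<exists>\<tau>. Im \<tau> > 0 \<and> j_inv \<tau> = c"
proof -
  let ?H = "{\<tau>. Im \<tau> > 0}"
  let ?S = "j_inv ` ?H"
  have H: "open ?H" "connected ?H" "convex ?H"
    using open_halfspace_Im_gt[of 0] convex_halfspace_Im_gt[of 0] convex_connected by auto
  have "\<not> j_inv constant_on ?H"
  proof
    assume "j_inv constant_on ?H"
    then obtain a where a: "\<And>\<tau>. Im \<tau> > 0 \<Longrightarrow> j_inv \<tau> = a" by (auto simp: constant_on_def)
    obtain Y where Y: "\<And>\<tau>. Im \<tau> \<ge> Y \<Longrightarrow> \<bar>Re \<tau>\<bar> \<le> 1 / 2 \<Longrightarrow> cmod a < cmod (j_inv \<tau>)"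
      by (rule j_inv_cusp) blast
    from Y[of "Complex 0 (max Y 1)"] a[of "Complex 0 (max Y 1)"] show False by simp
  qed
  then have "open ?S"
    by (intro open_mapping_thm[OF j_inv_holomorphic H(1,2) H(1)]) auto
  moreover have "closed ?S"
  proof -
    have "a \<in> ?S" if a: "a \<in> closure ?S" for a
    proof -
      obtain Y where Y: "\<And>\<tau>. Im \<tau> \<ge> Y \<Longrightarrow> \<bar>Re \<tau>\<bar> \<le> 1 / 2 \<Longrightarrow> cmod a + 1 < cmod (j_inv \<tau>)"
        by (rule j_inv_cusp) blast
      \<comment> \<open>Values within distance 1 of \<open>a\<close> are too small to be taken above
        height \<open>Y\<close>; after reduction they come from this compact rectangle, whose image
        is closed.\<close>
      define K where "K = cbox (Complex (- 1 / 2) (1 / 2)) (Complex (1 / 2) Y)"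
      have KH: "K \<subseteq> ?H" by (auto simp: K_def in_cbox_complex_iff)
      have "compact (j_inv ` K)"
        by (intro compact_continuous_image holomorphic_on_imp_continuous_on
            holomorphic_on_subset[OF j_inv_holomorphic KH]) (simp add: K_def)
      then have cl: "closed (j_inv ` K)" by (rule compact_imp_closed)
      have "a \<in> closure (j_inv ` K)"
        unfolding closure_approachable
      proof (intro allI impI)
        fix e :: real assume "e > 0"
        then have "min e 1 > 0" by simp
        then obtain \<tau> where t: "Im \<tau> > 0" "dist (j_inv \<tau>) a < min e 1"
          using a unfolding closure_approachable by blast
        obtain \<tau>' where t': "\<bar>Re \<tau>'\<bar> \<le> 1 / 2" "Im \<tau>' \<ge> 1 / 2" "j_inv \<tau>' = j_inv \<tau>"
          by (rule j_inv_reduced[OF t(1)])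
        have "cmod (j_inv \<tau>') \<le> cmod a + 1"
          using t(2) norm_triangle_sub[of "j_inv \<tau>" a] unfolding t'(3) dist_norm by linarith
        then have "\<not> Im \<tau>' \<ge> Y" using Y[of \<tau>'] t'(1) by linarith
        then have "\<tau>' \<in> K" using t' by (auto simp: K_def in_cbox_complex_iff abs_le_iff)
        then show "\<exists>y\<in>j_inv ` K. dist y a < e"
          using t(2) imageI[of \<tau>' K j_inv] unfolding t'(3) by auto
      qed
      then show ?thesis using cl KH by auto
    qed
    then show ?thesis using closure_subset_eq by blast
  qed
  ultimately have "closed ?S \<and> open ?S" by blast
  then have "?S = {} \<or> ?S = UNIV" unfolding clopen .
  moreover have "j_inv \<i> \<in> ?S" by (rule imageI) simp
  ultimately have "c \<in> ?S" by blast
  then show ?thesis by blast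
qed

text \<open>A lattice with the right invariant has the right g2 and g3 up to weighted scaling, so it
  remains to find \<open>l\<close> with l^4 a = g2 and l^6 b = g3.\<close>

theorem lattice_exists:
  assumes "g2 ^ 3 - 27 * g3\<^sup>2 \<noteq> 0"
  obtains L where "is_lattice L" "g2 = 60 * eisenstein_sum 4 L" "g3 = 140 * eisenstein_sum 6 L"
proof -
  obtain \<tau> where t: "Im \<tau> > 0" "j_inv \<tau> = g2 ^ 3 / (g2 ^ 3 - 27 * g3\<^sup>2)"
    using j_inv_surj by blast
  define a b where "a = 60 * eisenstein_sum 4 (std_lattice \<tau>)" and "b = 140 * eisenstein_sum 6 (std_lattice \<tau>)"
  have L: "is_lattice (std_lattice \<tau>)" using t by (intro is_lattice_std) auto
  have D: "a ^ 3 - 27 * b\<^sup>2 \<noteq> 0"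
    using disc_std(1)[of \<tau>] t(1) by (simp add: disc_def a_def b_def)
  have "a ^ 3 / (a ^ 3 - 27 * b\<^sup>2) = g2 ^ 3 / (g2 ^ 3 - 27 * g3\<^sup>2)"
    using t(2) by (simp add: j_inv_def disc_def a_def b_def)
  then have "a ^ 3 * (g2 ^ 3 - 27 * g3\<^sup>2) = g2 ^ 3 * (a ^ 3 - 27 * b\<^sup>2)"
    using D assms by (simp add: frac_eq_eq)
  then have e: "a ^ 3 * g3\<^sup>2 = g2 ^ 3 * b\<^sup>2" by (simp add: algebra_simps)
  have "\<exists>l. l \<noteq> 0 \<and> l ^ 4 * a = g2 \<and> l ^ 6 * b = g3"
  proof (cases "g2 = 0")
    case True
    then have g3: "g3 \<noteq> 0" using assms by auto
    then have a: "a = 0" using e True by simp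
    then have b: "b \<noteq> 0" using D by auto
    obtain l where "g3 / b = l ^ 6" using exists_complex_root[of 6 "g3 / b"] by auto
    then have "l ^ 6 * b = g3" using b by (simp add: field_simps)
    moreover have "l \<noteq> 0" using \<open>g3 / b = l ^ 6\<close> g3 b by auto
    ultimately show ?thesis using True a by auto
  next
    case False
    have a: "a \<noteq> 0"
    proof
      assume "a = 0"
      then have "b = 0" using e False by simp
      then show False using D \<open>a = 0\<close> by simp
    qed
    obtain l where l: "g2 / a = l ^ 4" using exists_complex_root[of 4 "g2 / a"] by auto
    then have l4: "l ^ 4 * a = g2" using a by (simp add: field_simps)
    have l0: "l \<noteq> 0" using l a False by auto
    have "a ^ 3 * g3\<^sup>2 = a ^ 3 * (l ^ 6 * b)\<^sup>2" using e unfolding l4[symmetric] by algebra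
    then have "g3\<^sup>2 = (l ^ 6 * b)\<^sup>2" using a by simp
    then consider "l ^ 6 * b = g3" | "l ^ 6 * b = - g3" by (metis power2_eq_iff)
    then show ?thesis
    proof cases
      case 1
      then show ?thesis using l0 l4 by blast
    next
      case 2
      \<comment> \<open>The invariant and g2 determine only the square of g3. A wrong sign is
        repaired by the factor i, since i^4 = 1 and i^6 = -1.\<close>
      have "(\<i> * l) ^ 4 = l ^ 4" "(\<i> * l) ^ 6 = - (l ^ 6)"
        using i_squared[unfolded power2_eq_square] by algebra+
      then have "(\<i> * l) ^ 4 * a = g2" "(\<i> * l) ^ 6 * b = g3" using l4 2 by simp_all
      moreover have "\<i> * l \<noteq> 0" using l0 by simp
      ultimately show ?thesis by blast
    qed
  qed
  then obtain l where l: "l \<noteq> 0" "l ^ 4 * a = g2" "l ^ 6 * b = g3" by blast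
  have inv: "1 / l \<noteq> 0" using l by simp
  show ?thesis
  proof (rule that)
    show "is_lattice ((*) (1 / l) ` std_lattice \<tau>)" by (rule is_lattice_scale[OF L inv])
    show "g2 = 60 * eisenstein_sum 4 ((*) (1 / l) ` std_lattice \<tau>)"
      unfolding eisenstein_sum_scale[OF inv] using l by (simp add: a_def power_divide field_simps)
    show "g3 = 140 * eisenstein_sum 6 ((*) (1 / l) ` std_lattice \<tau>)"
      unfolding eisenstein_sum_scale[OF inv] using l by (simp add: b_def power_divide field_simps)
  qed
qed

theorem period_lattice_invariants:
  assumes "g2 ^ 3 - 27 * g3\<^sup>2 \<noteq> 0"
  shows "is_lattice (period_lattice g2 g3)" "60 * eisenstein_sum 4 (period_lattice g2 g3) = g2"
    "140 * eisenstein_sum 6 (period_lattice g2 g3) = g3"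
proof -
  let ?P = "\<lambda>L. is_lattice L \<and> g2 = 60 * eisenstein_sum 4 L \<and> g3 = 140 * eisenstein_sum 6 L"
  obtain L where L: "?P L"
    using lattice_exists[OF assms] by metis
  have "?P (period_lattice g2 g3)"
    unfolding period_lattice_def
    by (rule theI[of ?P L]) (use L lattice_unique in auto)
  then show "is_lattice (period_lattice g2 g3)" "60 * eisenstein_sum 4 (period_lattice g2 g3) = g2"
    "140 * eisenstein_sum 6 (period_lattice g2 g3) = g3" by auto
qed

lemma period_lattice_scale:
  assumes "g2 ^ 3 - 27 * g3\<^sup>2 \<noteq> 0" "c \<noteq> 0"
  shows "period_lattice (g2 / c ^ 4) (g3 / c ^ 6) = (*) c ` period_lattice g2 g3"
proof -
  have c4: "(g2 / c ^ 4) ^ 3 = g2 ^ 3 / c ^ 12" by (simp add: power_divide flip: power_mult)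
  have c6: "27 * (g3 / c ^ 6)\<^sup>2 = 27 * g3\<^sup>2 / c ^ 12" by (simp add: power_divide flip: power_mult)
  have "(g2 / c ^ 4) ^ 3 - 27 * (g3 / c ^ 6)\<^sup>2 = (g2 ^ 3 - 27 * g3\<^sup>2) / c ^ 12"
    unfolding c4 c6 by (simp add: diff_divide_distrib)
  then have ne: "(g2 / c ^ 4) ^ 3 - 27 * (g3 / c ^ 6)\<^sup>2 \<noteq> 0" using assms by simp
  note p = period_lattice_invariants[OF assms(1)] and q = period_lattice_invariants[OF ne]
  show ?thesis
  proof (rule lattice_unique[OF q(1) is_lattice_scale[OF p(1) assms(2)]])
    show "60 * eisenstein_sum 4 (period_lattice (g2 / c ^ 4) (g3 / c ^ 6)) =
        60 * eisenstein_sum 4 ((*) c ` period_lattice g2 g3)"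
      unfolding q(2) eisenstein_sum_scale[OF assms(2)] using p(2) by simp
    show "140 * eisenstein_sum 6 (period_lattice (g2 / c ^ 4) (g3 / c ^ 6)) =
        140 * eisenstein_sum 6 ((*) c ` period_lattice g2 g3)"
      unfolding q(3) eisenstein_sum_scale[OF assms(2)] using p(3) by simp
  qed
qed

section \<open>The Somos-5 recurrence\<close>

text \<open>Each factor depends only on z / w, so scaling merely renames the index set; the leading
  factor \<open>z\<close> alone picks up \<open>c\<close>. The net of finite subsets is carried to
  that of the scaled lattice.\<close>

lemma sig_scale:
  assumes "lattice L" "c \<noteq> 0"
  shows "lattice.sig ((*) c ` L) (c * z) = c * lattice.sig L z"
proof -
  interpret A: lattice L by fact
  interpret B: lattice "(*) c ` L"
    using is_lattice_scale[OF A.is_lattice assms(2)] by unfold_locales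
  have inj: "inj_on ((*) c) X" for X using assms(2) by (auto intro: inj_onI)
  define R where "R = cmod z + 1"
  have R: "R > 0" "z \<in> ball 0 R" by (auto simp: R_def add_nonneg_pos)
  obtain l where l: "((\<lambda>F. \<Prod>w\<in>F. A.sig_factor w z) \<longlongrightarrow> l) (finite_subsets_at_top (L - {0}))"
    using A.sig_tendsto[OF R] by blast
  have "A.sig_factor (c * w) (c * z) = A.sig_factor w z" for w
    using assms(2) by (simp add: A.sig_factor_def power_mult_distrib)
  then have "(\<Prod>w\<in>(*) c ` F. A.sig_factor w (c * z)) = (\<Prod>w\<in>F. A.sig_factor w z)" for F
    by (simp add: prod.reindex[OF inj] o_def)
  then have "((\<lambda>F. \<Prod>w\<in>F. A.sig_factor w (c * z)) \<longlongrightarrow> l)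
      (filtermap ((`) ((*) c)) (finite_subsets_at_top (L - {0})))"
    using l by (simp add: filterlim_filtermap)
  also have "filtermap ((`) ((*) c)) (finite_subsets_at_top (L - {0})) = finite_subsets_at_top ((*) c ` (L - {0}))"
    by (rule filtermap_image_finite_subsets_at_top[OF inj])
  also have "(*) c ` (L - {0}) = (*) c ` L - {0}" using assms(2) by auto
  finally have m: "((\<lambda>F. \<Prod>w\<in>F. A.sig_factor w (c * z)) \<longlongrightarrow> l) (finite_subsets_at_top ((*) c ` L - {0}))" .
  show ?thesis
    unfolding A.sig_def B.sig_def
      tendsto_Lim[OF finite_subsets_at_top_neq_bot l] tendsto_Lim[OF finite_subsets_at_top_neq_bot m]
    by simp
qed

section \<open>The elliptic function behind the recurrence\<close>

context lattice
begin

context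
  fixes \<kappa> J \<mu> lam :: complex
  assumes \<kappa>: "\<kappa> \<notin> L" and lam: "wp \<kappa> = lam" and \<mu>: "wp' \<kappa> = \<mu>" "\<mu> \<noteq> 0"
    and J: "J = 6 * lam\<^sup>2 - 30 * G 4"
begin

text \<open>By \<open>wp'_deriv\<close> the assumption on \<open>J\<close> makes it the second
  derivative of \<open>wp\<close> at \<kappa>. The name refers to the Quispel-Roberts-Thompson maps:
  the curve in \<open>qrt_curve\<close> is symmetric and biquadratic.\<close>

definition qrt :: "complex \<Rightarrow> complex" where
  "qrt z = - \<mu> / sig (2 * \<kappa>) * (sig (z + 2 * \<kappa>) * sig (z - \<kappa>)) / (sig (z + \<kappa>) * sig z)"

lemma two_kappa: "2 * \<kappa> \<notin> L"
  using wp'_eq_0_iff[OF \<kappa>] \<mu> by simp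

lemma wp_ne_lam: "z \<notin> L \<Longrightarrow> z + \<kappa> \<notin> L \<Longrightarrow> z - \<kappa> \<notin> L \<Longrightarrow> wp z - lam \<noteq> 0"
  using wp_eq_iff[OF _ \<kappa>, of z] lam by simp

text \<open>\<open>zet3\<close> for the arguments z + \<kappa>, -z, -2\<kappa>, whose sum is
  -\<kappa>, turns the sigma quotient into a combination of zeta values; \<open>zet_add\<close> and
  \<open>wp_double_deriv\<close> replace these by \<open>wp\<close>, \<open>wp'\<close> and
  \<open>J\<close>.\<close>

lemma qrt_eq_aux:
  assumes z: "z \<notin> L" "z + \<kappa> \<notin> L" "z - \<kappa> \<notin> L"
  shows "qrt z = (J + (\<mu>\<^sup>2 - \<mu> * wp' z) / (wp z - lam)) / 2"
proof -
  define d where "d = zet (z + \<kappa>) - zet z - zet \<kappa>"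
  have nz: "sig z \<noteq> 0" "sig (z + \<kappa>) \<noteq> 0" "sig \<kappa> \<noteq> 0" "sig (2 * \<kappa>) \<noteq> 0"
    using z \<kappa> two_kappa by (simp_all add: sig_eq_0_iff)
  have X: "wp z - lam \<noteq> 0" by (rule wp_ne_lam[OF z])
  have "wp' z - \<mu> = 2 * (wp z - lam) * d"
    using zet_add[OF z(1) \<kappa> z(2)] by (simp only: lam \<mu> d_def)
  then have "\<mu>\<^sup>2 - \<mu> * wp' z = (wp z - lam) * (- 2 * \<mu> * d)" by algebra
  then have 1: "(\<mu>\<^sup>2 - \<mu> * wp' z) / (wp z - lam) = - 2 * \<mu> * d" using X by simp
  have JJ: "J = 2 * \<mu> * (zet (2 * \<kappa>) - 2 * zet \<kappa>)"
    using wp_double_deriv[OF \<kappa> two_kappa wp'_deriv[OF \<kappa>]] J by (simp only: lam \<mu>)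
  have L': "- z \<notin> L" "- (2 * \<kappa>) \<notin> L" "z + \<kappa> + - z + - (2 * \<kappa>) \<notin> L"
    using z two_kappa \<kappa> by simp_all
  have a: "z + \<kappa> + - z + - (2 * \<kappa>) = - \<kappa>" "- z + - (2 * \<kappa>) = - (z + 2 * \<kappa>)"
    "z + \<kappa> + - (2 * \<kappa>) = z - \<kappa>" "z + \<kappa> + - z = \<kappa>" by simp_all
  have "zet (z + \<kappa>) - zet z - zet (2 * \<kappa>) + zet \<kappa> =
      sig (z + 2 * \<kappa>) * (sig (z - \<kappa>) / (sig (z + \<kappa>) * sig z * sig (2 * \<kappa>)))"
    using zet3[OF z(2) L'] nz unfolding a zet_uminus sig_uminus by (simp add: zet_uminus sig_uminus)
  moreover have "J + - 2 * \<mu> * d = 2 * (- \<mu> * (zet (z + \<kappa>) - zet z - zet (2 * \<kappa>) + zet \<kappa>))"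
    unfolding JJ d_def by algebra
  then have "(J + - 2 * \<mu> * d) / 2 = - \<mu> * (zet (z + \<kappa>) - zet z - zet (2 * \<kappa>) + zet \<kappa>)"
    by simp
  ultimately show ?thesis unfolding 1 qrt_def by (simp add: mult_ac)
qed

lemma qrt_eq:
  assumes z: "z \<notin> L" "z + \<kappa> \<notin> L" "z - \<kappa> \<notin> L"
  shows "qrt z = (J + (\<mu>\<^sup>2 - \<mu> * wp' z) / (wp z - lam)) / 2"
    "qrt (z - \<kappa>) = (J + (\<mu>\<^sup>2 + \<mu> * wp' z) / (wp z - lam)) / 2"
proof -
  show "qrt z = (J + (\<mu>\<^sup>2 - \<mu> * wp' z) / (wp z - lam)) / 2" by (rule qrt_eq_aux[OF z])
  have "- (z - \<kappa>) \<notin> L" "- (z + \<kappa>) \<notin> L" using z by (simp_all only: uminus_mem_iff not_False_eq_True)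
  then have mz: "- z \<notin> L" "- z + \<kappa> \<notin> L" "- z - \<kappa> \<notin> L" using z by simp_all
  have e: "- z + 2 * \<kappa> = - (z - 2 * \<kappa>)" "- z - \<kappa> = - (z + \<kappa>)" "- z + \<kappa> = - (z - \<kappa>)"
    "z - \<kappa> + 2 * \<kappa> = z + \<kappa>" "z - \<kappa> - \<kappa> = z - 2 * \<kappa>" "z - \<kappa> + \<kappa> = z" by simp_all
  \<comment> \<open>Reflection exchanges the two formulas, and under it only the sign of
    \<open>wp'\<close> changes.\<close>
  have "qrt (- z) = qrt (z - \<kappa>)"
    unfolding qrt_def e sig_uminus by (simp add: mult_ac)
  then show "qrt (z - \<kappa>) = (J + (\<mu>\<^sup>2 + \<mu> * wp' z) / (wp z - lam)) / 2"
    using qrt_eq_aux[OF mz] by (simp add: wp_uminus wp'_uminus)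
qed

text \<open>The formula for lam solved for the coefficient \<alpha>; \<open>beta\<close> likewise
  comes from the formula for the fourth power of \<mu>.\<close>

definition alpha :: complex where "alpha = 3 * \<mu>\<^sup>2 * lam - J\<^sup>2 / 4"
definition beta :: complex where "beta = \<mu> ^ 4 - alpha * J"

text \<open>With X = wp(z) - lam, the two values have sum J + \<mu>^2 / X and product -alpha -
  \<mu>^2 X. Eliminating X yields the curve.\<close>

lemma qrt_curve:
  assumes z: "z \<notin> L" "z + \<kappa> \<notin> L" "z - \<kappa> \<notin> L"
  shows "qrt (z - \<kappa>) * qrt z * (qrt (z - \<kappa>) + qrt z - J) + alpha * (qrt (z - \<kappa>) + qrt z) + beta = 0"
    "qrt (z - \<kappa>) + qrt z = J + \<mu>\<^sup>2 / (wp z - lam)"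
proof -
  define X i where "X = wp z - lam" and "i = 1 / X"
  have X: "X \<noteq> 0" unfolding X_def by (rule wp_ne_lam[OF z])
  have Xi: "X * i = 1" using X by (simp add: i_def)
  define y where "y = wp' z"
  have ode: "y\<^sup>2 = 4 * (X + lam) ^ 3 - 60 * G 4 * (X + lam) - 140 * G 6"
    using wp_ode[OF z(1)] by (simp add: y_def X_def)
  have ode\<kappa>: "\<mu>\<^sup>2 = 4 * lam ^ 3 - 60 * G 4 * lam - 140 * G 6"
    using wp_ode[OF \<kappa>] by (simp only: \<mu> lam)
  \<comment> \<open>Subtracting the equation at \<kappa> removes \<open>G 6\<close>, and the linear
    coefficient 12 lam^2 - 60 \<open>G 4\<close> equals 2J.\<close>
  have y2: "y\<^sup>2 = 4 * X ^ 3 + 12 * lam * X\<^sup>2 + 2 * J * X + \<mu>\<^sup>2"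
    using ode ode\<kappa> J by algebra
  have w: "qrt z = (J + (\<mu>\<^sup>2 - \<mu> * y) * i) / 2" "qrt (z - \<kappa>) = (J + (\<mu>\<^sup>2 + \<mu> * y) * i) / 2"
    using qrt_eq[OF z] by (simp_all add: y_def X_def i_def)
  have sum: "qrt (z - \<kappa>) + qrt z = J + \<mu>\<^sup>2 * i"
    unfolding w by (simp add: field_simps)
  then show "qrt (z - \<kappa>) + qrt z = J + \<mu>\<^sup>2 / (wp z - lam)" by (simp add: i_def X_def)
  have "4 * (qrt (z - \<kappa>) * qrt z) = (J + \<mu>\<^sup>2 * i)\<^sup>2 - \<mu>\<^sup>2 * y\<^sup>2 * i\<^sup>2"
  proof -
    have half: "4 * (a / 2 * (b / 2)) = a * b" for a b :: complex by simp
    show ?thesis unfolding w half by algebra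
  qed
  also have "\<dots> = J\<^sup>2 - 4 * \<mu>\<^sup>2 * X - 12 * lam * \<mu>\<^sup>2"
    unfolding y2 using Xi by algebra
  finally have prod: "qrt (z - \<kappa>) * qrt z = - alpha - \<mu>\<^sup>2 * X"
    by (simp add: alpha_def field_simps)
  show "qrt (z - \<kappa>) * qrt z * (qrt (z - \<kappa>) + qrt z - J) + alpha * (qrt (z - \<kappa>) + qrt z) + beta = 0"
    unfolding prod sum beta_def using Xi by algebra
qed

text \<open>The values at \<open>z - \<kappa>\<close> and \<open>z + \<kappa>\<close> are the two roots of the same quadratic equation.\<close>

lemma qrt_map:
  assumes z: "z \<notin> L" "z + \<kappa> \<notin> L" "z - \<kappa> \<notin> L" "z + 2 * \<kappa> \<notin> L" "2 * z + \<kappa> \<notin> L"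
  shows "qrt (z + \<kappa>) * qrt z * qrt (z - \<kappa>) = alpha * qrt z + beta"
proof -
  define u w t where "u = qrt (z - \<kappa>)" and "w = qrt z" and "t = qrt (z + \<kappa>)"
  have z': "z + \<kappa> \<notin> L" "z + \<kappa> + \<kappa> \<notin> L" "z + \<kappa> - \<kappa> \<notin> L"
    using z by (simp_all add: add.assoc)
  note c1 = qrt_curve[OF z(1-3), folded u_def w_def]
  note c2 = qrt_curve[OF z', simplified add_diff_cancel_right', folded w_def t_def]
  have "z + \<kappa> + z \<notin> L" "z + \<kappa> - z \<notin> L" using z(5) \<kappa> by (simp_all add: algebra_simps)
  \<comment> \<open>If the two \<open>wp\<close> values agreed, the sums in \<open>qrt_curve\<close>
    would agree and the two neighbours would coincide; excluding 2z + \<kappa> from the lattice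
    prevents this.\<close>
  then have ne: "wp (z + \<kappa>) \<noteq> wp z" using wp_eq_iff[OF z(2,1)] by simp
  have X: "wp z - lam \<noteq> 0" "wp (z + \<kappa>) - lam \<noteq> 0" using wp_ne_lam z(1-3) z' by blast+
  have "t - u = (w + t) - (u + w)" by simp
  also have "\<dots> = \<mu>\<^sup>2 / (wp (z + \<kappa>) - lam) - \<mu>\<^sup>2 / (wp z - lam)"
    unfolding c1(2) c2(2) by simp
  also have "\<dots> \<noteq> 0" using ne X \<mu>(2) by (simp add: frac_eq_eq)
  finally have tu: "t - u \<noteq> 0" .
  have "(t - u) * (w * (t + u) + w\<^sup>2 - J * w + alpha) = 0"
    using c1(1) c2(1) by algebra
  then have "w * (t + u) + w\<^sup>2 - J * w + alpha = 0" using tu by simp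
  then have "t * w * u = alpha * w + beta" using c1(1) by algebra
  then show ?thesis by (simp only: t_def w_def u_def)
qed

text \<open>\<open>qrt_map\<close> with denominators cleared. Both sides are entire, so the identity
  extends across the points that \<open>qrt_map\<close> excludes.\<close>

lemma sig_somos5:
  defines "C \<equiv> - \<mu> / sig (2 * \<kappa>)"
  shows "C ^ 3 * sig (z + 3 * \<kappa>) * sig (z - 2 * \<kappa>)
    = alpha * C * sig (z + 2 * \<kappa>) * sig (z - \<kappa>) + beta * sig (z + \<kappa>) * sig z"
proof (rule eq_on_open_if_eq_off_countable[of UNIV
      "\<lambda>z. C ^ 3 * sig (z + 3 * \<kappa>) * sig (z - 2 * \<kappa>)"
      "\<lambda>z. alpha * C * sig (z + 2 * \<kappa>) * sig (z - \<kappa>) + beta * sig (z + \<kappa>) * sig z"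
      "L \<union> {z. z + \<kappa> \<in> L} \<union> {z. z + (- \<kappa>) \<in> L} \<union> {z. z + 2 * \<kappa> \<in> L} \<union> (\<lambda>z. (z - \<kappa>) / 2) ` L"])
  fix z assume z: "z \<notin> L \<union> {z. z + \<kappa> \<in> L} \<union> {z. z + (- \<kappa>) \<in> L} \<union> {z. z + 2 * \<kappa> \<in> L} \<union> (\<lambda>z. (z - \<kappa>) / 2) ` L"
  have "2 * z + \<kappa> \<notin> L"
  proof
    assume "2 * z + \<kappa> \<in> L"
    then have "z \<in> (\<lambda>z. (z - \<kappa>) / 2) ` L" by (intro image_eqI[of _ _ "2 * z + \<kappa>"]) auto
    then show False using z by blast
  qed
  then have zz: "z \<notin> L" "z + \<kappa> \<notin> L" "z - \<kappa> \<notin> L" "z + 2 * \<kappa> \<notin> L" "2 * z + \<kappa> \<notin> L" using z by auto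
  have nz: "sig z \<noteq> 0" "sig (z + \<kappa>) \<noteq> 0" "sig (z - \<kappa>) \<noteq> 0" "sig (z + 2 * \<kappa>) \<noteq> 0"
    using zz by (simp_all add: sig_eq_0_iff)
  have e: "z + \<kappa> + 2 * \<kappa> = z + 3 * \<kappa>" "z + \<kappa> - \<kappa> = z" "z + \<kappa> + \<kappa> = z + 2 * \<kappa>"
    "z - \<kappa> + 2 * \<kappa> = z + \<kappa>" "z - \<kappa> - \<kappa> = z - 2 * \<kappa>" "z - \<kappa> + \<kappa> = z" by simp_all
  have "qrt (z + \<kappa>) * qrt z * qrt (z - \<kappa>) = C ^ 3 * sig (z + 3 * \<kappa>) * sig (z - 2 * \<kappa>) / (sig (z + \<kappa>) * sig z)"
    unfolding qrt_def e C_def[symmetric] using nz by (simp add: power3_eq_cube)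
  moreover have "alpha * qrt z + beta =
      (alpha * C * sig (z + 2 * \<kappa>) * sig (z - \<kappa>) + beta * sig (z + \<kappa>) * sig z) / (sig (z + \<kappa>) * sig z)"
    unfolding qrt_def C_def[symmetric] using nz by (simp add: add_divide_distrib)
  ultimately show "C ^ 3 * sig (z + 3 * \<kappa>) * sig (z - 2 * \<kappa>)
    = alpha * C * sig (z + 2 * \<kappa>) * sig (z - \<kappa>) + beta * sig (z + \<kappa>) * sig z"
    using qrt_map[OF zz] nz by simp
next
  show "countable (L \<union> {z. z + \<kappa> \<in> L} \<union> {z. z + (- \<kappa>) \<in> L} \<union> {z. z + 2 * \<kappa> \<in> L} \<union> (\<lambda>z. (z - \<kappa>) / 2) ` L)"
    by (intro countable_Un countable_translate countable_image countable_L)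
qed (auto intro!: continuous_intros)

end

end

text \<open>Windows of five consecutive values are propagated in both directions. Division is by
  values of \<tau> only, so \<open>\<tau>'\<close> may be a sigma sequence about whose zeros nothing
  is known yet.\<close>

lemma somos5_unique:
  fixes \<tau> \<tau>' :: "int \<Rightarrow> complex"
  assumes nz: "\<And>n. \<tau> n \<noteq> 0"
    and r: "\<And>n. \<tau> (n + 3) * \<tau> (n - 2) = \<alpha> * \<tau> (n + 2) * \<tau> (n - 1) + \<beta> * \<tau> (n + 1) * \<tau> n"
    and r': "\<And>n. \<tau>' (n + 3) * \<tau>' (n - 2) = \<alpha> * \<tau>' (n + 2) * \<tau>' (n - 1) + \<beta> * \<tau>' (n + 1) * \<tau>' n"
    and init: "\<tau>' (-2) = \<tau> (-2)" "\<tau>' (-1) = \<tau> (-1)" "\<tau>' 0 = \<tau> 0" "\<tau>' 1 = \<tau> 1" "\<tau>' 2 = \<tau> 2"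
  shows "\<tau>' n = \<tau> n"
proof -
  let ?P = "\<lambda>n. \<tau>' (n - 2) = \<tau> (n - 2) \<and> \<tau>' (n - 1) = \<tau> (n - 1) \<and> \<tau>' n = \<tau> n \<and>
     \<tau>' (n + 1) = \<tau> (n + 1) \<and> \<tau>' (n + 2) = \<tau> (n + 2)"
  have "?P n"
  proof (induction n rule: int_induct[where k = 0])
    case base
    then show ?case using init by simp
  next
    case (step1 i)
    have "\<tau>' (i + 3) * \<tau> (i - 2) = \<tau> (i + 3) * \<tau> (i - 2)"
      using r[of i] r'[of i] step1 by simp
    then have "\<tau>' (i + 3) = \<tau> (i + 3)" using nz by simp
    moreover have "i + 1 - 2 = i - 1" "i + 1 - 1 = i" "i + 1 + 1 = i + 2" "i + 1 + 2 = i + 3" by simp_all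
    ultimately show ?case using step1(2) by (simp only: simp_thms)
  next
    case (step2 i)
    have e: "i - 1 + 3 = i + 2" "i - 1 - 2 = i - 3" "i - 1 + 2 = i + 1" "i - 1 - 1 = i - 2" "i - 1 + 1 = i" by simp_all
    have "\<tau> (i + 2) * \<tau>' (i - 3) = \<tau> (i + 2) * \<tau> (i - 3)"
      using r[of "i - 1"] r'[of "i - 1"] step2(2) unfolding e by simp
    then have "\<tau>' (i - 3) = \<tau> (i - 3)" using nz by simp
    then show ?case using step2(2) unfolding e by (simp only: simp_thms)
  qed
  then show ?thesis by blast
qed

text \<open>The growth factors \<open>S * s\<close> and \<open>-s\<close> are chosen so that \<open>r (n + 2) = r n * s * C\<^sup>n\<close> for all
  \<open>n\<close>, where \<open>\<tau> = r T\<close>; such a gauge turns a solution of the equation with coefficients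
  \<open>\<alpha>/C\<^sup>2, \<beta>/C\<^sup>3\<close> into one with coefficients \<open>\<alpha>, \<beta>\<close>.\<close>

lemma somos5_gauge:
  fixes \<tau> T :: "int \<Rightarrow> complex" and S :: complex
  defines "s \<equiv> (\<tau> 2 / T 2) / (\<tau> 0 / T 0)" and "C \<equiv> - 1 / S"
  assumes S: "S \<noteq> 0"
    and nz: "\<And>n. \<tau> n \<noteq> 0"
    and r: "\<And>n. \<tau> (n + 3) * \<tau> (n - 2) = \<alpha> * \<tau> (n + 2) * \<tau> (n - 1) + \<beta> * \<tau> (n + 1) * \<tau> n"
    and T: "\<And>n. C ^ 3 * T (n + 3) * T (n - 2) = \<alpha> * C * T (n + 2) * T (n - 1) + \<beta> * T (n + 1) * T n"
    and Tnz: "T (-2) \<noteq> 0" "T (-1) \<noteq> 0" "T 0 \<noteq> 0" "T 1 \<noteq> 0" "T 2 \<noteq> 0"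
    and h0: "\<tau> 2 * \<tau> (-1) / (\<tau> 1 * \<tau> 0) = C * (T 2 * T (-1)) / (T 1 * T 0)"
    and h1: "\<tau> 1 * \<tau> (-2) / (\<tau> 0 * \<tau> (-1)) = C * (T 1 * T (-2)) / (T 0 * T (-1))"
  shows "\<tau> k = (if even k then (\<tau> 0 / T 0) * (S * s) powi (k div 2) else (\<tau> 1 / T 1) * (- s) powi (k div 2))
           * T k / S powi (k div 2)\<^sup>2"
proof -
  define r where "r k = (if even k then (\<tau> 0 / T 0) * (S * s) powi (k div 2) else (\<tau> 1 / T 1) * (- s) powi (k div 2))
      / S powi (k div 2)\<^sup>2" for k :: int
  have C: "C \<noteq> 0" "S * C = - 1" using S by (simp_all add: C_def)
  have s: "s \<noteq> 0" using nz Tnz by (simp add: s_def)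
  have step: "r (n + 2) = r n * s * C powi n" for n
  proof -
    \<comment> \<open>\<open>div\<close> rounds down, so n is 2k or 2k + 1 for negative n too. The
      increment 2k + 1 of the squared exponent produces C^n: for even n the surplus \<open>S\<close>
      is absorbed by the growth factor, for odd n it supplies one more \<open>C\<close>.\<close>
    define k where "k = n div 2"
    have sq: "(k + 1)\<^sup>2 = k\<^sup>2 + (2 * k + 1)" by (simp add: power2_eq_square algebra_simps)
    have Ssq: "S powi (k + 1)\<^sup>2 = S powi k\<^sup>2 * (S powi (2 * k) * S)"
      unfolding sq using S by (simp add: power_int_add)
    have C2: "C powi (2 * k) = 1 / S powi (2 * k)"
      by (simp add: C_def power_int_mult power_divide power_int_divide_distrib)
    have Spos: "S powi k\<^sup>2 \<noteq> 0" "S powi (2 * k) \<noteq> 0" using S by simp_all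
    show ?thesis
    proof (cases "even n")
      case True
      then have n: "n = 2 * k" by (simp add: k_def)
      have "r (n + 2) = (\<tau> 0 / T 0) * ((S * s) powi k * (S * s)) / (S powi k\<^sup>2 * (S powi (2 * k) * S))"
        unfolding r_def n using S s Ssq by (simp add: power_int_add)
      also have "\<dots> = r n * s * (1 / S powi (2 * k))"
        unfolding r_def n using S Spos by (simp add: mult.assoc)
      finally show ?thesis unfolding n C2 .
    next
      case False
      then have n: "n = 2 * k + 1" by (simp add: k_def)
      have d: "(2 * k + 1 + 2) div 2 = k + 1" "(2 * k + 1) div 2 = k" by simp_all
      have "r (n + 2) = (\<tau> 1 / T 1) * ((- s) powi k * (- s)) / (S powi k\<^sup>2 * (S powi (2 * k) * S))"
        unfolding r_def n d using S s Ssq by (simp add: power_int_add)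
      also have "\<dots> = r n * s * (1 / S powi (2 * k) * C)"
        unfolding r_def n d C_def using S Spos by (simp add: mult.assoc)
      also have "1 / S powi (2 * k) * C = C powi n"
        unfolding n C2[symmetric] using C by (simp add: power_int_add)
      finally show ?thesis .
    qed
  qed
  have rr: "r (n + 2) * r (n - 1) = C * r (n + 1) * r n" "r (n + 3) * r (n - 2) = C ^ 3 * r (n + 1) * r n" for n
  proof -
    have p: "C powi n = C powi (n - 1) * C" "C powi (n + 1) = C powi (n - 2) * C ^ 3"
      using C power_int_add[of C "n - 1" 1] power_int_add[of C "n - 2" 3] by (simp_all add: add.commute)
    have 1: "r (n + 1) = r (n - 1) * s * C powi (n - 1)" using step[of "n - 1"] by (simp add: add.commute)
    have 2: "r (n + 3) = r (n + 1) * s * C powi (n + 1)" using step[of "n + 1"] by (simp add: add.commute)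
    have 3: "r n = r (n - 2) * s * C powi (n - 2)" using step[of "n - 2"] by simp
    show "r (n + 2) * r (n - 1) = C * r (n + 1) * r n"
      unfolding step[of n] 1 p(1) by (simp add: mult_ac)
    show "r (n + 3) * r (n - 2) = C ^ 3 * r (n + 1) * r n"
      unfolding 2 p(2) by (subst 3) (simp add: mult_ac)
  qed
  define \<tau>' where "\<tau>' n = r n * T n" for n
  have r': "\<tau>' (n + 3) * \<tau>' (n - 2) = \<alpha> * \<tau>' (n + 2) * \<tau>' (n - 1) + \<beta> * \<tau>' (n + 1) * \<tau>' n" for n
  proof -
    have "\<tau>' (n + 3) * \<tau>' (n - 2) = r (n + 3) * r (n - 2) * (T (n + 3) * T (n - 2))"
      by (simp add: \<tau>'_def mult_ac)
    also have "\<dots> = r (n + 1) * r n * (C ^ 3 * T (n + 3) * T (n - 2))"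
      unfolding rr by (simp add: mult_ac)
    also have "\<dots> = \<alpha> * (C * r (n + 1) * r n) * (T (n + 2) * T (n - 1)) + \<beta> * (r (n + 1) * r n) * (T (n + 1) * T n)"
      unfolding T by (simp add: algebra_simps)
    also have "\<dots> = \<alpha> * \<tau>' (n + 2) * \<tau>' (n - 1) + \<beta> * \<tau>' (n + 1) * \<tau>' n"
      unfolding rr(1)[symmetric] by (simp add: \<tau>'_def mult_ac)
    finally show ?thesis .
  qed
  \<comment> \<open>The five starting values: indices 0 and 1 agree by the normalization, 2 by the
    choice of \<open>s\<close>, and -1 and -2 through the prescribed ratios \<open>h0\<close> and
    \<open>h1\<close>.\<close>
  have i0: "\<tau>' 0 = \<tau> 0" "\<tau>' 1 = \<tau> 1" using Tnz by (simp_all add: \<tau>'_def r_def)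
  have i2: "\<tau>' 2 = \<tau> 2"
    using step[of 0] Tnz nz[of 0] by (simp add: \<tau>'_def r_def s_def)
  have rel0: "\<tau>' 2 * \<tau>' (-1) = C * (T 2 * T (-1)) / (T 1 * T 0) * (\<tau>' 1 * \<tau>' 0)"
    using rr(1)[of 0] Tnz by (simp add: \<tau>'_def)
  have "\<tau> 2 * \<tau> (-1) = C * (T 2 * T (-1)) / (T 1 * T 0) * (\<tau> 1 * \<tau> 0)"
    unfolding h0[symmetric] using nz by simp
  then have "\<tau> 2 * \<tau>' (-1) = \<tau> 2 * \<tau> (-1)"
    using rel0 unfolding i0 i2 by (simp only:)
  then have i1: "\<tau>' (-1) = \<tau> (-1)" using nz[of 2] by simp
  have "\<tau>' 1 * \<tau>' (-2) = C * (T 1 * T (-2)) / (T 0 * T (-1)) * (\<tau>' 0 * \<tau>' (-1))"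
    using rr(1)[of "-1"] Tnz by (simp add: \<tau>'_def)
  moreover have "\<tau> 1 * \<tau> (-2) = C * (T 1 * T (-2)) / (T 0 * T (-1)) * (\<tau> 0 * \<tau> (-1))"
    unfolding h1[symmetric] using nz by simp
  ultimately have "\<tau> 1 * \<tau>' (-2) = \<tau> 1 * \<tau> (-2)"
    unfolding i0 i1 by (simp only:)
  then have i_2: "\<tau>' (-2) = \<tau> (-2)" using nz[of 1] by simp
  have "\<tau>' k = \<tau> k"
    by (rule somos5_unique[OF nz assms(5) r' i_2 i1 i0 i2])
  then show ?thesis by (simp add: \<tau>'_def r_def)
qed

section \<open>Matching a given solution with its sigma function\<close>

theorem theorem2p9:
  fixes \<alpha> \<beta> J \<mu> lam g\<^sub>2 g\<^sub>3 x\<^sub>0 \<kappa> z\<^sub>0 g\<^sub>2' g\<^sub>3' u\<^sub>0 v Ap Am Bp Bm :: complex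
    and \<tau> h :: "int \<Rightarrow> complex"
    and P \<sigma> :: "complex \<Rightarrow> complex"
  assumes "\<And>n. \<tau> n \<noteq> 0"
    and "\<And>n. \<tau> (n + 3) * \<tau> (n - 2) = \<alpha> * \<tau> (n + 2) * \<tau> (n - 1) + \<beta> * \<tau> (n + 1) * \<tau> n"
    and "\<And>n. h n = \<tau> (n + 2) * \<tau> (n - 1) / (\<tau> (n + 1) * \<tau> n)"
    and "J = h (-1) + h 0 + \<alpha> * (1 / h (-1) + 1 / h 0) + \<beta> / (h (-1) * h 0)"
    and "\<mu> ^ 4 = \<beta> + \<alpha> * J"
    and "\<mu> \<noteq> 0"
    and "lam = 1 / (3 * \<mu>\<^sup>2) * (J\<^sup>2 / 4 + \<alpha>)"
    and "g\<^sub>2 = 12 * lam\<^sup>2 - 2 * J"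
    and "g\<^sub>3 = 4 * lam ^ 3 - g\<^sub>2 * lam - \<mu>\<^sup>2"
    and "g\<^sub>2 ^ 3 - 27 * g\<^sub>3\<^sup>2 \<noteq> 0"
    and "h (-1) + h 0 - J \<noteq> 0"
    and "x\<^sub>0 = lam + \<mu>\<^sup>2 / (h (-1) + h 0 - J)"
    and "P = weierstrass_p g\<^sub>2 g\<^sub>3"
    and "\<kappa> \<notin> period_lattice g\<^sub>2 g\<^sub>3"
    and "P \<kappa> = lam"
    and "deriv P \<kappa> = \<mu>"
    and "z\<^sub>0 \<notin> period_lattice g\<^sub>2 g\<^sub>3"
    and "P z\<^sub>0 = x\<^sub>0"
    and "deriv P \<kappa> * deriv P z\<^sub>0 = (x\<^sub>0 - lam) * (h (-1) - h 0)"
    and "g\<^sub>2' = \<mu> ^ 4 * g\<^sub>2"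
    and "g\<^sub>3' = \<mu> ^ 6 * g\<^sub>3"
    and "u\<^sub>0 = z\<^sub>0 / \<mu>"
    and "v = \<kappa> / \<mu>"
    and "\<sigma> = weierstrass_sigma g\<^sub>2' g\<^sub>3'"
    and "Ap = \<tau> 0 / \<sigma> u\<^sub>0"
    and "Am = \<tau> 1 / \<sigma> (u\<^sub>0 + v)"
    and "Bp = \<sigma> (2 * v) * \<sigma> u\<^sub>0 * \<tau> 2 / (\<sigma> (u\<^sub>0 + 2 * v) * \<tau> 0)"
    and "Bm = \<sigma> (2 * v) * \<sigma> (u\<^sub>0 + v) * \<tau> 3 / (\<sigma> (u\<^sub>0 + 3 * v) * \<tau> 1)"
  shows "(\<forall>n. \<tau> (2 * n) =
              Ap * Bp powi n * \<sigma> (u\<^sub>0 + 2 * of_int n * v) / \<sigma> (2 * v) powi n\<^sup>2 \<and>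
            \<tau> (2 * n + 1) =
              Am * Bm powi n * \<sigma> (u\<^sub>0 + (2 * of_int n + 1) * v) / \<sigma> (2 * v) powi n\<^sup>2)
         \<and> Bp / Bm = - \<sigma> (2 * v)
         \<and> \<tau> = somos5_sigma_sequence g\<^sub>2' g\<^sub>3' u\<^sub>0 v Ap Am Bp"
proof -
  note \<tau>_nz = assms(1) and somos = assms(2) and h = assms(3)
  define L where "L = period_lattice g\<^sub>2 g\<^sub>3"
  note PL = period_lattice_invariants[OF assms(10), folded L_def]
  interpret lattice L using PL(1) by unfold_locales
  have P: "P = wp"
    unfolding assms(13) by (rule ext) (simp only: weierstrass_p_def wp_def L_def[symmetric])
  have G: "60 * G 4 = g\<^sub>2" using PL(2) by (simp add: G_def)
  have kL: "\<kappa> \<notin> L" and zL: "z\<^sub>0 \<notin> L" using assms(14,17) by (simp_all add: L_def)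
  have dP: "deriv P z = wp' z" if "z \<notin> L" for z
    unfolding P using wp_deriv[OF that] by (rule DERIV_imp_deriv)
  have lam: "wp \<kappa> = lam" using assms(15) by (simp add: P)
  have \<mu>: "wp' \<kappa> = \<mu>" using assms(16) dP[OF kL] by simp
  note \<mu>0 = assms(6)
  \<comment> \<open>The formula for g2 encodes J = 6 lam^2 - g2 / 2, the second derivative of \<wp>
    at \<kappa>.\<close>
  have J: "J = 6 * lam\<^sup>2 - 30 * G 4"
  proof -
    have "j = 6 * l - 30 * x" if "60 * x = y" "y = 12 * l - 2 * j" for j l x y :: complex
    proof -
      have "2 * j = 12 * l - 60 * x" using that by (simp add: eq_diff_eq add.commute)
      then have "j = (12 * l - 60 * x) / 2" by (simp add: mult.commute)
      then show ?thesis by (simp add: diff_divide_distrib)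
    qed
    from this[OF G assms(8)] show ?thesis .
  qed
  note cs = kL lam \<mu> \<mu>0 J
  have alpha: "alpha J \<mu> lam = \<alpha>"
  proof -
    have "3 * \<mu>\<^sup>2 * lam = J\<^sup>2 / 4 + \<alpha>" using assms(7) \<mu>0 by simp
    then show ?thesis using alpha_def[OF cs] by simp
  qed
  have beta: "beta J \<mu> lam = \<beta>"
    using beta_def[OF cs] alpha assms(5) by simp

  define h\<^sub>m h\<^sub>0 where "h\<^sub>m = h (-1)" and "h\<^sub>0 = h 0"
  define X where "X = x\<^sub>0 - lam"
  define S where "S = h\<^sub>m + h\<^sub>0 - J"
  have S0: "S \<noteq> 0" using assms(11) by (simp add: S_def h\<^sub>m_def h\<^sub>0_def)
  have XS: "X = \<mu>\<^sup>2 / S" using assms(12) by (simp add: X_def S_def h\<^sub>m_def h\<^sub>0_def)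
  then have X0: "X \<noteq> 0" using \<mu>0 S0 by simp
  have X: "wp z\<^sub>0 - lam = X" using assms(18) by (simp add: P X_def)
  then have "wp z\<^sub>0 \<noteq> wp \<kappa>" using X0 lam by auto
  \<comment> \<open>\<open>z\<^sub>0\<close> is congruent neither to \<kappa> nor to -\<kappa>, so
    the formulas for R apply at it.\<close>
  then have zk: "z\<^sub>0 + \<kappa> \<notin> L" "z\<^sub>0 - \<kappa> \<notin> L" using wp_eq_iff[OF zL kL] by blast+
  have SX: "S = \<mu>\<^sup>2 / X" using XS S0 \<mu>0 by simp
  have "\<mu> * wp' z\<^sub>0 = X * (h\<^sub>m - h\<^sub>0)"
    using assms(19) dP[OF kL] dP[OF zL] by (simp add: \<mu> X_def h\<^sub>m_def h\<^sub>0_def)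
  then have diff: "h\<^sub>m - h\<^sub>0 = \<mu> * wp' z\<^sub>0 / X" using X0 by simp
  \<comment> \<open>The definition of \<open>x\<^sub>0\<close> prescribes the sum of the two ratios
    and the condition on the derivative at \<open>z\<^sub>0\<close> their difference, so each ratio
    is determined.\<close>
  have "h\<^sub>0 = (J + S - (h\<^sub>m - h\<^sub>0)) / 2" "h\<^sub>m = (J + S + (h\<^sub>m - h\<^sub>0)) / 2"
    by (simp_all add: S_def)
  then have h_eq: "h\<^sub>0 = (J + (\<mu>\<^sup>2 - \<mu> * wp' z\<^sub>0) / X) / 2" "h\<^sub>m = (J + (\<mu>\<^sup>2 + \<mu> * wp' z\<^sub>0) / X) / 2"
    unfolding diff SX by (simp_all add: add_divide_distrib diff_divide_distrib)
  have h_qrt: "h\<^sub>0 = qrt \<kappa> \<mu> z\<^sub>0" "h\<^sub>m = qrt \<kappa> \<mu> (z\<^sub>0 - \<kappa>)"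
    using qrt_eq[OF cs zL zk] unfolding X h_eq by simp_all

  have lat: "lattice L" by (rule lattice_axioms)
  \<comment> \<open>The starred curve has the lattice scaled by 1 / \<mu>; in its sigma function the
    constant -\<mu> / sig(2\<kappa>) becomes -1 / \<sigma>(2v).\<close>
  have sig_eq: "\<sigma> u = sig (\<mu> * u) / \<mu>" for u
  proof -
    have inv: "1 / \<mu> \<noteq> 0" using \<mu>0 by simp
    interpret B: lattice "(*) (1 / \<mu>) ` L"
      using is_lattice_scale[OF PL(1) inv] by unfold_locales
    have "period_lattice g\<^sub>2' g\<^sub>3' = (*) (1 / \<mu>) ` L"
      using period_lattice_scale[OF assms(10) inv] assms(20,21) \<mu>0
      by (simp add: L_def power_divide mult.commute)
    then have "\<sigma> u = B.sig u"
      unfolding assms(24) weierstrass_sigma_def B.sig_def by (simp add: sig_factor_def[abs_def])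
    also have "u = 1 / \<mu> * (\<mu> * u)" using \<mu>0 by simp
    also have "B.sig (1 / \<mu> * (\<mu> * u)) = 1 / \<mu> * sig (\<mu> * u)" by (rule sig_scale[OF lat inv])
    finally show ?thesis using \<mu>0 by simp
  qed
  define T where "T n = \<sigma> (u\<^sub>0 + of_int n * v)" for n :: int
  have T: "T n = sig (z\<^sub>0 + of_int n * \<kappa>) / \<mu>" for n
    unfolding T_def sig_eq assms(22,23) using \<mu>0 by (simp add: algebra_simps)
  define S2 where "S2 = \<sigma> (2 * v)"
  have S2: "S2 = sig (2 * \<kappa>) / \<mu>" unfolding S2_def sig_eq assms(23) using \<mu>0 by simp
  have S2_0: "S2 \<noteq> 0" unfolding S2 using two_kappa[OF cs] \<mu>0 by (simp add: sig_eq_0_iff)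
  have C: "- 1 / S2 = - \<mu> / sig (2 * \<kappa>)" by (simp add: S2)
  have h_T: "h\<^sub>0 = (- 1 / S2) * (T 2 * T (-1)) / (T 1 * T 0)" "h\<^sub>m = (- 1 / S2) * (T 1 * T (-2)) / (T 0 * T (-1))"
    unfolding h_qrt qrt_def[OF cs] C T using \<mu>0 by (simp_all add: algebra_simps)
  have h_tau: "h\<^sub>0 = \<tau> 2 * \<tau> (-1) / (\<tau> 1 * \<tau> 0)" "h\<^sub>m = \<tau> 1 * \<tau> (-2) / (\<tau> 0 * \<tau> (-1))"
    unfolding h\<^sub>m_def h\<^sub>0_def h by simp_all
  then have "h\<^sub>0 \<noteq> 0" "h\<^sub>m \<noteq> 0" using \<tau>_nz by simp_all
  \<comment> \<open>Because x / 0 = 0, a nonzero ratio excludes zeros in its denominator as well as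
    in its numerator; the two ratios together involve all five starting points.\<close>
  then have T_nz: "T (-2) \<noteq> 0" "T (-1) \<noteq> 0" "T 0 \<noteq> 0" "T 1 \<noteq> 0" "T 2 \<noteq> 0"
    unfolding h_T by auto
  have T_somos: "(- 1 / S2) ^ 3 * T (n + 3) * T (n - 2)
      = \<alpha> * (- 1 / S2) * T (n + 2) * T (n - 1) + \<beta> * T (n + 1) * T n" for n
  proof -
    define z where "z = z\<^sub>0 + of_int n * \<kappa>"
    have e: "T (n + 3) = sig (z + 3 * \<kappa>) / \<mu>" "T (n - 2) = sig (z - 2 * \<kappa>) / \<mu>" "T (n + 2) = sig (z + 2 * \<kappa>) / \<mu>"
      "T (n - 1) = sig (z - \<kappa>) / \<mu>" "T (n + 1) = sig (z + \<kappa>) / \<mu>" "T n = sig z / \<mu>"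
      unfolding T z_def by (simp_all add: algebra_simps)
    have gen: "D * (a / m) * (b / m) = x * (c / m) * (d / m) + y * (p / m) * (q / m)"
      if "D * a * b = x * c * d + y * p * q" for D a b c d p q x y m :: complex
    proof -
      have "D * (a / m) * (b / m) = (D * a * b) / (m * m)" by simp
      also have "\<dots> = x * (c / m) * (d / m) + y * (p / m) * (q / m)"
        unfolding that by (simp add: add_divide_distrib)
      finally show ?thesis .
    qed
    show ?thesis
      using gen[OF sig_somos5[OF cs, of z]] unfolding alpha beta C e .
  qed
  define s where "s = (\<tau> 2 / T 2) / (\<tau> 0 / T 0)"
  have s0: "s \<noteq> 0" using \<tau>_nz T_nz by (simp add: s_def)
  have main: "\<tau> k = (if even k then (\<tau> 0 / T 0) * (S2 * s) powi (k div 2) else (\<tau> 1 / T 1) * (- s) powi (k div 2))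
           * T k / S2 powi (k div 2)\<^sup>2" for k
    unfolding s_def
    by (rule somos5_gauge[OF S2_0 \<tau>_nz somos T_somos T_nz]) (use h_T h_tau in simp_all)
  have Ap: "Ap = \<tau> 0 / T 0" and Am: "Am = \<tau> 1 / T 1"
    unfolding assms(25,26) T_def by simp_all
  have Bp: "Bp = S2 * s"
    unfolding assms(27) s_def S2_def T_def by simp
  \<comment> \<open>\<open>T 3\<close> lies outside the starting window. The closed formula and
    \<tau> 3 \<noteq> 0 show that it is nonzero, so that \<open>Bm\<close> can be evaluated.\<close>
  have T3: "\<tau> 3 = \<tau> 1 / T 1 * (- s) * T 3 / S2"
    using main[of 3] by simp
  then have "T 3 \<noteq> 0" using \<tau>_nz[of 3] by auto
  have "Bm = S2 * T 1 * \<tau> 3 / (T 3 * \<tau> 1)"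
    unfolding assms(28) S2_def T_def by simp
  then have Bm: "Bm = - s"
    using T3 \<open>T 3 \<noteq> 0\<close> \<tau>_nz[of 1] T_nz S2_0 by simp
  have ratio: "Bp / Bm = - \<sigma> (2 * v)"
    unfolding Bp Bm S2_def[symmetric] using s0 by simp
  have seq: "\<tau> = somos5_sigma_sequence g\<^sub>2' g\<^sub>3' u\<^sub>0 v Ap Am Bp"
  proof
    fix k
    have "- Bp / S2 = - s" using S2_0 by (simp add: Bp)
    then show "\<tau> k = somos5_sigma_sequence g\<^sub>2' g\<^sub>3' u\<^sub>0 v Ap Am Bp k"
      unfolding somos5_sigma_sequence_def Let_def assms(24)[symmetric] S2_def[symmetric] T_def[symmetric]
      by (simp only: main[of k] Ap Am Bp)
  qed
  have even: "\<tau> (2 * n) = Ap * Bp powi n * \<sigma> (u\<^sub>0 + 2 * of_int n * v) / \<sigma> (2 * v) powi n\<^sup>2" for n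
    using main[of "2 * n"] by (simp add: Ap Bp S2_def[symmetric] T_def)
  have odd: "\<tau> (2 * n + 1) = Am * Bm powi n * \<sigma> (u\<^sub>0 + (2 * of_int n + 1) * v) / \<sigma> (2 * v) powi n\<^sup>2" for n
    using main[of "2 * n + 1"] by (simp add: Am Bm S2_def[symmetric] T_def)
  show ?thesis using even odd ratio seq by blast
qed

end
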